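(* Let $n>2$ and let $p\in\Omega$. Let $\rho>0$ be a continuously differentiable function of $Q\ge 0$ satisfying: there is a constant $C_0>0$ such that $H'(Q)\leq C_0\,\rho(Q)$ wherever $\rho'(Q)>0$, and $H'(Q)\geq C_0^{-1}\rho(Q)$ wherever $\rho'(Q)<0$. Let the 1-forms $\Gamma=d\eta$ and $\omega$ smoothly satisfy, on $\Omega\setminus\{p\}$, $$d\omega=\Gamma\wedge\omega,\qquad \delta\left[\rho(Q)\omega\right]=\ast\left(\Gamma\wedge\ast\rho(Q)\omega\right),\qquad Q=|\omega|^2 .$$ If $H=H(Q)\in L^{2n/(n-2)}(\Omega)$ and if the function $f\equiv|\nabla\Gamma|+|\Gamma|^2$ is sufficiently small in $L^{n/2}(\Omega)$, then $H$ is an $H^{1,2}$-weak solution, in a neighborhood of the singularity $p$, of $$\Delta H+(-1)^{3n}\nabla\cdot\left\{\ast\left[\omega\wedge\ast\left(\rho'(Q)dQ\wedge\omega\right)\right]\right\}+CfH\geq 0$$ for some constant $C>0$; that is, there is a neighborhood $D\subset\Omega$ of $p$ such that $H\in H^{1,2}(D)$ and $$\int_D\left\{\left[\nabla H+T\right]\cdot\nabla\zeta-CfH\zeta\right\}d\Omega\leq 0$$ for all nonnegative $\zeta\in C_0^\infty(D)$, where $T=(-1)^{3n}\ast\{\omega\wedge\ast[\rho'(Q)dQ\wedge\omega]\}$.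
   Context: $\Omega$ is an open, bounded domain of $\mathbb{R}^n$ satisfying an interior sphere condition. Forms are scalar-valued; $\ast$ is the Euclidean Hodge star, $\langle\alpha,\beta\rangle=\ast(\alpha\wedge\ast\beta)$, $|\alpha|^2=\langle\alpha,\alpha\rangle$; $d$ is the exterior derivative with formal adjoint $\delta$, where $\delta\alpha=(-1)^{nk+n+1}\ast d\ast\alpha$ for $\alpha\in\Lambda^k$ (so $\delta\alpha=-\partial_i\alpha_i$ on 1-forms). 1-forms are identified with vector fields via the Euclidean metric, so $\nabla\cdot$ of a 1-form is its divergence. $Q=|\omega|^2$ is viewed as a function of $\mathbf{x}$. The function $H$ is defined by $H'(Q)=\frac12\rho(Q)+Q\rho'(Q)$ (prime is $d/dQ$), normalized by $H(0)=0$. "Sufficiently small in $L^{n/2}(\Omega)$" means that $\|f\|_{L^{n/2}(\Omega)}$ is less than some positive constant depending only on $n$ and $C_0$. $H^{1,2}$ is the Sobolev space of $L^2$ functions with $L^2$ first derivatives. *)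

theory Defs
  imports "HOL-Analysis.Analysis"
begin

section \<open>Exterior algebra of Euclidean space\<close>

text \<open>
  An element of the full exterior algebra of \<open>real ^ 'n\<close> is stored by its coefficients
  with respect to the monomials \<open>dx\<^sub>I\<close>, the wedge product of the \<open>dx\<^sub>i\<close>, \<open>i \<in> I\<close>, taken in
  increasing order; here \<open>I\<close> ranges over all subsets of the index type.  The linear order
  on \<open>'n\<close> fixes the orientation.
\<close>

type_synonym 'n form = "real ^ ('n set)"
type_synonym 'n point = "real ^ 'n"

definition homogeneous :: "nat \<Rightarrow> 'n::finite form \<Rightarrow> bool" where
  "homogeneous k \<alpha> \<longleftrightarrow> (\<forall>I. card I \<noteq> k \<longrightarrow> \<alpha> $ I = 0)"

text \<open>For disjoint \<open>I\<close>, \<open>J\<close>: \<open>dx\<^sub>I \<and> dx\<^sub>J = shuffle_sign I J \<cdot> dx\<^bsub>I \<union> J\<^esub>\<close>.\<close>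

definition shuffle_sign :: "'n::{finite,linorder} set \<Rightarrow> 'n set \<Rightarrow> real" where
  "shuffle_sign I J = (-1) ^ card {(i, j). i \<in> I \<and> j \<in> J \<and> j < i}"

definition wedge :: "'n::{finite,linorder} form \<Rightarrow> 'n form \<Rightarrow> 'n form"
    (infixr \<open>\<and>\<^sub>\<Lambda>\<close> 75) where
  "\<alpha> \<and>\<^sub>\<Lambda> \<beta> = (\<chi> K. \<Sum>I\<in>Pow K. shuffle_sign I (K - I) * \<alpha> $ I * \<beta> $ (K - I))"

text \<open>The Hodge star sends \<open>dx\<^sub>I\<close> to \<open>shuffle_sign I (- I) \<cdot> dx\<^bsub>- I\<^esub>\<close>, so that
  \<open>dx\<^sub>I \<and> \<star> dx\<^sub>I\<close> is the volume form.\<close>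

definition hodge :: "'n::{finite,linorder} form \<Rightarrow> 'n form" (\<open>\<star> _\<close> [81] 80) where
  "\<star> \<alpha> = (\<chi> J. shuffle_sign (- J) J * \<alpha> $ (- J))"

definition form_inner :: "'n::{finite,linorder} form \<Rightarrow> 'n form \<Rightarrow> real" where
  "form_inner \<alpha> \<beta> = (\<star> (\<alpha> \<and>\<^sub>\<Lambda> \<star> \<beta>)) $ {}"

definition dx :: "'n::finite \<Rightarrow> 'n form" where
  "dx i = axis {i} 1"

text \<open>The vector identified with a 1-form by the Euclidean metric.\<close>

definition sharp :: "'n::finite form \<Rightarrow> 'n point" where
  "sharp \<alpha> = (\<chi> i. \<alpha> $ {i})"


section \<open>Differential forms\<close>

definition partial_deriv ::
    "'n::finite \<Rightarrow> ('n point \<Rightarrow> 'b::real_normed_vector) \<Rightarrow> 'n point \<Rightarrow> 'b" where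
  "partial_deriv i f x = frechet_derivative f (at x) (axis i 1)"

definition grad :: "('n::finite point \<Rightarrow> real) \<Rightarrow> 'n point \<Rightarrow> 'n point" where
  "grad f x = (\<chi> i. partial_deriv i f x)"

definition zero_form :: "('n::finite point \<Rightarrow> real) \<Rightarrow> 'n point \<Rightarrow> 'n form" where
  "zero_form g x = axis {} (g x)"

definition ext_d ::
    "('n::{finite,linorder} point \<Rightarrow> 'n form) \<Rightarrow> 'n point \<Rightarrow> 'n form" where
  "ext_d \<alpha> x = (\<Sum>i\<in>UNIV. dx i \<and>\<^sub>\<Lambda> partial_deriv i \<alpha> x)"

text \<open>The argument \<open>k\<close> is the degree of the form.\<close>

definition codiff ::
    "nat \<Rightarrow> ('n::{finite,linorder} point \<Rightarrow> 'n form) \<Rightarrow> 'n point \<Rightarrow> 'n form" where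
  "codiff k \<alpha> x =
     (-1) ^ (CARD('n) * k + CARD('n) + 1) *\<^sub>R \<star> (ext_d (\<lambda>y. \<star> \<alpha> y) x)"

definition norm_nabla :: "('n::{finite,linorder} point \<Rightarrow> 'n form) \<Rightarrow> 'n point \<Rightarrow> real" where
  "norm_nabla \<alpha> x =
     sqrt (\<Sum>j\<in>UNIV. form_inner (partial_deriv j \<alpha> x) (partial_deriv j \<alpha> x))"


section \<open>Function spaces and domains\<close>

text \<open>The predicates \<open>Ck_on\<close> and \<open>smooth_on\<close> are meant for open sets.\<close>

primrec Ck_on ::
    "nat \<Rightarrow> 'n::finite point set \<Rightarrow> ('n point \<Rightarrow> 'b::real_normed_vector) \<Rightarrow> bool" where
  "Ck_on 0 S f \<longleftrightarrow> continuous_on S f"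
| "Ck_on (Suc k) S f \<longleftrightarrow>
     (\<forall>x\<in>S. f differentiable (at x)) \<and> (\<forall>i. Ck_on k S (partial_deriv i f))"

definition smooth_on ::
    "'n::finite point set \<Rightarrow> ('n point \<Rightarrow> 'b::real_normed_vector) \<Rightarrow> bool" where
  "smooth_on S f \<longleftrightarrow> (\<forall>k. Ck_on k S f)"

definition test_function :: "'n::finite point set \<Rightarrow> ('n point \<Rightarrow> real) \<Rightarrow> bool" where
  "test_function D \<phi> \<longleftrightarrow>
     smooth_on UNIV \<phi> \<and> compact (closure {x. \<phi> x \<noteq> 0}) \<and> closure {x. \<phi> x \<noteq> 0} \<subseteq> D"

definition Lp_on ::
    "real \<Rightarrow> 'a::euclidean_space set \<Rightarrow> ('a \<Rightarrow> 'b::euclidean_space) \<Rightarrow> bool" where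
  "Lp_on q S u \<longleftrightarrow> u \<in> borel_measurable (lebesgue_on S) \<and>
     integrable (lebesgue_on S) (\<lambda>x. norm (u x) powr q)"

definition Lp_norm ::
    "real \<Rightarrow> 'a::euclidean_space set \<Rightarrow> ('a \<Rightarrow> 'b::euclidean_space) \<Rightarrow> real" where
  "Lp_norm q S u = (\<integral>x. norm (u x) powr q \<partial>lebesgue_on S) powr (1 / q)"

text \<open>\<open>u\<close> lies in the Sobolev space \<open>H\<^sup>1\<^sup>,\<^sup>2(D)\<close>, with weak gradient \<open>v\<close>.\<close>

definition H12_gradient ::
    "'n::finite point set \<Rightarrow> ('n point \<Rightarrow> real) \<Rightarrow> ('n point \<Rightarrow> 'n point) \<Rightarrow> bool" where
  "H12_gradient D u v \<longleftrightarrow> Lp_on 2 D u \<and> Lp_on 2 D v \<and>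
     (\<forall>\<phi>. test_function D \<phi> \<longrightarrow>
        (\<integral>x. u x *\<^sub>R grad \<phi> x \<partial>lebesgue_on D) = - (\<integral>x. \<phi> x *\<^sub>R v x \<partial>lebesgue_on D))"

definition interior_sphere_condition :: "'a::euclidean_space set \<Rightarrow> bool" where
  "interior_sphere_condition \<Omega> \<longleftrightarrow>
     (\<forall>y\<in>frontier \<Omega>. \<exists>c r. 0 < r \<and> ball c r \<subseteq> \<Omega> \<and> dist c y = r)"


section \<open>Consistency of the conventions\<close>

lemma shuffle_sign_sq: "shuffle_sign I J * shuffle_sign I J = 1"
  by (simp add: shuffle_sign_def flip: power_mult_distrib)

lemma shuffle_sign_empty [simp]: "shuffle_sign I {} = 1" "shuffle_sign {} I = 1"
  by (simp_all add: shuffle_sign_def)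

lemma form_inner_eq_inner: "form_inner \<alpha> \<beta> = \<alpha> \<bullet> \<beta>"
proof -
  have "form_inner \<alpha> \<beta> =
      (\<Sum>I\<in>UNIV. (shuffle_sign I (- I) * shuffle_sign I (- I)) * (\<alpha> $ I * \<beta> $ I))"
    by (simp add: form_inner_def hodge_def wedge_def Compl_eq_Diff_UNIV [symmetric] ac_simps)
  then show ?thesis
    by (simp add: shuffle_sign_sq inner_vec_def)
qed

lemma linear_hodge: "linear (hodge :: 'n::{finite,linorder} form \<Rightarrow> 'n form)"
  by (rule linearI) (simp_all add: hodge_def vec_eq_iff algebra_simps)

lemma partial_deriv_hodge:
  assumes "\<alpha> differentiable (at x)"
  shows "partial_deriv i (\<lambda>y. \<star> \<alpha> y) x = \<star> (partial_deriv i \<alpha> x)"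
proof -
  have "((\<lambda>y. \<star> \<alpha> y) has_derivative (\<lambda>h. \<star> (frechet_derivative \<alpha> (at x) h))) (at x)"
    using bounded_linear.has_derivative
        [OF linear_hodge [unfolded linear_conv_bounded_linear]
         assms [unfolded frechet_derivative_works]] .
  from frechet_derivative_at [OF this] show ?thesis
    by (simp add: partial_deriv_def fun_eq_iff)
qed

lemma dx_wedge_nth:
  "(dx i \<and>\<^sub>\<Lambda> \<beta>) $ K =
     (if i \<in> K then shuffle_sign {i} (K - {i}) * \<beta> $ (K - {i}) else 0)"
proof -
  have "(dx i \<and>\<^sub>\<Lambda> \<beta>) $ K =
      (\<Sum>I\<in>Pow K. if I = {i} then shuffle_sign {i} (K - {i}) * \<beta> $ (K - {i}) else 0)"
    unfolding wedge_def dx_def axis_def vec_lambda_beta by (rule sum.cong) simp_all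
  then show ?thesis by simp
qed

text \<open>On 1-forms, \<open>codiff\<close> is minus the divergence.\<close>

lemma codiff_1_form:
  fixes \<alpha> :: "'n::{finite,linorder} point \<Rightarrow> 'n form"
  assumes "\<alpha> differentiable (at x)"
  shows "codiff 1 \<alpha> x $ {} = - (\<Sum>i\<in>UNIV. partial_deriv i \<alpha> x $ {i})"
proof -
  have "(\<Sum>i\<in>UNIV. (dx i \<and>\<^sub>\<Lambda> \<star> partial_deriv i \<alpha> x) $ UNIV) =
      (\<Sum>i\<in>UNIV. (shuffle_sign {i} (- {i}) * shuffle_sign {i} (- {i})) *
         partial_deriv i \<alpha> x $ {i})"
    by (rule sum.cong) (simp_all add: dx_wedge_nth hodge_def flip: Compl_eq_Diff_UNIV)
  then have "ext_d (\<lambda>y. \<star> \<alpha> y) x $ UNIV = (\<Sum>i\<in>UNIV. partial_deriv i \<alpha> x $ {i})"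
    by (simp add: ext_d_def partial_deriv_hodge [OF assms] shuffle_sign_sq)
  moreover have "(-1 :: real) ^ (CARD('n) * 1 + CARD('n) + 1) = -1"
    by (simp add: minus_one_power_iff)
  ultimately show ?thesis
    unfolding codiff_def by (simp add: hodge_def)
qed

end

theory Submission
  imports Defs
begin

text \<open>
  Write \<open>w\<close>, \<open>\<gamma>\<close> for the vector fields of \<open>\<omega>\<close>, \<open>\<Gamma>\<close> and \<open>q = \<nabla>Q\<close>.  Then
  \<open>\<nabla>H + T = (\<rho>/2) q + \<rho>' (w \<bullet> q) w\<close> is a uniformly elliptic expression in \<open>q\<close>, and away from \<open>p\<close> its
  weak divergence is a zero-order term \<open>S\<close>.  Twisted closedness of \<open>\<omega>\<close> and the bounds on \<open>H'\<close>
  make the part of \<open>S\<close> quadratic in \<open>\<nabla>\<omega>\<close> positive; it absorbs the cross terms, so \<open>S \<ge> - C f H\<close>.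
  As \<open>\<rho>\<close> is only \<open>C\<^sup>1\<close>, the divergence is computed by difference quotients on the test function side.

  The point \<open>p\<close> has vanishing capacity.  Testing with \<open>\<kappa>\<^sup>2 H\<close>, where the cutoff \<open>\<kappa>\<close> vanishes near \<open>p\<close>, gives
  an energy estimate with right-hand side \<open>\<integral> f H\<^sup>2 \<kappa>\<^sup>2 + \<integral> |\<nabla>\<kappa>|\<^sup>2 H\<^sup>2\<close>; by Young's inequality it is bounded
  uniformly in \<open>\<kappa>\<close> by the norms of \<open>f\<close> in \<open>L\<close>-\<open>n/2\<close>, of \<open>\<nabla>\<kappa>\<close> in \<open>L\<close>-\<open>n\<close> and of \<open>H\<close> in \<open>L\<close>-\<open>2n/(n-2)\<close>.
  Hence \<open>\<nabla>H\<close> is square integrable near \<open>p\<close>, and the cutoff can be removed from the weak formulations.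
\<close>

section \<open>Functions with continuous gradient\<close>

text \<open>Twisted closedness makes the derivative of \<rho> w along w equal to \<open>P\<close> up
  to terms linear in \<gamma>. For the divergence one then needs only the integral identity for
  \<partial>_j V_i \<partial>_i \<psi>_j and div V div \<psi>, with V = \<rho> w and \<psi> =
  \<zeta> w: the equation for \<delta> prescribes div V, and the leftover terms linear in the
  gradient of \<zeta> are removed by adding the divergence of \<zeta> Y for a suitable field Y. As V
  is only once differentiable, every derivative is carried as an explicit continuous gradient and no
  second derivative of V occurs. The singularity is met twice, with different exponents. Before the
  gradient of H is known to be square integrable, the cutoff may enter only through the L^n norm of
  its gradient, which is scale invariant and hence merely bounded; n/2, n and 2n/(n-2) are the
  exponents for which Young's inequality closes. Once the energy is finite, the L^2 norm of the
  cutoff's gradient suffices, and this one tends to 0 because n > 2.\<close>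

definition C1_grad :: "'a::euclidean_space set \<Rightarrow> ('a \<Rightarrow> real) \<Rightarrow> ('a \<Rightarrow> 'a) \<Rightarrow> bool" where
  "C1_grad S f g \<longleftrightarrow>
     (\<forall>x\<in>S. (f has_derivative (\<lambda>h. g x \<bullet> h)) (at x)) \<and> continuous_on S g"

lemma C1_gradD: "C1_grad S f g \<Longrightarrow> x \<in> S \<Longrightarrow> (f has_derivative (\<lambda>h. g x \<bullet> h)) (at x)"
  by (simp add: C1_grad_def)

lemma C1_grad_cont_grad: "C1_grad S f g \<Longrightarrow> continuous_on S g"
  by (simp add: C1_grad_def)

lemma C1_grad_cont: "C1_grad S f g \<Longrightarrow> continuous_on S f"
  using C1_gradD has_derivative_continuous continuous_at_imp_continuous_on by metis

lemma C1_grad_subset: "C1_grad S f g \<Longrightarrow> T \<subseteq> S \<Longrightarrow> C1_grad T f g"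
  unfolding C1_grad_def by (meson continuous_on_subset subsetD)

lemma C1_grad_const: "C1_grad S (\<lambda>x. c) (\<lambda>x. 0)"
  by (simp add: C1_grad_def)

lemma C1_grad_add:
  "C1_grad S f g \<Longrightarrow> C1_grad S f' g' \<Longrightarrow> C1_grad S (\<lambda>x. f x + f' x) (\<lambda>x. g x + g' x)"
  unfolding C1_grad_def
  by (auto simp: inner_add_left[abs_def] fun_eq_iff intro!: has_derivative_eq_rhs[OF has_derivative_add] continuous_on_add)

lemma C1_grad_mult:
  assumes "C1_grad S f g" "C1_grad S f' g'"
  shows "C1_grad S (\<lambda>x. f x * f' x) (\<lambda>x. f x *\<^sub>R g' x + f' x *\<^sub>R g x)"
proof -
  have "((\<lambda>x. f x * f' x) has_derivative (\<lambda>h. (f x *\<^sub>R g' x + f' x *\<^sub>R g x) \<bullet> h)) (at x)"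
    if "x \<in> S" for x
    using has_derivative_mult[OF C1_gradD[OF assms(1) that] C1_gradD[OF assms(2) that]]
    by (simp add: inner_add_left mult.commute)
  then show ?thesis
    using C1_grad_cont[OF assms(1)] C1_grad_cont[OF assms(2)] assms
    unfolding C1_grad_def by (auto intro!: continuous_intros)
qed

lemma C1_grad_cmult: "C1_grad S f g \<Longrightarrow> C1_grad S (\<lambda>x. c * f x) (\<lambda>x. c *\<^sub>R g x)"
  using C1_grad_mult[OF C1_grad_const[of S c]] by simp

lemma C1_grad_diff:
  "C1_grad S f g \<Longrightarrow> C1_grad S f' g' \<Longrightarrow> C1_grad S (\<lambda>x. f x - f' x) (\<lambda>x. g x - g' x)"
  using C1_grad_add[of S f g "\<lambda>x. -1 * f' x" "\<lambda>x. -1 *\<^sub>R g' x"] C1_grad_cmult[of S f' g' "-1"]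
  by simp

lemma C1_grad_sum:
  "finite I \<Longrightarrow> (\<And>i. i \<in> I \<Longrightarrow> C1_grad S (f i) (g i)) \<Longrightarrow>
    C1_grad S (\<lambda>x. \<Sum>i\<in>I. f i x) (\<lambda>x. \<Sum>i\<in>I. g i x)"
  by (induction I rule: finite_induct) (auto intro: C1_grad_const C1_grad_add)

text \<open>A derivative of \<phi> within \<open>T\<close> is enough. With \<open>T\<close> the
  half-line and f = |\<omega>|^2 this covers the zeros of \<omega>, where \<rho> has only a
  one-sided derivative. In return f has to take values in \<open>T\<close> everywhere, so that the
  chain rule can be applied within the range of f.\<close>

lemma C1_grad_compose:
  assumes f: "C1_grad S f g" and fT: "\<And>x. f x \<in> T"
    and \<phi>: "\<And>t. t \<in> T \<Longrightarrow> (\<phi> has_real_derivative \<phi>' t) (at t within T)"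
    and c: "continuous_on T \<phi>'"
  shows "C1_grad S (\<lambda>x. \<phi> (f x)) (\<lambda>x. \<phi>' (f x) *\<^sub>R g x)"
proof -
  have "((\<lambda>x. \<phi> (f x)) has_derivative (\<lambda>h. (\<phi>' (f x) *\<^sub>R g x) \<bullet> h)) (at x)" if "x \<in> S" for x
  proof -
    have "(\<phi> has_derivative (*) (\<phi>' (f x))) (at (f x) within f ` UNIV)"
      using \<phi>[OF fT[of x], unfolded has_field_derivative_def]
      by (rule has_derivative_subset) (use fT in auto)
    from has_derivative_in_compose[OF C1_gradD[OF f that] this] show ?thesis by simp
  qed
  moreover have "continuous_on S (\<lambda>x. \<phi>' (f x) *\<^sub>R g x)"
    by (intro continuous_on_scaleR C1_grad_cont_grad[OF f], rule continuous_on_compose2[OF c C1_grad_cont[OF f]]) (use fT in auto)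
  ultimately show ?thesis
    unfolding C1_grad_def by blast
qed

lemma C1_grad_zero_outside:
  assumes "C1_grad UNIV f g" "closed K" "\<And>x. x \<notin> K \<Longrightarrow> f x = 0" "x \<notin> K"
  shows "g x = 0"
proof -
  have "(f has_derivative (\<lambda>h. 0)) (at x)"
    by (rule has_derivative_transform_within_open[of "\<lambda>_. 0" _ _ _ "- K"])
      (use assms in auto)
  from has_derivative_unique[OF this C1_gradD[OF assms(1) UNIV_I]]
  have "0 = g x \<bullet> g x" by metis
  then show ?thesis by simp
qed

text \<open>\<open>U\<close> and the complement of \<open>K\<close> are open and cover the space,
  and on the second set the product is identically 0. So f may be singular or arbitrary outside
  \<open>U\<close>; this is how fields singular at p are multiplied by test functions that vanish
  near p.\<close>

lemma C1_grad_mult_extend: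
  assumes f: "C1_grad U f g" and \<zeta>: "C1_grad UNIV \<zeta> z" and "open U" "closed K" "K \<subseteq> U"
    and 0: "\<And>x. x \<notin> K \<Longrightarrow> \<zeta> x = 0"
  shows "C1_grad UNIV (\<lambda>x. \<zeta> x * f x) (\<lambda>x. \<zeta> x *\<^sub>R g x + f x *\<^sub>R z x)"
proof -
  have z0: "z x = 0" if "x \<notin> K" for x
    using C1_grad_zero_outside[OF \<zeta> \<open>closed K\<close> 0 that] .
  have 1: "C1_grad U (\<lambda>x. \<zeta> x * f x) (\<lambda>x. \<zeta> x *\<^sub>R g x + f x *\<^sub>R z x)"
    by (rule C1_grad_mult[OF C1_grad_subset[OF \<zeta>] f]) simp
  have 2: "C1_grad (- K) (\<lambda>x. \<zeta> x * f x) (\<lambda>x. \<zeta> x *\<^sub>R g x + f x *\<^sub>R z x)"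
  proof -
    have "((\<lambda>x. \<zeta> x * f x) has_derivative (\<lambda>h. 0)) (at x)" if "x \<in> - K" for x
      by (rule has_derivative_transform_within_open[of "\<lambda>_. 0" _ _ _ "- K"])
        (use assms that in auto)
    moreover have "continuous_on (- K) (\<lambda>x. \<zeta> x *\<^sub>R g x + f x *\<^sub>R z x)"
      by (rule continuous_on_eq[of _ "\<lambda>_. 0"]) (use 0 z0 in auto)
    moreover have "(\<lambda>h. (\<zeta> x *\<^sub>R g x + f x *\<^sub>R z x) \<bullet> h) = (\<lambda>h. 0)" if "x \<in> - K" for x
      using 0 z0 that by auto
    ultimately show ?thesis unfolding C1_grad_def by metis
  qed
  have "U \<union> - K = UNIV" using \<open>K \<subseteq> U\<close> by auto
  then show ?thesis
    using 1 2 continuous_on_open_Un[OF \<open>open U\<close>, of "- K"] \<open>closed K\<close>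
    unfolding C1_grad_def by (metis (no_types, lifting) UnE open_Compl)
qed

lemma C1_grad_bounded:
  assumes "C1_grad UNIV f g" "compact K" "\<And>x. x \<notin> K \<Longrightarrow> f x = 0"
  obtains L where "L \<ge> 0" "\<And>x. norm (g x) \<le> L"
proof -
  have "compact (g ` K)"
    using assms C1_grad_cont_grad continuous_on_subset compact_continuous_image by (metis top_greatest)
  then obtain L where L: "\<forall>y\<in>g ` K. norm y \<le> L" using compact_imp_bounded bounded_iff by metis
  show ?thesis
  proof (rule that[of "max L 0"])
    show "norm (g x) \<le> max L 0" for x
      using L C1_grad_zero_outside[OF assms(1) compact_imp_closed[OF assms(2)] assms(3)]
      by (cases "x \<in> K") (auto simp: le_max_iff_disj)
  qed simp
qed

lemma C1_grad_Lipschitz: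
  assumes f: "C1_grad UNIV f g" and L: "\<And>x. norm (g x) \<le> L"
  shows "\<bar>f y - f x\<bar> \<le> L * norm (y - x)"
proof -
  have "norm (f y - f x) \<le> L * norm (y - x)"
  proof (rule differentiable_bound[of UNIV f "\<lambda>x h. g x \<bullet> h"])
    show "onorm (\<lambda>h. g x \<bullet> h) \<le> L" for x
      by (rule onorm_le) (metis Cauchy_Schwarz_ineq2 L mult_right_mono norm_ge_zero order_trans real_norm_def)
  qed (use C1_gradD[OF f] in auto)
  then show ?thesis by simp
qed

section \<open>Integration by parts\<close>

lemma integrable_compact_support:
  fixes f :: "'a::euclidean_space \<Rightarrow> real"
  assumes "continuous_on UNIV f" "compact K" "\<And>x. x \<notin> K \<Longrightarrow> f x = 0"
  shows "integrable lborel f"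
proof -
  have "integrable lborel (\<lambda>x. indicator K x *\<^sub>R f x)"
    using borel_integrable_compact[OF assms(2) continuous_on_subset[OF assms(1)]] by simp
  also have "(\<lambda>x. indicator K x *\<^sub>R f x) = f"
    using assms(3) by (force simp: indicator_def)
  finally show ?thesis .
qed

lemma integrable_indicator_cball:
  "integrable lborel (\<lambda>x. indicator (cball (c::'a::euclidean_space) r) x :: real)"
  by (rule integrable_real_indicator) (use emeasure_lborel_cball_finite[of c r] in auto)

lemma integral_lborel_translate:
  fixes f :: "'a::euclidean_space \<Rightarrow> real"
  assumes [measurable]: "f \<in> borel_measurable borel"
  shows "(\<integral>x. f (x + c) \<partial>lborel) = integral\<^sup>L lborel f"
proof -
  have "integral\<^sup>L lborel f = integral\<^sup>L (distr lborel borel ((+) c)) f"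
    by (simp add: lborel_distr_plus)
  also have "\<dots> = (\<integral>x. f (x + c) \<partial>lborel)"
    by (subst integral_distr) (auto simp: add.commute)
  finally show ?thesis ..
qed

lemma has_derivative_directional_seq:
  fixes f :: "'a::real_normed_vector \<Rightarrow> real"
  assumes "(f has_derivative f') (at x)"
  shows "(\<lambda>k. real (Suc k) * (f (x + (1 / real (Suc k)) *\<^sub>R e) - f x)) \<longlonglongrightarrow> f' e"
proof -
  have "((\<lambda>t. x + t *\<^sub>R e) has_derivative (\<lambda>t. t *\<^sub>R e)) (at (0::real))"
    by (auto intro!: derivative_eq_intros)
  moreover have "(f has_derivative f') (at ((\<lambda>t. x + t *\<^sub>R e) (0::real)))"
    using assms by simp
  ultimately have "((\<lambda>t. f (x + t *\<^sub>R e)) has_derivative (\<lambda>t. f' (t *\<^sub>R e))) (at 0)"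
    using has_derivative_compose by blast
  moreover have "(\<lambda>t. f' (t *\<^sub>R e)) = (*) (f' e)"
    using has_derivative_linear[OF assms] by (auto simp: linear_scale fun_eq_iff)
  ultimately have "((\<lambda>t. f (x + t *\<^sub>R e)) has_real_derivative f' e) (at 0)"
    unfolding has_field_derivative_def by metis
  then have "((\<lambda>t. (f (x + t *\<^sub>R e) - f x) / t) \<longlongrightarrow> f' e) (at 0)"
    by (simp add: DERIV_def)
  moreover have "filterlim (\<lambda>k. 1 / real (Suc k)) (at 0) sequentially"
    unfolding filterlim_at using LIMSEQ_inverse_real_of_nat by (auto simp: inverse_eq_divide)
  ultimately have "(\<lambda>k. (f (x + (1 / real (Suc k)) *\<^sub>R e) - f x) / (1 / real (Suc k))) \<longlonglongrightarrow> f' e"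
    by (rule filterlim_compose)
  then show ?thesis by (simp add: field_simps)
qed

lemma has_derivative_directional_seq_neg:
  fixes f :: "'a::real_normed_vector \<Rightarrow> real"
  assumes "(f has_derivative f') (at x)"
  shows "(\<lambda>k. real (Suc k) * (f (x - (1 / real (Suc k)) *\<^sub>R e) - f x)) \<longlonglongrightarrow> - f' e"
  using has_derivative_directional_seq[OF assms, of "- e"] linear_neg[OF has_derivative_linear[OF assms]]
  by simp

text \<open>Supplies one ball outside of which all difference quotients with steps of length at most
  r vanish, and with it a common integrable bound.\<close>

lemma compact_support_enlarge:
  fixes K :: "'a::euclidean_space set"
  assumes "compact K"
  obtains R where "R > 0" "\<And>x h. x + h \<in> K \<Longrightarrow> norm h \<le> r \<Longrightarrow> x \<in> cball 0 R"
proof -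
  obtain B where B: "\<And>x. x \<in> K \<Longrightarrow> norm x \<le> B"
    using assms compact_imp_bounded bounded_iff by metis
  show ?thesis
  proof (rule that[of "max 1 (B + r)"])
    fix x h assume "x + h \<in> K" "norm h \<le> r"
    then have "norm x \<le> B + r"
      using B[of "x + h"] norm_triangle_ineq4[of "x + h" h] by simp
    then show "x \<in> cball 0 (max 1 (B + r))" by simp
  qed simp
qed

text \<open>Translation invariance makes every difference quotient of f integrate to 0. The
  Lipschitz bound on a fixed ball dominates them all, so their limit integrates to 0 as
  well.\<close>

lemma integral_gradient_eq_0:
  fixes f :: "'a::euclidean_space \<Rightarrow> real"
  assumes f: "C1_grad UNIV f g" and K: "compact K" "\<And>x. x \<notin> K \<Longrightarrow> f x = 0"
  shows "(\<integral>x. g x \<bullet> e \<partial>lborel) = 0"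
proof -
  obtain L where L: "L \<ge> 0" "\<And>x. norm (g x) \<le> L"
    using C1_grad_bounded[OF f K] by blast
  obtain R where R: "R > 0" "\<And>x h. x + h \<in> K \<Longrightarrow> norm h \<le> norm e \<Longrightarrow> x \<in> cball 0 R"
    using compact_support_enlarge[OF K(1)] by metis
  have [measurable]: "f \<in> borel_measurable borel" "g \<in> borel_measurable borel"
    using C1_grad_cont[OF f] C1_grad_cont_grad[OF f] by (auto intro: borel_measurable_continuous_onI)
  have int: "integrable lborel f"
    by (rule integrable_compact_support[OF C1_grad_cont[OF f] K])
  define s where "s k x = real (Suc k) * (f (x + (1 / real (Suc k)) *\<^sub>R e) - f x)" for k x
  have [measurable]: "s k \<in> borel_measurable borel" for k
    unfolding s_def by measurable
  have lim: "(\<lambda>k. integral\<^sup>L lborel (s k)) \<longlonglongrightarrow> (\<integral>x. g x \<bullet> e \<partial>lborel)"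
  proof (rule integral_dominated_convergence[where w="\<lambda>x. L * norm e * indicator (cball 0 R) x"])
    show "AE x in lborel. (\<lambda>k. s k x) \<longlonglongrightarrow> g x \<bullet> e"
      unfolding s_def using has_derivative_directional_seq[OF C1_gradD[OF f UNIV_I]] by (intro AE_I2)
    show "AE x in lborel. norm (s k x) \<le> L * norm e * indicator (cball 0 R) x" for k
    proof (intro AE_I2)
      fix x :: 'a
      have le: "norm ((1 / real (Suc k)) *\<^sub>R e) \<le> norm e"
        by (simp add: field_simps mult_le_cancel_right1)
      show "norm (s k x) \<le> L * norm e * indicator (cball 0 R) x"
      proof (cases "x \<in> cball 0 R")
        case True
        have "norm (s k x) \<le> real (Suc k) * (L * norm ((1 / real (Suc k)) *\<^sub>R e))"
          using C1_grad_Lipschitz[OF f L(2), of "x + (1 / real (Suc k)) *\<^sub>R e" x]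
          unfolding s_def real_norm_def abs_mult by (intro mult_mono) auto
        then show ?thesis using True by (simp del: of_nat_Suc)
      next
        case False
        then have "x \<notin> K" "x + (1 / real (Suc k)) *\<^sub>R e \<notin> K"
          using R(2)[of x 0] R(2)[OF _ le, of x] by auto
        then have "f x = 0" "f (x + (1 / real (Suc k)) *\<^sub>R e) = 0" using K(2) by blast+
        then have "s k x = 0" unfolding s_def by (simp only:) simp
        then show ?thesis using False by simp
      qed
    qed
    show "integrable lborel (\<lambda>x. L * norm e * indicator (cball 0 R) x)"
      by (intro integrable_mult_right integrable_indicator_cball)
  qed measurable
  have "integral\<^sup>L lborel (s k) = 0" for k
  proof -
    have "integrable lborel (\<lambda>x. f (x + (1 / real (Suc k)) *\<^sub>R e))"
    proof (rule integrable_compact_support[where K="cball 0 R"])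
      show "continuous_on UNIV (\<lambda>x. f (x + (1 / real (Suc k)) *\<^sub>R e))"
        by (rule continuous_on_compose2[OF C1_grad_cont[OF f]]) (auto intro!: continuous_intros)
      have le: "norm ((1 / real (Suc k)) *\<^sub>R e) \<le> norm e"
        by (simp add: field_simps mult_le_cancel_right1)
      show "f (x + (1 / real (Suc k)) *\<^sub>R e) = 0" if "x \<notin> cball 0 R" for x
        using that R(2)[OF _ le, of x] K(2) by auto
    qed auto
    then show ?thesis
      unfolding s_def using int by (simp add: integral_lborel_translate del: of_nat_Suc)
  qed
  then show ?thesis using LIMSEQ_unique[OF lim] by simp
qed

lemma C1_grad_translate:
  assumes "C1_grad UNIV f g"
  shows "C1_grad UNIV (\<lambda>x. f (x + c)) (\<lambda>x. g (x + c))"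
proof -
  have "((\<lambda>x. f (x + c)) has_derivative (\<lambda>h. g (x + c) \<bullet> h)) (at x)" for x
  proof -
    have "((\<lambda>x. x + c) has_derivative (\<lambda>h. h)) (at x)"
      by (auto intro!: derivative_eq_intros)
    from has_derivative_compose[OF this C1_gradD[OF assms UNIV_I]] show ?thesis .
  qed
  moreover have "continuous_on UNIV (\<lambda>x. g (x + c))"
    by (rule continuous_on_compose2[OF C1_grad_cont_grad[OF assms]]) (auto intro!: continuous_intros)
  ultimately show ?thesis by (simp add: C1_grad_def)
qed

text \<open>For \<open>C\<^sup>2\<close> functions this is two integrations by parts and the symmetry of second derivatives;
  difference quotients make it work for \<open>C\<^sup>1\<close> functions.\<close>

lemma integral_gradient_swap:
  fixes f :: "'a::euclidean_space \<Rightarrow> real"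
  assumes f: "C1_grad UNIV f g" "compact K" "\<And>x. x \<notin> K \<Longrightarrow> f x = 0"
    and f': "C1_grad UNIV f' g'" "compact K'" "\<And>x. x \<notin> K' \<Longrightarrow> f' x = 0"
  shows "(\<integral>x. (g x \<bullet> e) * (g' x \<bullet> e') \<partial>lborel) = (\<integral>x. (g x \<bullet> e') * (g' x \<bullet> e) \<partial>lborel)"
proof -
  obtain L where L: "L \<ge> 0" "\<And>x. norm (g x) \<le> L"
    using C1_grad_bounded[OF f] by blast
  obtain L' where L': "L' \<ge> 0" "\<And>x. norm (g' x) \<le> L'"
    using C1_grad_bounded[OF f'] by blast
  obtain R where R: "R > 0" "\<And>x h. x + h \<in> K \<Longrightarrow> norm h \<le> norm e \<Longrightarrow> x \<in> cball 0 R"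
    using compact_support_enlarge[OF f(2)] by metis
  obtain R' where R': "R' > 0" "\<And>x h. x + h \<in> K' \<Longrightarrow> norm h \<le> norm e \<Longrightarrow> x \<in> cball 0 R'"
    using compact_support_enlarge[OF f'(2)] by metis
  have g0: "g x = 0" if "x \<notin> K" for x
    using C1_grad_zero_outside[OF f(1) compact_imp_closed[OF f(2)] f(3) that] .
  have g'0: "g' x = 0" if "x \<notin> K'" for x
    using C1_grad_zero_outside[OF f'(1) compact_imp_closed[OF f'(2)] f'(3) that] .
  have cont: "continuous_on UNIV f" "continuous_on UNIV g" "continuous_on UNIV f'" "continuous_on UNIV g'"
    using C1_grad_cont[OF f(1)] C1_grad_cont_grad[OF f(1)]
      C1_grad_cont[OF f'(1)] C1_grad_cont_grad[OF f'(1)] by auto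
  then have [measurable]: "f \<in> borel_measurable borel" "g \<in> borel_measurable borel"
    "f' \<in> borel_measurable borel" "g' \<in> borel_measurable borel"
    by (auto intro: borel_measurable_continuous_onI)
  define t where "t k = (1 / real (Suc k)) *\<^sub>R e" for k
  have le: "norm (t k) \<le> norm e" for k
    by (simp add: t_def field_simps mult_le_cancel_right1)
  define s where "s k x = real (Suc k) * (f (x + t k) - f x)" for k x
  define s' where "s' k x = real (Suc k) * (f' (x - t k) - f' x)" for k x
  have sb: "\<bar>s k x\<bar> \<le> L * norm e" for k x
  proof -
    have "\<bar>s k x\<bar> \<le> real (Suc k) * (L * norm (t k))"
      using C1_grad_Lipschitz[OF f(1) L(2), of "x + t k" x]
      unfolding s_def abs_mult by (intro mult_mono) auto
    then show ?thesis by (simp add: t_def del: of_nat_Suc)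
  qed
  have s'b: "\<bar>s' k x\<bar> \<le> L' * norm e" for k x
  proof -
    have "\<bar>s' k x\<bar> \<le> real (Suc k) * (L' * norm (t k))"
      using C1_grad_Lipschitz[OF f'(1) L'(2), of "x - t k" x]
      unfolding s'_def abs_mult by (intro mult_mono) auto
    then show ?thesis by (simp add: t_def del: of_nat_Suc)
  qed
  have [measurable]: "s k \<in> borel_measurable borel" "s' k \<in> borel_measurable borel" for k
    unfolding s_def s'_def by measurable
  have lim1: "(\<lambda>k. \<integral>x. s k x * (g' x \<bullet> e') \<partial>lborel) \<longlonglongrightarrow> (\<integral>x. (g x \<bullet> e) * (g' x \<bullet> e') \<partial>lborel)"
  proof (rule integral_dominated_convergence
      [where w="\<lambda>x. (L * norm e) * (L' * norm e') * indicator (cball 0 R') x"])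
    show "AE x in lborel. (\<lambda>k. s k x * (g' x \<bullet> e')) \<longlonglongrightarrow> (g x \<bullet> e) * (g' x \<bullet> e')"
      unfolding s_def t_def using has_derivative_directional_seq[OF C1_gradD[OF f(1) UNIV_I]]
      by (intro AE_I2 tendsto_mult tendsto_const)
    show "AE x in lborel. norm (s k x * (g' x \<bullet> e')) \<le> (L * norm e) * (L' * norm e') * indicator (cball 0 R') x" for k
    proof (intro AE_I2)
      fix x
      have "\<bar>g' x \<bullet> e'\<bar> \<le> L' * norm e'"
        by (meson Cauchy_Schwarz_ineq2 L'(2) mult_right_mono norm_ge_zero order_trans)
      then have "norm (s k x * (g' x \<bullet> e')) \<le> (L * norm e) * (L' * norm e')"
        unfolding real_norm_def abs_mult using sb L'(1) L(1) by (intro mult_mono) auto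
      moreover have "g' x = 0" if "x \<notin> cball 0 R'" using that R'(2)[of x 0] g'0[of x] by auto
      ultimately show "norm (s k x * (g' x \<bullet> e')) \<le> (L * norm e) * (L' * norm e') * indicator (cball 0 R') x"
        by (cases "x \<in> cball 0 R'") auto
    qed
    show "integrable lborel (\<lambda>x. (L * norm e) * (L' * norm e') * indicator (cball 0 R') x)"
      by (intro integrable_mult_right integrable_indicator_cball)
  qed measurable
  have lim2: "(\<lambda>k. \<integral>x. (g x \<bullet> e') * s' k x \<partial>lborel) \<longlonglongrightarrow> (\<integral>x. (g x \<bullet> e') * (- (g' x \<bullet> e)) \<partial>lborel)"
  proof (rule integral_dominated_convergence
      [where w="\<lambda>x. (L * norm e') * (L' * norm e) * indicator (cball 0 R) x"])
    show "AE x in lborel. (\<lambda>k. (g x \<bullet> e') * s' k x) \<longlonglongrightarrow> (g x \<bullet> e') * (- (g' x \<bullet> e))"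
      unfolding s'_def t_def using has_derivative_directional_seq_neg[OF C1_gradD[OF f'(1) UNIV_I]]
      by (intro AE_I2 tendsto_mult tendsto_const)
    show "AE x in lborel. norm ((g x \<bullet> e') * s' k x) \<le> (L * norm e') * (L' * norm e) * indicator (cball 0 R) x" for k
    proof (intro AE_I2)
      fix x
      have "\<bar>g x \<bullet> e'\<bar> \<le> L * norm e'"
        by (meson Cauchy_Schwarz_ineq2 L(2) mult_right_mono norm_ge_zero order_trans)
      then have "norm ((g x \<bullet> e') * s' k x) \<le> (L * norm e') * (L' * norm e)"
        unfolding real_norm_def abs_mult using s'b L'(1) L(1) by (intro mult_mono) auto
      moreover have "g x = 0" if "x \<notin> cball 0 R" using that R(2)[of x 0] g0[of x] by auto
      ultimately show "norm ((g x \<bullet> e') * s' k x) \<le> (L * norm e') * (L' * norm e) * indicator (cball 0 R) x"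
        by (cases "x \<in> cball 0 R") auto
    qed
    show "integrable lborel (\<lambda>x. (L * norm e') * (L' * norm e) * indicator (cball 0 R) x)"
      by (intro integrable_mult_right integrable_indicator_cball)
  qed measurable
  \<comment> \<open>The e'-derivative of the compactly supported product \<open>s k x * f' x\<close>
    integrates to 0. Translating by \<open>t k\<close> then moves the forward quotient from g to a
    backward quotient of f', so that f and f' are each differentiated once.\<close>
  have eq: "(\<integral>x. s k x * (g' x \<bullet> e') \<partial>lborel) = - (\<integral>x. (g x \<bullet> e') * s' k x \<partial>lborel)" for k
  proof -
    let ?c = "real (Suc k)"
    have ct: "continuous_on UNIV (\<lambda>x. f (x + t k))" "continuous_on UNIV (\<lambda>x. g (x + t k))"
      "continuous_on UNIV (\<lambda>x. f' (x - t k))"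
      by (rule continuous_on_compose2[OF cont(1)] continuous_on_compose2[OF cont(2)]
          continuous_on_compose2[OF cont(3)], intro continuous_intros, simp)+
    have 1: "C1_grad UNIV (\<lambda>x. s k x * f' x) (\<lambda>x. s k x *\<^sub>R g' x + f' x *\<^sub>R (?c *\<^sub>R (g (x + t k) - g x)))"
      unfolding s_def
      by (intro C1_grad_mult C1_grad_cmult C1_grad_diff C1_grad_translate f f')
    have "(\<integral>x. (s k x *\<^sub>R g' x + f' x *\<^sub>R (?c *\<^sub>R (g (x + t k) - g x))) \<bullet> e' \<partial>lborel) = 0"
      by (rule integral_gradient_eq_0[OF 1 f'(2)]) (use f'(3) in auto)
    moreover have "(s k x *\<^sub>R g' x + f' x *\<^sub>R (?c *\<^sub>R (g (x + t k) - g x))) \<bullet> e'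
        = s k x * (g' x \<bullet> e') + (?c * (f' x * (g (x + t k) \<bullet> e')) - ?c * (f' x * (g x \<bullet> e')))" for x
      by (simp add: inner_add_left inner_diff_left algebra_simps del: of_nat_Suc)
    moreover have i1: "integrable lborel (\<lambda>x. s k x * (g' x \<bullet> e'))"
      unfolding s_def using cont ct g'0
      by (intro integrable_compact_support[OF _ f'(2)]) (auto intro!: continuous_intros)
    moreover have i2: "integrable lborel (\<lambda>x. f' x * (g (x + t k) \<bullet> e'))"
      using cont ct f'(3)
      by (intro integrable_compact_support[OF _ f'(2)]) (auto intro!: continuous_intros)
    moreover have i3: "integrable lborel (\<lambda>x. f' x * (g x \<bullet> e'))"
      using cont f'(3)
      by (intro integrable_compact_support[OF _ f'(2)]) (auto intro!: continuous_intros)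
    ultimately have "(\<integral>x. s k x * (g' x \<bullet> e') \<partial>lborel) =
        - (?c * (\<integral>x. f' x * (g (x + t k) \<bullet> e') \<partial>lborel) - ?c * (\<integral>x. f' x * (g x \<bullet> e') \<partial>lborel))"
      by (simp del: of_nat_Suc)
    also have "(\<integral>x. f' x * (g (x + t k) \<bullet> e') \<partial>lborel) = (\<integral>x. f' (x - t k) * (g x \<bullet> e') \<partial>lborel)"
      using integral_lborel_translate[of "\<lambda>x. f' (x - t k) * (g x \<bullet> e')" "t k"] by simp
    also have "?c * (\<integral>x. f' (x - t k) * (g x \<bullet> e') \<partial>lborel) - ?c * (\<integral>x. f' x * (g x \<bullet> e') \<partial>lborel)
        = (\<integral>x. (g x \<bullet> e') * s' k x \<partial>lborel)"
    proof -
      have i4: "integrable lborel (\<lambda>x. f' (x - t k) * (g x \<bullet> e'))"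
        using cont ct g0
        by (intro integrable_compact_support[OF _ f(2)]) (auto intro!: continuous_intros)
      have "(\<lambda>x. (g x \<bullet> e') * s' k x) = (\<lambda>x. ?c * (f' (x - t k) * (g x \<bullet> e')) - ?c * (f' x * (g x \<bullet> e')))"
        by (simp add: s'_def algebra_simps del: of_nat_Suc)
      then show ?thesis using i3 i4 by (simp del: of_nat_Suc)
    qed
    finally show ?thesis by simp
  qed
  have "(\<lambda>k. \<integral>x. s k x * (g' x \<bullet> e') \<partial>lborel) \<longlonglongrightarrow> - (\<integral>x. (g x \<bullet> e') * (- (g' x \<bullet> e)) \<partial>lborel)"
    unfolding eq by (rule tendsto_minus[OF lim2])
  from LIMSEQ_unique[OF lim1 this] show ?thesis by simp
qed

section \<open>Cutoff functions around a point\<close>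

text \<open>The building block of a C^1 cutoff. The only delicate point is 0, where the difference
  quotient is itself a positive part and tends to 0.\<close>

lemma DERIV_pos_part_sq: "((\<lambda>t::real. (max 0 t)\<^sup>2) has_real_derivative 2 * max 0 t) (at t)"
proof -
  consider "t > 0" | "t < 0" | "t = 0" by linarith
  then show ?thesis
  proof cases
    case 1
    have "((\<lambda>t::real. t\<^sup>2) has_real_derivative 2 * t) (at t)"
      by (auto intro!: derivative_eq_intros)
    then have "((\<lambda>t::real. (max 0 t)\<^sup>2) has_real_derivative 2 * t) (at t)"
      by (rule has_field_derivative_transform_within_open[of _ _ _ "{0<..}"]) (use 1 in auto)
    then show ?thesis using 1 by simp
  next
    case 2
    have "((\<lambda>t::real. 0) has_real_derivative 0) (at t)" by simp
    then have "((\<lambda>t::real. (max 0 t)\<^sup>2) has_real_derivative 0) (at t)"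
      by (rule has_field_derivative_transform_within_open[of _ _ _ "{..<0}"]) (use 2 in auto)
    then show ?thesis using 2 by simp
  next
    case 3
    have "(\<lambda>h::real. (max 0 h)\<^sup>2 / h) = (\<lambda>h. max 0 h)"
      by (auto simp: max_def power2_eq_square)
    moreover have "((\<lambda>h::real. max 0 h) \<longlongrightarrow> max 0 0) (at 0)"
      by (intro tendsto_intros)
    ultimately show ?thesis using 3 by (simp add: DERIV_def)
  qed
qed

text \<open>A C^1 step, 0 up to 1 and 1 from 2 on, made of two nested squared positive parts: the
  inner one flattens it at 2, the outer one at 1.\<close>

definition ramp :: "real \<Rightarrow> real" where
  "ramp t = (max 0 (1 - (max 0 (2 - t))\<^sup>2))\<^sup>2"

definition ramp_deriv :: "real \<Rightarrow> real" where
  "ramp_deriv t = 4 * max 0 (1 - (max 0 (2 - t))\<^sup>2) * max 0 (2 - t)"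

lemma DERIV_ramp: "(ramp has_real_derivative ramp_deriv t) (at t)"
proof -
  have 1: "((\<lambda>t. (max 0 (2 - t))\<^sup>2) has_real_derivative 2 * max 0 (2 - t) * (- 1)) (at t)"
    by (rule DERIV_chain2[OF DERIV_pos_part_sq]) (auto intro!: derivative_eq_intros)
  have 2: "((\<lambda>t. 1 - (max 0 (2 - t))\<^sup>2) has_real_derivative 2 * max 0 (2 - t)) (at t)"
    using DERIV_diff[OF DERIV_const[of 1] 1] by simp
  show ?thesis
    using DERIV_chain2[OF DERIV_pos_part_sq 2] by (simp add: ramp_def[abs_def] ramp_deriv_def mult_ac)
qed

lemma ramp_eq_0: "t \<le> 1 \<Longrightarrow> ramp t = 0"
  using one_le_power[of "2 - t" 2] by (simp add: ramp_def)

lemma ramp_eq_1: "t \<ge> 2 \<Longrightarrow> ramp t = 1"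
  by (simp add: ramp_def max_def)

lemma ramp_bounds: "0 \<le> ramp t" "ramp t \<le> 1"
  by (auto simp: ramp_def max_def abs_square_le_1)

lemma ramp_deriv_eq_0: "t \<le> 1 \<or> t \<ge> 2 \<Longrightarrow> ramp_deriv t = 0"
  using one_le_power[of "2 - t" 2] by (auto simp: ramp_deriv_def)

lemma ramp_deriv_bound: "\<bar>ramp_deriv t\<bar> \<le> 4"
proof (cases "t \<le> 1")
  case False
  have "max 0 (1 - (max 0 (2 - t))\<^sup>2) * max 0 (2 - t) \<le> 1 * 1"
    using False by (intro mult_mono) auto
  then show ?thesis by (simp add: ramp_deriv_def abs_mult)
qed (simp add: ramp_deriv_eq_0)

lemma continuous_on_ramp_deriv: "continuous_on S ramp_deriv"
  unfolding ramp_deriv_def[abs_def] by (intro continuous_intros)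

text \<open>It vanishes near p and is 1 far away. Using the squared distance avoids differentiating
  the norm at p.\<close>

definition cutoff :: "'a::euclidean_space \<Rightarrow> real \<Rightarrow> 'a \<Rightarrow> real" where
  "cutoff p \<epsilon> x = ramp ((x - p) \<bullet> (x - p) / \<epsilon>\<^sup>2)"

definition cutoff_grad :: "'a::euclidean_space \<Rightarrow> real \<Rightarrow> 'a \<Rightarrow> 'a" where
  "cutoff_grad p \<epsilon> x = (ramp_deriv ((x - p) \<bullet> (x - p) / \<epsilon>\<^sup>2) * (2 / \<epsilon>\<^sup>2)) *\<^sub>R (x - p)"

lemma C1_grad_cutoff: "C1_grad UNIV (cutoff p \<epsilon>) (cutoff_grad p \<epsilon>)"
proof -
  have "C1_grad UNIV (\<lambda>x. (x - p) \<bullet> (x - p)) (\<lambda>x. 2 *\<^sub>R (x - p))"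
    unfolding C1_grad_def
    by (auto intro!: derivative_eq_intros continuous_intros simp: fun_eq_iff inner_commute inner_diff_left inner_diff_right)
  from C1_grad_cmult[OF this, of "1 / \<epsilon>\<^sup>2"]
  have "C1_grad UNIV (\<lambda>x. (x - p) \<bullet> (x - p) / \<epsilon>\<^sup>2) (\<lambda>x. (2 / \<epsilon>\<^sup>2) *\<^sub>R (x - p))" by simp
  from C1_grad_compose[OF this, of UNIV ramp ramp_deriv] DERIV_ramp continuous_on_ramp_deriv
  show ?thesis by (simp add: cutoff_def[abs_def] cutoff_grad_def[abs_def])
qed

lemma cutoff_bounds: "0 \<le> cutoff p \<epsilon> x" "cutoff p \<epsilon> x \<le> 1"
  using ramp_bounds by (auto simp: cutoff_def)

lemma cutoff_eq_0: "0 < \<epsilon> \<Longrightarrow> dist p x \<le> \<epsilon> \<Longrightarrow> cutoff p \<epsilon> x = 0"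
  unfolding cutoff_def
  by (rule ramp_eq_0) (simp add: dot_square_norm dist_norm norm_minus_commute divide_le_eq power_mono)

text \<open>The transition ends at radius sqrt 2 * \<epsilon>; 3/2 is a rational upper bound for
  sqrt 2.\<close>

lemma cutoff_ratio_ge_2:
  assumes "0 < \<epsilon>" "3 / 2 * \<epsilon> \<le> dist p x"
  shows "(x - p) \<bullet> (x - p) / \<epsilon>\<^sup>2 \<ge> 2"
proof -
  have "2 * \<epsilon>\<^sup>2 \<le> (3 / 2 * \<epsilon>)\<^sup>2" using assms(1) by (simp add: power2_eq_square)
  also have "\<dots> \<le> (dist p x)\<^sup>2" using assms by (intro power_mono) auto
  also have "\<dots> = (x - p) \<bullet> (x - p)" by (simp add: dot_square_norm dist_norm norm_minus_commute)
  finally show ?thesis using assms(1) by (simp add: le_divide_eq)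
qed

lemma cutoff_eq_1: "0 < \<epsilon> \<Longrightarrow> 3 / 2 * \<epsilon> \<le> dist p x \<Longrightarrow> cutoff p \<epsilon> x = 1"
  unfolding cutoff_def by (intro ramp_eq_1 cutoff_ratio_ge_2)

lemma cutoff_grad_eq_0: "0 < \<epsilon> \<Longrightarrow> 3 / 2 * \<epsilon> \<le> dist p x \<Longrightarrow> cutoff_grad p \<epsilon> x = 0"
  unfolding cutoff_grad_def using cutoff_ratio_ge_2[of \<epsilon> p x] ramp_deriv_eq_0 by force

text \<open>12 = 4 * 2 * 3/2: the bound for \<open>ramp_deriv\<close>, the factor from the inner
  derivative, and the outer radius divided by \<epsilon>.\<close>

lemma norm_cutoff_grad:
  assumes "0 < \<epsilon>"
  shows "norm (cutoff_grad p \<epsilon> x) \<le> 12 / \<epsilon> * indicator (cball p (3 / 2 * \<epsilon>)) x"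
proof (cases "x \<in> cball p (3 / 2 * \<epsilon>)")
  case True
  have "norm (cutoff_grad p \<epsilon> x) \<le> 4 * (2 / \<epsilon>\<^sup>2) * (3 / 2 * \<epsilon>)"
    unfolding cutoff_grad_def norm_scaleR abs_mult
    using True assms ramp_deriv_bound by (intro mult_mono) (auto simp: dist_norm norm_minus_commute)
  then show ?thesis using True assms by (simp add: power2_eq_square)
next
  case False
  then show ?thesis using cutoff_grad_eq_0[OF assms, of p x] by simp
qed

text \<open>The right-hand side stays bounded as \<open>\<epsilon>\<close> tends to \<open>0\<close> as long as \<open>s \<le> DIM('a)\<close>, and tends
  to \<open>0\<close> if \<open>s < DIM('a)\<close>: a point has vanishing capacity.\<close>

lemma integral_cutoff_grad_powr:
  fixes p :: "'a::euclidean_space"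
  assumes "0 < \<epsilon>" "0 < s"
  shows "integrable lborel (\<lambda>x. norm (cutoff_grad p \<epsilon> x) powr s)"
    and "(\<integral>x. norm (cutoff_grad p \<epsilon> x) powr s \<partial>lborel)
      \<le> unit_ball_vol (real DIM('a)) * 12 powr s * 2 ^ DIM('a) * \<epsilon> powr (real DIM('a) - s)"
proof -
  have le: "norm (cutoff_grad p \<epsilon> x) powr s \<le> (12 / \<epsilon>) powr s * indicator (cball p (3 / 2 * \<epsilon>)) x" for x
    using powr_mono2[OF _ norm_ge_zero norm_cutoff_grad[OF assms(1), of p x], of s] assms
    by (cases "x \<in> cball p (3 / 2 * \<epsilon>)") auto
  have int: "integrable lborel (\<lambda>x. (12 / \<epsilon>) powr s * indicator (cball p (3 / 2 * \<epsilon>)) x)"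
    by (intro integrable_mult_right integrable_indicator_cball)
  have [measurable]: "cutoff_grad p \<epsilon> \<in> borel_measurable borel"
    by (intro borel_measurable_continuous_onI C1_grad_cont_grad[OF C1_grad_cutoff])
  show 1: "integrable lborel (\<lambda>x. norm (cutoff_grad p \<epsilon> x) powr s)"
    by (rule Bochner_Integration.integrable_bound[OF int]) (use le in \<open>auto intro!: AE_I2\<close>)
  have "(\<integral>x. norm (cutoff_grad p \<epsilon> x) powr s \<partial>lborel)
      \<le> (\<integral>x. (12 / \<epsilon>) powr s * indicator (cball p (3 / 2 * \<epsilon>)) x \<partial>lborel)"
    by (rule integral_mono[OF 1 int le])
  also have "\<dots> = (12 / \<epsilon>) powr s * (unit_ball_vol (real DIM('a)) * (3 / 2 * \<epsilon>) ^ DIM('a))"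
    using assms content_cball[of "3 / 2 * \<epsilon>" p] by simp
  also have "\<dots> \<le> (12 / \<epsilon>) powr s * (unit_ball_vol (real DIM('a)) * (2 * \<epsilon>) ^ DIM('a))"
    using assms by (intro mult_left_mono power_mono) (auto intro: unit_ball_vol_nonneg)
  also have "\<dots> = unit_ball_vol (real DIM('a)) * 12 powr s * 2 ^ DIM('a) * \<epsilon> powr (real DIM('a) - s)"
    using assms by (simp add: powr_divide power_mult_distrib powr_diff powr_realpow)
  finally show "(\<integral>x. norm (cutoff_grad p \<epsilon> x) powr s \<partial>lborel) \<le> \<dots>" .
qed

section \<open>The pointwise inequality\<close>

text \<open>The norm of a matrix is here the Frobenius norm, the L2 norm of the row norms, so
  Cauchy-Schwarz in each row is enough.\<close>

lemma norm_matrix_vector_mult_le: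
  fixes A :: "real^'n::finite^'m::finite"
  shows "norm (A *v x) \<le> norm A * norm x"
proof -
  have "norm (A *v x) = L2_set (\<lambda>i. norm ((A *v x) $ i)) UNIV" by (simp add: norm_vec_def)
  also have "\<dots> \<le> L2_set (\<lambda>i. norm (A $ i) * norm x) UNIV"
    by (rule L2_set_mono) (auto simp: matrix_vector_mul_component Cauchy_Schwarz_ineq2)
  also have "\<dots> = norm A * norm x" by (simp add: norm_vec_def L2_set_left_distrib)
  finally show ?thesis .
qed

lemma abs_inner_matrix_le:
  fixes A :: "real^'n::finite^'m::finite"
  shows "\<bar>u \<bullet> (A *v x)\<bar> \<le> norm u * norm A * norm x"
proof -
  have "\<bar>u \<bullet> (A *v x)\<bar> \<le> norm u * norm (A *v x)" by (rule Cauchy_Schwarz_ineq2)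
  also have "\<dots> \<le> norm u * (norm A * norm x)"
    by (intro mult_left_mono norm_matrix_vector_mult_le) auto
  finally show ?thesis by (simp add: mult.assoc)
qed

lemma abs_trace_le: "\<bar>trace (A :: real^'n::finite^'n)\<bar> \<le> real CARD('n) * norm A"
proof -
  have "\<bar>trace A\<bar> \<le> (\<Sum>i\<in>UNIV. \<bar>A $ i $ i\<bar>)" unfolding trace_def by (rule sum_abs)
  also have "\<dots> \<le> (\<Sum>i\<in>(UNIV::'n set). norm A)"
    by (intro sum_mono order_trans[OF component_le_norm_cart] Finite_Cartesian_Product.norm_nth_le)
  finally show ?thesis by simp
qed

lemma norm_transpose: "norm (transpose (A :: real^'n::finite^'m::finite)) = norm A"
proof -
  have "transpose A \<bullet> transpose A = A \<bullet> A"
    unfolding inner_vec_def transpose_def by (simp, rule sum.swap)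
  then show ?thesis by (simp add: norm_eq_sqrt_inner)
qed

text \<open>Row j of \<open>M\<close> is meant to be the gradient of w_j. Then \<open>M *v w\<close>
  is the derivative of w along itself and \<open>w v* M\<close> half the gradient of |w|^2; they
  agree for symmetric \<open>M\<close>, that is for closed forms, and the curl condition measures
  their difference.\<close>

lemma twisted_closed_mult_self:
  fixes w \<gamma> q :: "real^'n::finite" and M :: "real^'n^'n"
  assumes curl: "\<And>i j. M $ j $ i - M $ i $ j = \<gamma> $ i * w $ j - \<gamma> $ j * w $ i"
    and q: "q = 2 *\<^sub>R (w v* M)"
  shows "M *v w = (1/2) *\<^sub>R q + (\<gamma> \<bullet> w) *\<^sub>R w - (w \<bullet> w) *\<^sub>R \<gamma>"
proof -
  have "(M *v w) $ j = ((1/2) *\<^sub>R q + (\<gamma> \<bullet> w) *\<^sub>R w - (w \<bullet> w) *\<^sub>R \<gamma>) $ j" for j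
  proof -
    have "(M *v w) $ j = (\<Sum>i\<in>UNIV. (M $ i $ j + (\<gamma> $ i * w $ j - \<gamma> $ j * w $ i)) * w $ i)"
      unfolding matrix_vector_mult_def by (simp add: curl[symmetric])
    also have "\<dots> = ((1/2) *\<^sub>R q + (\<gamma> \<bullet> w) *\<^sub>R w - (w \<bullet> w) *\<^sub>R \<gamma>) $ j"
      unfolding q inner_vec_def vector_matrix_mult_def
      by (simp add: algebra_simps sum.distrib sum_subtractf sum_distrib_left sum_distrib_right)
    finally show ?thesis .
  qed
  then show ?thesis by (simp add: vec_eq_iff)
qed

text \<open>Read r, r' as \<rho>(Q), \<rho>'(Q) and z as the gradient of \<zeta>. The double sum is
  then \<partial>_j(\<rho> w_i) \<partial>_i(\<zeta> w_j) - \<partial>_i(\<rho> w_i)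
  \<partial>_j(\<zeta> w_j), and the last sum is the divergence of \<zeta> Y with Y = \<rho> Q
  \<gamma> - 2 \<rho> (\<gamma> \<bullet> w) w. Both integrate to 0, so the left-hand side does too.
  Y is dictated by the terms linear in z that the double sum leaves beside \<open>P\<close>.\<close>

lemma flux_identity:
  fixes w \<gamma> q z :: "real^'n::finite" and M B :: "real^'n^'n"
  assumes curl: "\<And>i j. M $ j $ i - M $ i $ j = \<gamma> $ i * w $ j - \<gamma> $ j * w $ i"
    and q: "q = 2 *\<^sub>R (w v* M)"
    and div: "(\<Sum>i\<in>UNIV. r * M $ i $ i + w $ i * (r' * q $ i)) = - r * (\<gamma> \<bullet> w)"
    and S: "S = r * (\<gamma> \<bullet> w) * trace M + r * (M \<bullet> transpose M) + r' * (q \<bullet> (M *v w))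
       + r * (w \<bullet> w) * trace B + (r + r' * (w \<bullet> w)) * (\<gamma> \<bullet> q) + 2 * r * (\<gamma> \<bullet> w)\<^sup>2
       - 2 * r * (w \<bullet> (B *v w) + \<gamma> \<bullet> (M *v w))"
  shows "((r / 2) *\<^sub>R q + (r' * (w \<bullet> q)) *\<^sub>R w) \<bullet> z + \<zeta> * S =
      (\<Sum>i\<in>UNIV. \<Sum>j\<in>UNIV.
         (r * M $ i $ j + w $ i * (r' * q $ j)) * (\<zeta> * M $ j $ i + w $ j * z $ i)
       - (r * M $ i $ i + w $ i * (r' * q $ i)) * (\<zeta> * M $ j $ j + w $ j * z $ j))
    + (\<Sum>i\<in>UNIV. \<zeta> * (r * (w \<bullet> w) * B $ i $ i + \<gamma> $ i * ((r + r' * (w \<bullet> w)) * q $ i)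
         - 2 * ((\<gamma> \<bullet> w) * (r * M $ i $ i + w $ i * (r' * q $ i))
             + r * w $ i * (\<Sum>k\<in>UNIV. \<gamma> $ k * M $ k $ i + w $ k * B $ k $ i)))
       + (r * (w \<bullet> w) * \<gamma> $ i - 2 * ((\<gamma> \<bullet> w) * (r * w $ i))) * z $ i)" (is "_ = ?A + ?Y")
proof -
  have Mw: "M *v w = (1/2) *\<^sub>R q + (\<gamma> \<bullet> w) *\<^sub>R w - (w \<bullet> w) *\<^sub>R \<gamma>"
    by (rule twisted_closed_mult_self[OF curl q])
  have zMw: "z \<bullet> (M *v w) = (q \<bullet> z) / 2 + (\<gamma> \<bullet> w) * (w \<bullet> z) - (w \<bullet> w) * (\<gamma> \<bullet> z)"
    unfolding Mw by (simp add: inner_add_right inner_diff_right inner_commute)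
  have mv: "u \<bullet> (N *v v) = (\<Sum>i\<in>UNIV. \<Sum>j\<in>UNIV. u $ i * (N $ i $ j * v $ j))" for u v :: "real^'n" and N :: "real^'n^'n"
    by (simp add: inner_vec_def matrix_vector_mult_def sum_distrib_left)
  have mv': "u \<bullet> (N *v v) = (\<Sum>i\<in>UNIV. \<Sum>j\<in>UNIV. u $ j * (N $ j $ i * v $ i))" for u v :: "real^'n" and N :: "real^'n^'n"
    unfolding mv by (rule sum.swap)
  have A1: "(\<Sum>i\<in>UNIV. \<Sum>j\<in>UNIV. (r * M $ i $ j + w $ i * (r' * q $ j)) * (\<zeta> * M $ j $ i + w $ j * z $ i))
      = \<zeta> * (r * (M \<bullet> transpose M) + r' * (q \<bullet> (M *v w))) + r * (z \<bullet> (M *v w)) + r' * (q \<bullet> w) * (w \<bullet> z)"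
  proof -
    have 1: "(q \<bullet> w) * (w \<bullet> z) = (\<Sum>i\<in>UNIV. \<Sum>j\<in>UNIV. (q $ j * w $ j) * (w $ i * z $ i))"
      by (simp add: inner_vec_def sum_product, rule sum.swap)
    have "r' * (q \<bullet> w) * (w \<bullet> z) = r' * ((q \<bullet> w) * (w \<bullet> z))" by simp
    then show ?thesis
      unfolding 1 mv[of z] mv'[of q] inner_vec_def[of M] transpose_def
      by (simp add: inner_vec_def sum_distrib_left sum.distrib[symmetric] algebra_simps)
  qed
  \<comment> \<open>The double sum factors into the divergences of \<rho> w and of \<zeta> w; the
    first of them is known from \<open>div\<close>.\<close>
  have A2: "(\<Sum>i\<in>UNIV. \<Sum>j\<in>UNIV. (r * M $ i $ i + w $ i * (r' * q $ i)) * (\<zeta> * M $ j $ j + w $ j * z $ j))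
      = - r * (\<gamma> \<bullet> w) * (\<zeta> * trace M + w \<bullet> z)"
    unfolding div[symmetric] sum_product[symmetric]
    by (simp add: trace_def inner_vec_def sum_distrib_left sum.distrib)
  have A: "?A = \<zeta> * (r * (M \<bullet> transpose M) + r' * (q \<bullet> (M *v w))) + r * (z \<bullet> (M *v w)) + r' * (q \<bullet> w) * (w \<bullet> z)
      + r * (\<gamma> \<bullet> w) * (\<zeta> * trace M + w \<bullet> z)"
    unfolding sum_subtractf A1 A2 by simp
  have Y1: "(\<Sum>i\<in>UNIV. r * w $ i * (\<Sum>k\<in>UNIV. \<gamma> $ k * M $ k $ i + w $ k * B $ k $ i))
      = r * (\<gamma> \<bullet> (M *v w) + w \<bullet> (B *v w))"
    unfolding mv' by (simp add: sum_distrib_left sum.distrib[symmetric] algebra_simps)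
  have "?Y = \<zeta> * (r * (w \<bullet> w) * trace B + (r + r' * (w \<bullet> w)) * (\<gamma> \<bullet> q)
        - 2 * ((\<gamma> \<bullet> w) * (\<Sum>i\<in>UNIV. r * M $ i $ i + w $ i * (r' * q $ i))
        + (\<Sum>i\<in>UNIV. r * w $ i * (\<Sum>k\<in>UNIV. \<gamma> $ k * M $ k $ i + w $ k * B $ k $ i))))
      + (r * (w \<bullet> w) * (\<gamma> \<bullet> z) - 2 * ((\<gamma> \<bullet> w) * (r * (w \<bullet> z))))"
    unfolding trace_def inner_vec_def[of \<gamma> q] inner_vec_def[of \<gamma> z] inner_vec_def[of w z]
    by (simp add: sum_distrib_left sum.distrib sum_subtractf left_diff_distrib right_diff_distrib distrib_left mult.assoc mult.left_commute)
  \<comment> \<open>Inserting the known divergence of \<rho> w a second time produces the square 2 r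
    (\<gamma> \<bullet> w)^2.\<close>
  also have "\<dots> = \<zeta> * (r * (w \<bullet> w) * trace B + (r + r' * (w \<bullet> w)) * (\<gamma> \<bullet> q)
        + 2 * r * (\<gamma> \<bullet> w)\<^sup>2 - 2 * r * (w \<bullet> (B *v w) + \<gamma> \<bullet> (M *v w)))
      + (r * (w \<bullet> w) * (\<gamma> \<bullet> z) - 2 * ((\<gamma> \<bullet> w) * (r * (w \<bullet> z))))"
    unfolding div Y1 by (simp add: algebra_simps power2_eq_square)
  finally show ?thesis
    unfolding A S zMw by (simp add: inner_add_left inner_commute[of q w] algebra_simps)
qed

text \<open>\<open>S\<close> is the zero-order term of the equation for \<open>H\<close>: \<open>w\<close>, \<open>\<gamma>\<close> are the values of \<open>\<omega>\<close>, \<open>\<Gamma>\<close> at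
  a point, \<open>M\<close>, \<open>B\<close> their Jacobians and \<open>q\<close> the gradient of \<open>Q = |\<omega>|\<^sup>2\<close>.\<close>

lemma zero_order_term_bound:
  fixes w \<gamma> q :: "real^'n::finite" and M B :: "real^'n^'n"
  assumes curl: "\<And>i j. M $ j $ i - M $ i $ j = \<gamma> $ i * w $ j - \<gamma> $ j * w $ i"
    and q: "q = 2 *\<^sub>R (w v* M)"
    and r: "r > 0" and c: "c > 0" "c \<le> 1" and L: "\<bar>r'\<bar> * (w \<bullet> w) \<le> L * r"
    and rc: "r' < 0 \<Longrightarrow> c / 2 * r \<le> r / 2 + (w \<bullet> w) * r'"
    and S: "S = r * (\<gamma> \<bullet> w) * trace M + r * (M \<bullet> transpose M) + r' * (q \<bullet> (M *v w))
       + r * (w \<bullet> w) * trace B + (r + r' * (w \<bullet> w)) * (\<gamma> \<bullet> q) + 2 * r * (\<gamma> \<bullet> w)\<^sup>2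
       - 2 * r * (w \<bullet> (B *v w) + \<gamma> \<bullet> (M *v w))"
  defines "K \<equiv> 6 + 6 * L + real CARD('n)"
  shows "S \<ge> - ((K\<^sup>2 / (4 * c)) + real CARD('n) + 2) * (r * (w \<bullet> w)) * (norm B + \<gamma> \<bullet> \<gamma>)"
proof -
  define m where "m = norm M"
  define g where "g = norm \<gamma>"
  define s where "s = norm w"
  define b where "b = norm B"
  have nn: "m \<ge> 0" "g \<ge> 0" "s \<ge> 0" "b \<ge> 0" by (auto simp: m_def g_def s_def b_def)
  have Q: "w \<bullet> w = s\<^sup>2" "\<gamma> \<bullet> \<gamma> = g\<^sup>2" by (simp_all add: s_def g_def dot_square_norm)
  have gw: "\<bar>\<gamma> \<bullet> w\<bar> \<le> g * s" unfolding g_def s_def by (rule Cauchy_Schwarz_ineq2)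
  have "norm (w v* M) \<le> m * s"
    using norm_matrix_vector_mult_le[of "transpose M" w] by (simp add: m_def s_def norm_transpose)
  then have nq: "norm q \<le> 2 * m * s" unfolding q by simp
  have gq: "\<bar>\<gamma> \<bullet> q\<bar> \<le> 2 * m * s * g"
    using Cauchy_Schwarz_ineq2[of \<gamma> q] mult_left_mono[OF nq nn(2)] by (simp add: g_def mult_ac)
  have wq: "\<bar>w \<bullet> q\<bar> \<le> 2 * m * s\<^sup>2"
    using Cauchy_Schwarz_ineq2[of w q] mult_left_mono[OF nq nn(3)]
    by (simp add: s_def mult_ac power2_eq_square)
  have wMg: "\<bar>w \<bullet> (M *v \<gamma>)\<bar> \<le> s * m * g" "\<bar>\<gamma> \<bullet> (M *v w)\<bar> \<le> g * m * s" "\<bar>w \<bullet> (B *v w)\<bar> \<le> s * b * s"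
    unfolding m_def g_def s_def b_def by (rule abs_inner_matrix_le)+
  have tr: "\<bar>trace M\<bar> \<le> real CARD('n) * m" "\<bar>trace B\<bar> \<le> real CARD('n) * b"
    unfolding m_def b_def by (rule abs_trace_le)+
  \<comment> \<open>The product of \<open>M\<close> with its transpose has no sign in general.
    Exchanging the indices by the curl condition turns it into |M|^2 plus terms linear in M and
    \<gamma>.\<close>
  have MT: "M \<bullet> transpose M = m\<^sup>2 + \<gamma> \<bullet> (M *v w) - w \<bullet> (M *v \<gamma>)"
  proof -
    have a: "w \<bullet> (M *v \<gamma>) = (\<Sum>i\<in>UNIV. \<Sum>j\<in>UNIV. M $ i $ j * (\<gamma> $ j * w $ i))"
      "\<gamma> \<bullet> (M *v w) = (\<Sum>i\<in>UNIV. \<Sum>j\<in>UNIV. M $ i $ j * (\<gamma> $ i * w $ j))"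
      by (simp_all add: inner_vec_def matrix_vector_mult_def sum_distrib_left mult_ac)
    have "M \<bullet> transpose M = (\<Sum>i\<in>UNIV. \<Sum>j\<in>UNIV. M $ i $ j * (M $ i $ j + (\<gamma> $ i * w $ j - \<gamma> $ j * w $ i)))"
      unfolding inner_vec_def transpose_def
      by (intro sum.cong refl) (simp add: inner_vec_def curl[symmetric])
    also have "\<dots> = M \<bullet> M + \<gamma> \<bullet> (M *v w) - w \<bullet> (M *v \<gamma>)"
      unfolding a by (simp add: inner_vec_def ring_distribs sum.distrib sum_subtractf)
    finally show ?thesis by (simp add: m_def dot_square_norm)
  qed
  have Mw: "M *v w = (1/2) *\<^sub>R q + (\<gamma> \<bullet> w) *\<^sub>R w - (w \<bullet> w) *\<^sub>R \<gamma>"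
    by (rule twisted_closed_mult_self[OF curl q])
  have qMw: "q \<bullet> (M *v w) = (q \<bullet> q) / 2 + (\<gamma> \<bullet> w) * (w \<bullet> q) - s\<^sup>2 * (\<gamma> \<bullet> q)"
    unfolding Mw Q by (simp add: inner_add_right inner_diff_right inner_commute)
  have qq: "q \<bullet> q \<le> 4 * m\<^sup>2 * s\<^sup>2"
    using power_mono[OF nq norm_ge_zero, of 2] by (simp add: dot_square_norm power_mult_distrib)
  \<comment> \<open>For r' < 0 the worst case is |q| = 2 |M| |w|, which leaves 2 |M|^2 (r/2 + |w|^2
    r'). The bracket is H', and the growth condition keeps it above (c/2) r.\<close>
  have main: "r * m\<^sup>2 + r' * ((q \<bullet> q) / 2) \<ge> c * r * m\<^sup>2"
  proof (cases "r' < 0")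
    case True
    have "r' * ((q \<bullet> q) / 2) \<ge> r' * (2 * m\<^sup>2 * s\<^sup>2)"
      using True qq by (intro mult_left_mono_neg) auto
    moreover have "m\<^sup>2 * (c / 2 * r) \<le> m\<^sup>2 * (r / 2 + s\<^sup>2 * r')"
      using rc[OF True] unfolding Q by (intro mult_left_mono) auto
    ultimately show ?thesis by (simp add: algebra_simps)
  next
    case False
    have "r' * ((q \<bullet> q) / 2) \<ge> 0" using False by simp
    moreover have "c * (r * m\<^sup>2) \<le> 1 * (r * m\<^sup>2)" using c r by (intro mult_right_mono) auto
    ultimately show ?thesis by simp
  qed
  \<comment> \<open>Every cross term between \<gamma> and \<open>M\<close> is a multiple of t.
    Counted without cancellation, their coefficients add up to 6 + 6 L + n = K; those of u below add
    up to n + 2.\<close>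
  define t where "t = r * g * s * m"
  have L0: "L \<ge> 0" using L r by (metis abs_ge_zero inner_ge_zero mult_nonneg_nonneg order_trans zero_le_mult_iff linorder_not_le)
  have e1: "\<bar>r * (\<gamma> \<bullet> w) * trace M\<bar> \<le> real CARD('n) * t"
  proof -
    have "\<bar>r * (\<gamma> \<bullet> w) * trace M\<bar> \<le> r * (g * s) * (real CARD('n) * m)"
      unfolding abs_mult using gw tr r nn by (intro mult_mono) auto
    then show ?thesis by (simp add: t_def mult_ac)
  qed
  have e2: "\<bar>r * (w \<bullet> (M *v \<gamma>))\<bar> \<le> t" "\<bar>r * (\<gamma> \<bullet> (M *v w))\<bar> \<le> t"
    using wMg r by (auto simp: abs_mult t_def mult_ac)
  have Ls: "\<bar>r'\<bar> * s\<^sup>2 \<le> L * r" using L Q by simp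
  have e3: "\<bar>r' * ((\<gamma> \<bullet> w) * (w \<bullet> q))\<bar> \<le> 2 * L * t"
  proof -
    have "\<bar>r' * ((\<gamma> \<bullet> w) * (w \<bullet> q))\<bar> \<le> \<bar>r'\<bar> * ((g * s) * (2 * m * s\<^sup>2))"
      unfolding abs_mult using gw wq nn by (intro mult_mono) auto
    also have "\<dots> = (\<bar>r'\<bar> * s\<^sup>2) * (2 * g * s * m)" by (simp add: mult_ac)
    also have "\<dots> \<le> (L * r) * (2 * g * s * m)" using Ls nn by (intro mult_right_mono) auto
    finally show ?thesis by (simp add: t_def mult_ac)
  qed
  have e4: "\<bar>r' * (s\<^sup>2 * (\<gamma> \<bullet> q))\<bar> \<le> 2 * L * t"
  proof -
    have "\<bar>r' * (s\<^sup>2 * (\<gamma> \<bullet> q))\<bar> = (\<bar>r'\<bar> * s\<^sup>2) * \<bar>\<gamma> \<bullet> q\<bar>" by (simp add: abs_mult mult_ac)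
    also have "\<dots> \<le> (L * r) * (2 * m * s * g)" using L0 r by (intro mult_mono[OF Ls gq]) auto
    finally show ?thesis by (simp add: t_def mult_ac)
  qed
  have e5: "\<bar>r * (\<gamma> \<bullet> q)\<bar> \<le> 2 * t"
    using mult_left_mono[OF gq, of r] r by (simp add: abs_mult t_def mult_ac)
  define u where "u = r * s\<^sup>2 * b"
  have e6: "\<bar>r * s\<^sup>2 * trace B\<bar> \<le> real CARD('n) * u"
    using mult_left_mono[OF tr(2), of "r * s\<^sup>2"] r by (simp add: abs_mult u_def mult_ac)
  have e7: "\<bar>r * (w \<bullet> (B *v w))\<bar> \<le> u"
    using mult_left_mono[OF wMg(3), of r] r by (simp add: abs_mult u_def mult_ac power2_eq_square)
  have e8: "0 \<le> 2 * r * (\<gamma> \<bullet> w)\<^sup>2" using r by simp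
  have "S = (r * m\<^sup>2 + r' * ((q \<bullet> q) / 2)) + r * (\<gamma> \<bullet> w) * trace M
      - r * (w \<bullet> (M *v \<gamma>)) + r * (\<gamma> \<bullet> (M *v w)) + r' * ((\<gamma> \<bullet> w) * (w \<bullet> q)) - r' * (s\<^sup>2 * (\<gamma> \<bullet> q))
      + r * s\<^sup>2 * trace B + r * (\<gamma> \<bullet> q) + r' * (s\<^sup>2 * (\<gamma> \<bullet> q)) + 2 * r * (\<gamma> \<bullet> w)\<^sup>2
       - 2 * (r * (w \<bullet> (B *v w))) - 2 * (r * (\<gamma> \<bullet> (M *v w)))"
    unfolding S MT qMw Q by (simp add: algebra_simps)
  moreover have "K * t = 6 * t + 6 * (L * t) + real CARD('n) * t"
    "(real CARD('n) + 2) * u = real CARD('n) * u + 2 * u" "0 \<le> L * t" "0 \<le> t"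
    using L0 r nn by (simp_all add: K_def t_def algebra_simps)
  ultimately have S1: "S \<ge> c * r * m\<^sup>2 - K * t - (real CARD('n) + 2) * u"
    using main e1 e2 e3 e4 e5 e6 e7 e8 unfolding abs_le_iff by linarith
  \<comment> \<open>Completing the square in |M| absorbs K t into c r |M|^2, at the price of the
    factor K^2 / (4 c) on |\<gamma>|^2.\<close>
  have "c * r * m\<^sup>2 - K * t + (K\<^sup>2 / (4 * c)) * (r * s\<^sup>2 * g\<^sup>2) = (c * r) * (m - K * (g * s) / (2 * c))\<^sup>2"
    using c by (simp add: t_def power2_eq_square field_simps)
  also have "\<dots> \<ge> 0" using c r by simp
  finally have S2: "0 \<le> c * r * m\<^sup>2 - K * t + (K\<^sup>2 / (4 * c)) * (r * s\<^sup>2 * g\<^sup>2)" .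
  have "k * (r * s\<^sup>2 * g\<^sup>2) + (real CARD('n) + 2) * u \<le> (k + real CARD('n) + 2) * (r * s\<^sup>2) * (b + g\<^sup>2)"
    if "k \<ge> 0" for k
  proof -
    have "0 \<le> k * (r * s\<^sup>2) * b" "0 \<le> (real CARD('n) + 2) * (r * s\<^sup>2) * g\<^sup>2"
      using that r nn by simp_all
    then show ?thesis by (simp add: u_def algebra_simps)
  qed
  from this[of "K\<^sup>2 / (4 * c)"] c have "(K\<^sup>2 / (4 * c)) * (r * s\<^sup>2 * g\<^sup>2) + (real CARD('n) + 2) * u
      \<le> (K\<^sup>2 / (4 * c) + real CARD('n) + 2) * (r * s\<^sup>2) * (b + g\<^sup>2)" by simp
  with S1 S2 have "S \<ge> - ((K\<^sup>2 / (4 * c) + real CARD('n) + 2) * (r * s\<^sup>2) * (b + g\<^sup>2))" by linarith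
  then show ?thesis unfolding Q b_def[symmetric] by (simp only: mult_minus_left)
qed

section \<open>Extension by zero and cutoffs supported in shells around p\<close>

lemma continuous_on_zero_extend:
  assumes "continuous_on U f" "open U" "closed K" "K \<subseteq> U" "\<And>x. x \<notin> K \<Longrightarrow> f x = 0"
  shows "continuous_on UNIV f"
proof -
  have "continuous_on (- K) f"
    by (rule continuous_on_eq[of _ "\<lambda>_. 0"]) (use assms in auto)
  then have "continuous_on (U \<union> - K) f"
    using assms by (intro continuous_on_open_Un) auto
  moreover have "U \<union> - K = UNIV" using \<open>K \<subseteq> U\<close> by auto
  ultimately show ?thesis by simp
qed

lemma borel_measurable_zero_extend:
  fixes f :: "'a::euclidean_space \<Rightarrow> 'b::euclidean_space"
  assumes "continuous_on U f" "open U" "\<And>x. x \<notin> U \<Longrightarrow> f x = 0"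
  shows "f \<in> borel_measurable borel"
proof -
  have "(\<lambda>x. indicator U x *\<^sub>R f x) \<in> borel_measurable borel"
    using assms by (intro borel_measurable_continuous_on_indicator) auto
  also have "(\<lambda>x. indicator U x *\<^sub>R f x) = f" using assms by (auto simp: indicator_def fun_eq_iff)
  finally show ?thesis .
qed

lemma cutoff_grad_inside: "0 < \<epsilon> \<Longrightarrow> dist p x \<le> \<epsilon> \<Longrightarrow> cutoff_grad p \<epsilon> x = 0"
  unfolding cutoff_grad_def
  by (subst ramp_deriv_eq_0) (auto simp: dot_square_norm dist_norm norm_minus_commute divide_le_eq power_mono)

definition shell :: "'a::euclidean_space \<Rightarrow> real \<Rightarrow> real \<Rightarrow> 'a set" where
  "shell p s t = {x. s \<le> dist p x \<and> dist p x \<le> t}"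

lemma compact_shell: "compact (shell p s t)"
proof -
  have "shell p s t = cball p t - ball p s" by (auto simp: shell_def)
  then show ?thesis by (simp add: compact_diff)
qed

definition shell_cutoff :: "'a::euclidean_space \<Rightarrow> real \<Rightarrow> real \<Rightarrow> 'a \<Rightarrow> real" where
  "shell_cutoff p s t x = cutoff p s x * (1 - cutoff p t x)"

definition shell_cutoff_grad :: "'a::euclidean_space \<Rightarrow> real \<Rightarrow> real \<Rightarrow> 'a \<Rightarrow> 'a" where
  "shell_cutoff_grad p s t x = (1 - cutoff p t x) *\<^sub>R cutoff_grad p s x - cutoff p s x *\<^sub>R cutoff_grad p t x"

lemma C1_grad_shell_cutoff: "C1_grad UNIV (shell_cutoff p s t) (shell_cutoff_grad p s t)"
  using C1_grad_mult[OF C1_grad_cutoff[of p s] C1_grad_diff[OF C1_grad_const[of _ 1] C1_grad_cutoff[of p t]]]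
  by (simp add: shell_cutoff_def[abs_def] shell_cutoff_grad_def[abs_def] algebra_simps)

lemma shell_cutoff_eq_1:
  assumes "0 < s" "0 < t" "x \<in> shell p (3 / 2 * s) t"
  shows "shell_cutoff p s t x = 1" "shell_cutoff_grad p s t x = 0"
  using assms cutoff_eq_1[of s p x] cutoff_eq_0[of t p x] cutoff_grad_eq_0[of s p x] cutoff_grad_inside[of t p x]
  by (auto simp: shell_def shell_cutoff_def shell_cutoff_grad_def)

lemma shell_cutoff_eq_0:
  assumes "0 < s" "0 < t" "x \<notin> shell p s (3 / 2 * t)"
  shows "shell_cutoff p s t x = 0"
  using assms cutoff_eq_0[of s p x] cutoff_eq_1[of t p x]
  by (auto simp: shell_def shell_cutoff_def)

lemma shell_cutoff_bounds: "0 \<le> shell_cutoff p s t x" "shell_cutoff p s t x \<le> 1"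
  using cutoff_bounds[of p s x] cutoff_bounds[of p t x]
  by (auto simp: shell_cutoff_def intro!: mult_le_one)

lemma norm_shell_cutoff_grad:
  "norm (shell_cutoff_grad p s t x) \<le> norm (cutoff_grad p s x) + norm (cutoff_grad p t x)"
proof -
  have "norm (shell_cutoff_grad p s t x)
      \<le> \<bar>1 - cutoff p t x\<bar> * norm (cutoff_grad p s x) + \<bar>cutoff p s x\<bar> * norm (cutoff_grad p t x)"
    unfolding shell_cutoff_grad_def norm_scaleR[symmetric] by (rule norm_triangle_ineq4)
  also have "\<dots> \<le> 1 * norm (cutoff_grad p s x) + 1 * norm (cutoff_grad p t x)"
    using cutoff_bounds[of p s x] cutoff_bounds[of p t x]
    by (intro add_mono mult_right_mono) auto
  finally show ?thesis by simp
qed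

lemma C1_grad_inner_self:
  fixes w :: "real^'n::finite \<Rightarrow> real^'n"
  assumes "\<And>j. C1_grad U (\<lambda>x. w x $ j) (\<lambda>x. M x $ j)"
  shows "C1_grad U (\<lambda>x. w x \<bullet> w x) (\<lambda>x. 2 *\<^sub>R (w x v* M x))"
proof -
  have "C1_grad U (\<lambda>x. \<Sum>j\<in>UNIV. w x $ j * w x $ j) (\<lambda>x. \<Sum>j\<in>UNIV. w x $ j *\<^sub>R M x $ j + w x $ j *\<^sub>R M x $ j)"
    by (intro C1_grad_sum C1_grad_mult assms) auto
  moreover have "(\<lambda>x. \<Sum>j\<in>UNIV. w x $ j *\<^sub>R M x $ j + w x $ j *\<^sub>R M x $ j) = (\<lambda>x. 2 *\<^sub>R (w x v* M x))"
    by (simp add: vec_eq_iff fun_eq_iff vector_matrix_mult_def sum_distrib_left mult_ac)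
  ultimately show ?thesis by (simp add: inner_vec_def)
qed

text \<open>The fields are extended by \<open>0\<close> outside \<open>\<Omega> - {p}\<close>; since \<open>H 0 = 0\<close>, all derived fields then vanish
  there as well and are Borel functions on the whole space.\<close>

locale singular_flow =
  fixes \<Omega> :: "(real^'n::finite) set" and p :: "real^'n"
    and \<rho> \<rho>' H :: "real \<Rightarrow> real" and C0 :: real
    and w \<gamma> :: "real^'n \<Rightarrow> real^'n" and M B :: "real^'n \<Rightarrow> real^'n^'n"
    and F :: "real^'n \<Rightarrow> real"
  assumes dim: "CARD('n) > 2" and C0: "C0 > 0" and open_domain: "open \<Omega>" and p_in: "p \<in> \<Omega>"
    and rho_pos: "\<And>t. t \<ge> 0 \<Longrightarrow> \<rho> t > 0"
    and rho_deriv: "\<And>t. t \<ge> 0 \<Longrightarrow> (\<rho> has_real_derivative \<rho>' t) (at t within {0..})"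
    and rho'_cont: "continuous_on {0..} \<rho>'"
    and H_deriv: "\<And>t. t \<ge> 0 \<Longrightarrow> (H has_real_derivative \<rho> t / 2 + t * \<rho>' t) (at t within {0..})"
    and H0: "H 0 = 0"
    and growth_upper: "\<And>t. t \<ge> 0 \<Longrightarrow> \<rho>' t > 0 \<Longrightarrow> \<rho> t / 2 + t * \<rho>' t \<le> C0 * \<rho> t"
    and growth_lower: "\<And>t. t \<ge> 0 \<Longrightarrow> \<rho>' t < 0 \<Longrightarrow> \<rho> t / 2 + t * \<rho>' t \<ge> inverse C0 * \<rho> t"
    and w_C1: "\<And>j. C1_grad (\<Omega> - {p}) (\<lambda>x. w x $ j) (\<lambda>x. M x $ j)"
    and \<gamma>_C1: "\<And>j. C1_grad (\<Omega> - {p}) (\<lambda>x. \<gamma> x $ j) (\<lambda>x. B x $ j)"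
    and zero_outside: "\<And>x. x \<notin> \<Omega> - {p} \<Longrightarrow> w x = 0 \<and> \<gamma> x = 0 \<and> M x = 0 \<and> B x = 0"
    and curl: "\<And>x i j. x \<in> \<Omega> - {p} \<Longrightarrow>
      M x $ j $ i - M x $ i $ j = \<gamma> x $ i * w x $ j - \<gamma> x $ j * w x $ i"
    and div: "\<And>x. x \<in> \<Omega> - {p} \<Longrightarrow>
      (\<Sum>i\<in>UNIV. \<rho> (w x \<bullet> w x) * M x $ i $ i
         + w x $ i * (\<rho>' (w x \<bullet> w x) * (2 *\<^sub>R (w x v* M x)) $ i)) = - \<rho> (w x \<bullet> w x) * (\<gamma> x \<bullet> w x)"
    and F_measurable: "F \<in> borel_measurable lebesgue"
    and F_integrable: "integrable lebesgue (\<lambda>x. F x powr (real CARD('n) / 2))"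
    and F_ge: "\<And>x. norm (B x) + \<gamma> x \<bullet> \<gamma> x \<le> F x"
    and H_integrable:
      "integrable lebesgue (\<lambda>x. \<bar>H (w x \<bullet> w x)\<bar> powr (2 * real CARD('n) / (real CARD('n) - 2)))"
begin

text \<open>\<open>Dh\<close> is the gradient of \<open>h = H \<circ> Q\<close>, \<open>P\<close> is \<open>\<nabla>H + T\<close>, and \<open>pot\<close> is dominated by the function \<open>f\<close> of
  the theorem.\<close>

definition "U = \<Omega> - {p}"
definition "Q x = w x \<bullet> w x"
definition "q x = 2 *\<^sub>R (w x v* M x)"
definition "r x = \<rho> (Q x)"
definition "r' x = \<rho>' (Q x)"
definition "h x = H (Q x)"
definition "Dh x = (\<rho> (Q x) / 2 + Q x * \<rho>' (Q x)) *\<^sub>R q x"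
definition "P x = (r x / 2) *\<^sub>R q x + (r' x * (w x \<bullet> q x)) *\<^sub>R w x"
definition "pot x = norm (B x) + \<gamma> x \<bullet> \<gamma> x"
definition "S x = r x * (\<gamma> x \<bullet> w x) * trace (M x) + r x * (M x \<bullet> transpose (M x)) + r' x * (q x \<bullet> (M x *v w x))
       + r x * (w x \<bullet> w x) * trace (B x) + (r x + r' x * (w x \<bullet> w x)) * (\<gamma> x \<bullet> q x) + 2 * r x * (\<gamma> x \<bullet> w x)\<^sup>2
       - 2 * r x * (w x \<bullet> (B x *v w x) + \<gamma> x \<bullet> (M x *v w x))"

text \<open>Chosen so that H' \<ge> (c0/2) \<rho> throughout: 2/C0 comes from the growth condition
  where \<rho>' < 0, and 1 from H' \<ge> \<rho>/2 where \<rho>' \<ge> 0.\<close>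

definition "c0 = min 1 (2 / C0)"
text \<open>Chosen so that t |\<rho>' t| \<le> L0 \<rho> t: C0 covers \<rho>' > 0, and 1 covers
  \<rho>' < 0, where H' > 0 already forces - t \<rho>' t < \<rho> t / 2.\<close>

definition "L0 = C0 + 1"

lemma c0: "c0 > 0" "c0 \<le> 1" and L0: "L0 > 1"
  using C0 by (auto simp: c0_def L0_def)

lemma open_U: "open U"
  using open_domain by (auto simp: U_def open_delete)

lemma Q_nonneg: "Q x \<ge> 0"
  by (simp add: Q_def)

section \<open>Consequences of the growth conditions on \<rho>\<close>

lemma rho'_bound: assumes "t \<ge> 0" shows "\<bar>\<rho>' t\<bar> * t \<le> L0 * \<rho> t"
proof (cases "\<rho>' t > 0")
  case True
  then show ?thesis using growth_upper[OF assms True] rho_pos[OF assms] by (simp add: L0_def algebra_simps)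
next
  case False
  have "- (t * \<rho>' t) \<le> \<rho> t"
  proof (cases "\<rho>' t = 0")
    case False
    have "0 \<le> inverse C0 * \<rho> t" using C0 rho_pos[OF assms] by simp
    then show ?thesis using growth_lower[OF assms] False \<open>\<not> \<rho>' t > 0\<close> rho_pos[OF assms] by simp
  qed (use rho_pos[OF assms] in simp)
  moreover have "\<rho> t \<le> L0 * \<rho> t" using L0 rho_pos[OF assms] by simp
  ultimately show ?thesis using False by (simp add: mult.commute)
qed

lemma H'_lower: assumes "t \<ge> 0" shows "c0 / 2 * \<rho> t \<le> \<rho> t / 2 + t * \<rho>' t"
proof (cases "\<rho>' t < 0")
  case True
  have "c0 / 2 * \<rho> t \<le> inverse C0 * \<rho> t"
    using rho_pos[OF assms] C0 by (intro mult_right_mono) (auto simp: c0_def field_simps min_def)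
  then show ?thesis using growth_lower[OF assms True] by simp
next
  case False
  have "c0 * \<rho> t \<le> 1 * \<rho> t" using c0 rho_pos[OF assms] by (intro mult_right_mono) auto
  moreover have "0 \<le> t * \<rho>' t" using False assms by simp
  ultimately show ?thesis by linarith
qed

lemma H'_pos: "t \<ge> 0 \<Longrightarrow> 0 < \<rho> t / 2 + t * \<rho>' t"
  by (rule less_le_trans[OF _ H'_lower]) (use c0 rho_pos in auto)

lemma H'_upper: assumes "t \<ge> 0" shows "\<rho> t / 2 + t * \<rho>' t \<le> (L0 + 1) * \<rho> t"
proof -
  have "t * \<rho>' t \<le> \<bar>\<rho>' t\<bar> * t"
    using assms by (metis abs_ge_self mult.commute mult_left_mono)
  then show ?thesis using rho'_bound[OF assms] rho_pos[OF assms] by (simp add: algebra_simps)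
qed

lemma H_nonneg: assumes "t \<ge> 0" shows "H t \<ge> 0"
proof -
  have "H 0 \<le> H t"
  proof (rule DERIV_nonneg_imp_increasing_open[OF assms])
    show "continuous_on {0..t} H"
      using H_deriv DERIV_continuous unfolding continuous_on_eq_continuous_within
      by (meson atLeastAtMost_iff atLeast_iff continuous_within_subset subsetI)
    show "\<exists>y. (H has_real_derivative y) (at x) \<and> 0 \<le> y" if "0 < x" "x < t" for x
      using H_deriv[of x] H'_pos[of x] that at_within_interior[of x "{0..}"] by auto
  qed
  then show ?thesis using H0 by simp
qed

text \<open>Both sides vanish at 0, so derivatives are compared: the derivative of t \<rho> is H' +
  \<rho>/2, and \<rho>/2 \<le> H'/c0. This expresses the bound on the zero-order term, which comes
  in terms of Q \<rho>, by H itself.\<close>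

lemma rho_le_H: assumes "t \<ge> 0" shows "\<rho> t * t \<le> (1 + 1 / c0) * H t"
proof -
  let ?g = "\<lambda>t. (1 + 1 / c0) * H t - \<rho> t * t"
  have d: "(?g has_real_derivative (1 + 1 / c0) * (\<rho> t / 2 + t * \<rho>' t) - (\<rho> t + \<rho>' t * t)) (at t within {0..})"
    if "t \<ge> 0" for t
    by (rule DERIV_cong[OF DERIV_diff[OF DERIV_cmult[OF H_deriv[OF that]]
          DERIV_mult[OF rho_deriv[OF that] DERIV_ident]]]) simp
  have "?g 0 \<le> ?g t"
  proof (rule DERIV_nonneg_imp_increasing_open[OF assms])
    show "continuous_on {0..t} ?g"
      using d DERIV_continuous unfolding continuous_on_eq_continuous_within
      by (meson atLeastAtMost_iff atLeast_iff continuous_within_subset subsetI)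
    show "\<exists>y. (?g has_real_derivative y) (at x) \<and> 0 \<le> y" if x: "0 < x" "x < t" for x
    proof -
      define y where "y = \<rho> x / 2 + x * \<rho>' x"
      have "\<rho> x / 2 \<le> y / c0"
        using H'_lower[of x] x c0 by (simp add: field_simps y_def)
      moreover have "(1 + 1 / c0) * y - (\<rho> x + \<rho>' x * x) = y / c0 - \<rho> x / 2"
        by (simp add: distrib_right) (simp add: y_def)
      ultimately have "0 \<le> (1 + 1 / c0) * (\<rho> x / 2 + x * \<rho>' x) - (\<rho> x + \<rho>' x * x)"
        by (simp add: y_def)
      then show ?thesis
        using d[of x] x at_within_interior[of x "{0..}"] by auto
    qed
  qed
  then show ?thesis using H0 by simp
qed

lemma zero_off_U:
  assumes "x \<notin> U"
  shows "w x = 0" "\<gamma> x = 0" "M x = 0" "B x = 0" "Q x = 0" "q x = 0" "h x = 0" "Dh x = 0" "P x = 0" "pot x = 0"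
  using zero_outside[of x] assms H0
  by (auto simp: U_def Q_def q_def h_def Dh_def P_def pot_def)

lemma C1_Q: "C1_grad U Q q"
  unfolding U_def Q_def[abs_def] q_def[abs_def] by (rule C1_grad_inner_self[OF w_C1])

lemma C1_r: "C1_grad U r (\<lambda>x. r' x *\<^sub>R q x)"
  unfolding r_def[abs_def] r'_def
  by (rule C1_grad_compose[OF C1_Q, of "{0..}"]) (use Q_nonneg rho_deriv rho'_cont in auto)

lemma C1_h: "C1_grad U h Dh"
  unfolding h_def[abs_def] Dh_def[abs_def]
proof (rule C1_grad_compose[OF C1_Q, of "{0..}"])
  show "continuous_on {0..} (\<lambda>t. \<rho> t / 2 + t * \<rho>' t)"
    using rho_deriv rho'_cont DERIV_continuous_on[of "{0..}" \<rho> \<rho>']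
    by (intro continuous_intros) auto
qed (use Q_nonneg H_deriv in auto)

lemma cont_U: "continuous_on U w" "continuous_on U \<gamma>" "continuous_on U M" "continuous_on U B"
  "continuous_on U Q" "continuous_on U q" "continuous_on U r" "continuous_on U r'"
  "continuous_on U h" "continuous_on U Dh"
proof -
  have vec: "continuous_on U f" if "\<And>j. continuous_on U (\<lambda>x. f x $ j)" for f :: "real^'n \<Rightarrow> ('b::topological_space, 'n) vec"
    using continuous_on_vec_lambda[where f="\<lambda>j x. f x $ j" and S=U] that by simp
  show "continuous_on U w" "continuous_on U \<gamma>" "continuous_on U M" "continuous_on U B"
    using C1_grad_cont[OF w_C1] C1_grad_cont[OF \<gamma>_C1] C1_grad_cont_grad[OF w_C1] C1_grad_cont_grad[OF \<gamma>_C1]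
    unfolding U_def[symmetric] by (auto intro: vec)
  show "continuous_on U Q" "continuous_on U q" "continuous_on U r" "continuous_on U h" "continuous_on U Dh"
    using C1_Q C1_r C1_h by (auto intro: C1_grad_cont C1_grad_cont_grad)
  show "continuous_on U r'"
    unfolding r'_def[abs_def]
    by (rule continuous_on_compose2[OF rho'_cont \<open>continuous_on U Q\<close>]) (use Q_nonneg in auto)
qed

lemma cont_P: "continuous_on U P" and cont_pot: "continuous_on U pot"
  unfolding P_def[abs_def] pot_def[abs_def] using cont_U by (auto intro!: continuous_intros)

lemma measurable_fields [measurable]:
  "h \<in> borel_measurable borel" "Dh \<in> borel_measurable borel" "P \<in> borel_measurable borel" "pot \<in> borel_measurable borel"
  using borel_measurable_zero_extend[OF _ open_U] cont_U cont_P cont_pot zero_off_U by blast+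

lemma h_nonneg: "h x \<ge> 0"
  unfolding h_def by (rule H_nonneg[OF Q_nonneg])

lemma pot_nonneg: "pot x \<ge> 0"
  by (simp add: pot_def)

text \<open>The constant of \<open>zero_order_term_bound\<close> for L = L0 and c = c0, times the
  factor of \<open>rho_le_H\<close>. It becomes the C of the final inequality.\<close>

definition "Ksub = (((6 + 6 * L0 + real CARD('n))\<^sup>2 / (4 * c0)) + real CARD('n) + 2) * (1 + 1 / c0)"

lemma Ksub_pos: "Ksub > 0"
  using c0 unfolding Ksub_def by (intro mult_pos_pos add_nonneg_pos) (auto intro!: add_pos_nonneg)

lemma S_bound: assumes "x \<in> U" shows "S x \<ge> - Ksub * pot x * h x"
proof -
  define k where "k = ((6 + 6 * L0 + real CARD('n))\<^sup>2 / (4 * c0)) + real CARD('n) + 2"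
  have "S x \<ge> - k * (r x * (w x \<bullet> w x)) * (norm (B x) + \<gamma> x \<bullet> \<gamma> x)"
    unfolding k_def
  proof (rule zero_order_term_bound[OF _ q_def _ c0 _ _ S_def])
    show "\<bar>r' x\<bar> * (w x \<bullet> w x) \<le> L0 * r x"
      using rho'_bound[OF Q_nonneg[of x]] by (simp add: Q_def r_def r'_def)
    show "c0 / 2 * r x \<le> r x / 2 + (w x \<bullet> w x) * r' x"
      using H'_lower[OF Q_nonneg[of x]] by (simp add: Q_def r_def r'_def)
  qed (use assms curl rho_pos[OF Q_nonneg] in \<open>auto simp: U_def r_def\<close>)
  moreover have "k * (r x * (w x \<bullet> w x)) * pot x \<le> k * ((1 + 1 / c0) * h x) * pot x"
    using rho_le_H[OF Q_nonneg[of x]] c0 pot_nonneg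
    by (intro mult_right_mono mult_left_mono) (auto simp: r_def Q_def h_def k_def)
  ultimately show ?thesis by (simp add: Ksub_def pot_def flip: k_def) (simp add: mult_ac)
qed

section \<open>The weak equation on shells around p\<close>

lemma shell_subset_U: "0 < s \<Longrightarrow> cball p t \<subseteq> \<Omega> \<Longrightarrow> shell p s t \<subseteq> U"
  by (auto simp: shell_def U_def)

text \<open>By \<open>flux_identity\<close>, P \<bullet> z + \<zeta> S is a sum of continuous terms
  supported in the shell, hence away from p, whose integrals cancel.\<close>

lemma weak_identity:
  assumes \<zeta>: "C1_grad UNIV \<zeta> z" and 0: "\<And>x. x \<notin> shell p s t \<Longrightarrow> \<zeta> x = 0"
    and s: "0 < s" "0 < t" and sub: "cball p (3 * t) \<subseteq> \<Omega>"
  shows "integrable lborel (\<lambda>x. P x \<bullet> z x)" "integrable lborel (\<lambda>x. \<zeta> x * S x)"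
    "(\<integral>x. P x \<bullet> z x \<partial>lborel) = - (\<integral>x. \<zeta> x * S x \<partial>lborel)"
proof -
  define K where "K = shell p s t"
  define K' where "K' = shell p (s / 2) (3 * t)"
  have K: "compact K" "closed K" "K \<subseteq> U" and K': "compact K'" "closed K'" "K' \<subseteq> U"
    unfolding K_def K'_def using s sub subset_trans[OF _ sub, of "cball p t"] cball_subset_cball_iff[of p t p "3 * t"]
      shell_subset_U[of s t] shell_subset_U[of "s / 2" "3 * t"]
    by (simp_all add: compact_shell compact_imp_closed)
  have z0: "z x = 0" if "x \<notin> K" for x
    by (rule C1_grad_zero_outside[OF \<zeta> K(2) _ that]) (use 0 in \<open>auto simp: K_def\<close>)
  have \<zeta>0: "\<zeta> x = 0" if "x \<notin> K" for x using that 0 by (auto simp: K_def)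
  \<comment> \<open>\<open>integral_gradient_swap\<close> wants C^1 functions of compact support on
    the whole space. Multiplication by \<kappa> makes \<rho> w_i such a function, and \<kappa> is 1
    on \<open>K\<close>, where the other factor lives. Its support reaches the radius 3/2 * 2 t,
    whence the room \<open>cball p (3 * t)\<close>.\<close>
  define \<kappa> where "\<kappa> = shell_cutoff p (s / 2) (2 * t)"
  define \<kappa>g where "\<kappa>g = shell_cutoff_grad p (s / 2) (2 * t)"
  have \<kappa>: "C1_grad UNIV \<kappa> \<kappa>g" unfolding \<kappa>_def \<kappa>g_def by (rule C1_grad_shell_cutoff)
  have \<kappa>0: "\<kappa> x = 0" if "x \<notin> K'" for x
    using that shell_cutoff_eq_0[of "s / 2" "2 * t" x p] s by (auto simp: \<kappa>_def K'_def)
  have \<kappa>1: "\<kappa> x = 1" "\<kappa>g x = 0" if "x \<in> K" for x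
    using that shell_cutoff_eq_1[of "s / 2" "2 * t" x p] s by (auto simp: \<kappa>_def \<kappa>g_def K_def shell_def)
  define e where "e i = (axis i 1 :: real^'n)" for i
  have e: "u \<bullet> e i = u $ i" for u i by (simp add: e_def inner_axis)
  define dV where "dV i x = r x *\<^sub>R M x $ i + w x $ i *\<^sub>R (r' x *\<^sub>R q x)" for i x
  have V: "C1_grad U (\<lambda>x. r x * w x $ i) (dV i)" for i
    unfolding dV_def[abs_def] by (rule C1_grad_mult[OF C1_r w_C1[folded U_def]])
  define d\<psi> where "d\<psi> j x = \<zeta> x *\<^sub>R M x $ j + w x $ j *\<^sub>R z x" for j x
  have \<psi>: "C1_grad UNIV (\<lambda>x. \<zeta> x * w x $ j) (d\<psi> j)" for j
    unfolding d\<psi>_def[abs_def] by (rule C1_grad_mult_extend[OF w_C1[folded U_def] \<zeta> open_U K(2,3) \<zeta>0])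
  have d\<psi>0: "d\<psi> j x = 0" if "x \<notin> K" for j x using that by (simp add: d\<psi>_def z0 \<zeta>0)
  have cdV: "continuous_on U (dV i)" and cd\<psi>: "continuous_on UNIV (d\<psi> j)" for i j
    using V \<psi> by (auto intro: C1_grad_cont_grad)
  have V\<psi>: "integrable lborel (\<lambda>x. (dV i x \<bullet> u) * (d\<psi> j x \<bullet> v))" for i j u v
    by (rule integrable_compact_support[OF _ K(1)], rule continuous_on_zero_extend[OF _ open_U K(2,3)])
      (use d\<psi>0 cdV continuous_on_subset[OF cd\<psi>] in \<open>auto intro!: continuous_intros\<close>)
  have swap: "(\<integral>x. (dV i x \<bullet> e j) * (d\<psi> j x \<bullet> e i) \<partial>lborel) = (\<integral>x. (dV i x \<bullet> e i) * (d\<psi> j x \<bullet> e j) \<partial>lborel)" for i j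
  proof -
    have 1: "C1_grad UNIV (\<lambda>x. \<kappa> x * (r x * w x $ i)) (\<lambda>x. \<kappa> x *\<^sub>R dV i x + (r x * w x $ i) *\<^sub>R \<kappa>g x)"
      by (rule C1_grad_mult_extend[OF V \<kappa> open_U K'(2,3) \<kappa>0])
    have 2: "((\<kappa> x *\<^sub>R dV i x + (r x * w x $ i) *\<^sub>R \<kappa>g x) \<bullet> u) * (d\<psi> j x \<bullet> v) = (dV i x \<bullet> u) * (d\<psi> j x \<bullet> v)" for x u v
      by (cases "x \<in> K") (simp_all add: \<kappa>1 d\<psi>0)
    show ?thesis
      using integral_gradient_swap[OF 1 K'(1) _ \<psi>[of j] K(1), of "e j" "e i"] \<kappa>0 \<zeta>0 unfolding 2 by simp
  qed
  define dY where "dY i x = (r x * Q x) *\<^sub>R B x $ i + \<gamma> x $ i *\<^sub>R (r x *\<^sub>R q x + Q x *\<^sub>R (r' x *\<^sub>R q x))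
      - 2 *\<^sub>R ((\<gamma> x \<bullet> w x) *\<^sub>R dV i x + (r x * w x $ i) *\<^sub>R (\<Sum>k\<in>UNIV. \<gamma> x $ k *\<^sub>R M x $ k + w x $ k *\<^sub>R B x $ k))" for i x
  \<comment> \<open>The field Y of \<open>flux_identity\<close>; \<open>dY i\<close> is the gradient
    of its i-th component.\<close>
  define Y where "Y i x = r x * Q x * \<gamma> x $ i - 2 * ((\<gamma> x \<bullet> w x) * (r x * w x $ i))" for i x
  have Y: "C1_grad U (Y i) (dY i)" for i
  proof -
    have "C1_grad U (\<lambda>x. \<gamma> x \<bullet> w x) (\<lambda>x. \<Sum>k\<in>UNIV. \<gamma> x $ k *\<^sub>R M x $ k + w x $ k *\<^sub>R B x $ k)"
      unfolding inner_vec_def inner_real_def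
      by (intro C1_grad_sum C1_grad_mult w_C1[folded U_def] \<gamma>_C1[folded U_def]) auto
    then show ?thesis
      unfolding Y_def[abs_def] dY_def[abs_def]
      by (intro C1_grad_diff C1_grad_cmult C1_grad_mult V C1_r C1_Q \<gamma>_C1[folded U_def])
  qed
  have \<zeta>Y: "C1_grad UNIV (\<lambda>x. \<zeta> x * Y i x) (\<lambda>x. \<zeta> x *\<^sub>R dY i x + Y i x *\<^sub>R z x)" for i
    by (rule C1_grad_mult_extend[OF Y \<zeta> open_U K(2,3) \<zeta>0])
  have Yint: "integrable lborel (\<lambda>x. (\<zeta> x *\<^sub>R dY i x + Y i x *\<^sub>R z x) \<bullet> e i)" for i
    by (rule integrable_compact_support[OF continuous_on_inner[OF C1_grad_cont_grad[OF \<zeta>Y] continuous_on_const] K(1)])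
      (simp add: z0 \<zeta>0)
  have Y0: "(\<integral>x. (\<zeta> x *\<^sub>R dY i x + Y i x *\<^sub>R z x) \<bullet> e i \<partial>lborel) = 0" for i
    by (rule integral_gradient_eq_0[OF \<zeta>Y K(1)]) (use \<zeta>0 in auto)
  define R where "R x = (\<Sum>i\<in>UNIV. \<Sum>j\<in>UNIV. (dV i x \<bullet> e j) * (d\<psi> j x \<bullet> e i) - (dV i x \<bullet> e i) * (d\<psi> j x \<bullet> e j))
      + (\<Sum>i\<in>UNIV. (\<zeta> x *\<^sub>R dY i x + Y i x *\<^sub>R z x) \<bullet> e i)" for x
  have Rint: "integrable lborel R"
    unfolding R_def[abs_def] by (intro Bochner_Integration.integrable_add Bochner_Integration.integrable_sum
        Bochner_Integration.integrable_diff V\<psi> Yint)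
  have R0: "integral\<^sup>L lborel R = 0"
  proof -
    have "integral\<^sup>L lborel R = (\<Sum>i\<in>UNIV. \<Sum>j\<in>UNIV. (\<integral>x. (dV i x \<bullet> e j) * (d\<psi> j x \<bullet> e i) \<partial>lborel)
         - (\<integral>x. (dV i x \<bullet> e i) * (d\<psi> j x \<bullet> e j) \<partial>lborel)) + (\<Sum>i\<in>UNIV. \<integral>x. (\<zeta> x *\<^sub>R dY i x + Y i x *\<^sub>R z x) \<bullet> e i \<partial>lborel)"
      unfolding R_def
      by (subst Bochner_Integration.integral_add Bochner_Integration.integral_sum Bochner_Integration.integral_diff;
          (intro Bochner_Integration.integrable_add Bochner_Integration.integrable_sum
            Bochner_Integration.integrable_diff V\<psi> Yint)?)+ simp
    then show ?thesis using swap Y0 by simp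
  qed
  have key: "P x \<bullet> z x + \<zeta> x * S x = R x" for x
  proof (cases "x \<in> K")
    case True
    then have x: "x \<in> \<Omega> - {p}" using K(3) by (auto simp: U_def)
    show ?thesis
      unfolding P_def R_def
      by (subst flux_identity[OF curl[OF x] q_def div[OF x, folded q_def Q_def r_def r'_def] S_def])
        (simp add: e dV_def d\<psi>_def dY_def Y_def Q_def algebra_simps)
  next
    case False
    then show ?thesis by (simp add: R_def d\<psi>0 z0 \<zeta>0)
  qed
  show P: "integrable lborel (\<lambda>x. P x \<bullet> z x)"
    by (rule integrable_compact_support[OF _ K(1)], rule continuous_on_zero_extend[OF _ open_U K(2,3)])
      (use z0 cont_P continuous_on_subset[OF C1_grad_cont_grad[OF \<zeta>]] in \<open>auto intro!: continuous_intros\<close>)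
  have S: "(\<lambda>x. \<zeta> x * S x) = (\<lambda>x. R x - P x \<bullet> z x)" using key by (auto simp: fun_eq_iff algebra_simps)
  show "integrable lborel (\<lambda>x. \<zeta> x * S x)" unfolding S using Rint P by simp
  show "(\<integral>x. P x \<bullet> z x \<partial>lborel) = - (\<integral>x. \<zeta> x * S x \<partial>lborel)" unfolding S using Rint P R0 by simp
qed

lemma weak_subsolution_off_p:
  assumes \<zeta>: "C1_grad UNIV \<zeta> z" and 0: "\<And>x. x \<notin> shell p s t \<Longrightarrow> \<zeta> x = 0" and nn: "\<And>x. \<zeta> x \<ge> 0"
    and s: "0 < s" "0 < t" and sub: "cball p (3 * t) \<subseteq> \<Omega>"
  shows "integrable lborel (\<lambda>x. P x \<bullet> z x)" "integrable lborel (\<lambda>x. pot x * h x * \<zeta> x)"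
    "(\<integral>x. P x \<bullet> z x \<partial>lborel) \<le> Ksub * (\<integral>x. pot x * h x * \<zeta> x \<partial>lborel)"
proof -
  note W = weak_identity[OF \<zeta> 0 s sub]
  show "integrable lborel (\<lambda>x. P x \<bullet> z x)" by (rule W(1))
  have K: "compact (shell p s t)" "closed (shell p s t)" "shell p s t \<subseteq> U"
    using s sub subset_trans[OF _ sub, of "cball p t"] cball_subset_cball_iff[of p t p "3 * t"]
      shell_subset_U[of s t] shell_subset_U[of "s / 2" "3 * t"]
    by (simp_all add: compact_shell compact_imp_closed)
  show i: "integrable lborel (\<lambda>x. pot x * h x * \<zeta> x)"
    by (rule integrable_compact_support[OF _ K(1)], rule continuous_on_zero_extend[OF _ open_U K(2,3)])
      (use 0 cont_pot cont_U continuous_on_subset[OF C1_grad_cont[OF \<zeta>]] in \<open>auto intro!: continuous_intros\<close>)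
  have "- (\<integral>x. \<zeta> x * S x \<partial>lborel) = (\<integral>x. - (\<zeta> x * S x) \<partial>lborel)" by simp
  also have "\<dots> \<le> (\<integral>x. Ksub * (pot x * h x * \<zeta> x) \<partial>lborel)"
  proof (rule integral_mono)
    show "- (\<zeta> x * S x) \<le> Ksub * (pot x * h x * \<zeta> x)" for x
    proof (cases "x \<in> shell p s t")
      case True
      then have "\<zeta> x * (- S x) \<le> \<zeta> x * (Ksub * pot x * h x)"
        using S_bound[of x] K(3) nn by (intro mult_left_mono) auto
      then show ?thesis by (simp add: mult_ac)
    qed (simp add: 0)
  qed (use W(2) i in auto)
  finally show "(\<integral>x. P x \<bullet> z x \<partial>lborel) \<le> Ksub * (\<integral>x. pot x * h x * \<zeta> x \<partial>lborel)"
    using W(3) by simp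
qed

end

section \<open>The energy estimate\<close>

text \<open>N/2 and N/(N-2) are conjugate, and squaring b doubles the second exponent. The factors
  2/N and (N-2)/N of Young's inequality are at most 1 and are dropped.\<close>

lemma young_critical:
  fixes a b N :: real
  assumes N: "N > 2" and a: "a \<ge> 0" and b: "b \<ge> 0"
  shows "a * b\<^sup>2 \<le> a powr (N / 2) + b powr (2 * N / (N - 2))"
proof -
  have "a * b\<^sup>2 \<le> a powr (N / 2) / (N / 2) + (b\<^sup>2) powr (N / (N - 2)) / (N / (N - 2))"
    by (rule Youngs_inequality) (use assms in \<open>auto simp: field_simps\<close>)
  also have "(b\<^sup>2) powr (N / (N - 2)) = b powr (2 * N / (N - 2))"
    using b powr_powr[of b 2 "N / (N - 2)"] by simp
  also have "a powr (N / 2) / (N / 2) \<le> a powr (N / 2)"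
  proof -
    have "a powr (N / 2) * (2 / N) \<le> a powr (N / 2) * 1"
      using N by (intro mult_left_mono) auto
    then show ?thesis by simp
  qed
  also have "b powr (2 * N / (N - 2)) / (N / (N - 2)) \<le> b powr (2 * N / (N - 2))"
  proof -
    have "b powr (2 * N / (N - 2)) * ((N - 2) / N) \<le> b powr (2 * N / (N - 2)) * 1"
      using N by (intro mult_left_mono) auto
    then show ?thesis by simp
  qed
  finally show ?thesis by simp
qed

lemma young_critical':
  fixes t b N :: real
  assumes "N > 2" "t \<ge> 0" "b \<ge> 0"
  shows "t\<^sup>2 * b\<^sup>2 \<le> t powr N + b powr (2 * N / (N - 2))"
  using young_critical[of N "t\<^sup>2" b] assms powr_powr[of t 2 "N / 2"] by simp

lemma powr_add_le:
  fixes a b s :: real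
  assumes "a \<ge> 0" "b \<ge> 0" "s \<ge> 0"
  shows "(a + b) powr s \<le> 2 powr s * (a powr s + b powr s)"
proof -
  have "(a + b) powr s \<le> (2 * max a b) powr s" using assms by (intro powr_mono2) auto
  also have "\<dots> = 2 powr s * (max a b) powr s" using assms by (simp add: powr_mult)
  also have "\<dots> \<le> 2 powr s * (a powr s + b powr s)" by (intro mult_left_mono) (auto simp: max_def)
  finally show ?thesis .
qed

lemma cutoff_tendsto_1:
  assumes "e \<longlonglongrightarrow> 0" "\<And>k. 0 < e k" "x \<noteq> p"
  shows "(\<lambda>k. cutoff p (e k) x) \<longlonglongrightarrow> 1"
proof -
  have "(\<lambda>k. 3 / 2 * e k) \<longlonglongrightarrow> 3 / 2 * 0" by (intro tendsto_intros assms)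
  then have "\<forall>\<^sub>F k in sequentially. 3 / 2 * e k < dist p x"
    using order_tendstoD(2)[of _ _ _ "dist p x"] assms(3) by (metis mult_zero_right zero_less_dist_iff)
  then have "\<forall>\<^sub>F k in sequentially. cutoff p (e k) x = 1"
    by eventually_elim (rule cutoff_eq_1[OF assms(2) less_imp_le])
  then show ?thesis by (rule tendsto_eventually)
qed

lemma AE_lborel_neq: "AE x in lborel. x \<noteq> (p::'a::euclidean_space)"
  using AE_lborel_singleton[of p] by simp

lemma integral_cutoff_tendsto:
  fixes g :: "'a::euclidean_space \<Rightarrow> real"
  assumes e: "e \<longlonglongrightarrow> 0" "\<And>k. 0 < e k" and g: "integrable lborel g"
  shows "(\<lambda>k. \<integral>x. cutoff p (e k) x * g x \<partial>lborel) \<longlonglongrightarrow> integral\<^sup>L lborel g"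
proof (rule integral_dominated_convergence[where w="\<lambda>x. \<bar>g x\<bar>"])
  have [measurable]: "cutoff p (e k) \<in> borel_measurable borel" for k
    by (intro borel_measurable_continuous_onI C1_grad_cont[OF C1_grad_cutoff])
  show "(\<lambda>x. cutoff p (e k) x * g x) \<in> borel_measurable lborel" for k
    using g by measurable
  show "AE x in lborel. (\<lambda>k. cutoff p (e k) x * g x) \<longlonglongrightarrow> g x"
    using AE_lborel_neq[of p]
  proof eventually_elim
    case (elim x)
    then show ?case using tendsto_mult[OF cutoff_tendsto_1[OF e elim] tendsto_const[of "g x"]] by simp
  qed
  show "AE x in lborel. norm (cutoff p (e k) x * g x) \<le> \<bar>g x\<bar>" for k
    using cutoff_bounds[of p "e k"] by (intro AE_I2) (auto simp: abs_mult intro: mult_left_le_one_le)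
qed (use g in auto)

lemma integrable_cutoff_mult:
  fixes g :: "'a::euclidean_space \<Rightarrow> real"
  assumes g: "integrable lborel g"
  shows "integrable lborel (\<lambda>x. cutoff p \<epsilon> x * g x)"
proof (rule Bochner_Integration.integrable_bound[OF g])
  have [measurable]: "cutoff p \<epsilon> \<in> borel_measurable borel"
    by (intro borel_measurable_continuous_onI C1_grad_cont[OF C1_grad_cutoff])
  show "(\<lambda>x. cutoff p \<epsilon> x * g x) \<in> borel_measurable lborel" using g by measurable
  show "AE x in lborel. norm (cutoff p \<epsilon> x * g x) \<le> norm (g x)"
    using cutoff_bounds[of p \<epsilon>] by (intro AE_I2) (auto simp: abs_mult intro: mult_left_le_one_le)
qed

text \<open>With g the gradient of the cutoff, |u \<bullet> g| \<le> |u|^2 + |g|^2 on a shrinking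
  ball. The integral of |u|^2 over that ball tends to 0 by dominated convergence, that of |g|^2 is
  of order \<epsilon>^(n-2) and tends to 0 as n > 2.\<close>

lemma integral_cutoff_grad_vanishes:
  fixes u :: "'a::euclidean_space \<Rightarrow> 'a"
  assumes dim: "DIM('a) > 2" and e: "e \<longlonglongrightarrow> 0" "\<And>k. 0 < e k"
    and [measurable]: "u \<in> borel_measurable borel" and u: "integrable lborel (\<lambda>x. (norm (u x))\<^sup>2)"
  shows "(\<lambda>k. \<integral>x. u x \<bullet> cutoff_grad p (e k) x \<partial>lborel) \<longlonglongrightarrow> 0"
    and "integrable lborel (\<lambda>x. u x \<bullet> cutoff_grad p (e k) x)"
proof -
  have [measurable]: "cutoff_grad p (e k) \<in> borel_measurable borel" for k
    by (intro borel_measurable_continuous_onI C1_grad_cont_grad[OF C1_grad_cutoff])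
  define v where "v k x = indicator (cball p (3 / 2 * e k)) x * (norm (u x))\<^sup>2" for k x
  define g where "g k x = norm (cutoff_grad p (e k) x) powr 2" for k x
  have le: "norm (u x \<bullet> cutoff_grad p (e k) x) \<le> v k x + g k x" for k x
  proof (cases "x \<in> cball p (3 / 2 * e k)")
    case True
    have "norm (u x \<bullet> cutoff_grad p (e k) x) \<le> norm (u x) * norm (cutoff_grad p (e k) x)"
      unfolding real_norm_def by (rule Cauchy_Schwarz_ineq2)
    also have "\<dots> \<le> (norm (u x))\<^sup>2 + (norm (cutoff_grad p (e k) x))\<^sup>2"
      using sum_squares_bound[of "norm (u x)" "norm (cutoff_grad p (e k) x)"]
        mult_nonneg_nonneg[OF norm_ge_zero[of "u x"] norm_ge_zero[of "cutoff_grad p (e k) x"]] by linarith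
    finally show ?thesis using True by (simp add: v_def g_def)
  next
    case False
    then have "cutoff_grad p (e k) x = 0" using cutoff_grad_eq_0[OF e(2), of k p x] by auto
    then show ?thesis by (simp add: v_def g_def)
  qed
  have vi: "integrable lborel (v k)" for k
    by (rule Bochner_Integration.integrable_bound[OF u]) (auto simp: v_def[abs_def] indicator_def)
  have gi: "integrable lborel (g k)" for k
    unfolding g_def[abs_def] by (rule integral_cutoff_grad_powr(1)[OF e(2)]) simp
  show int: "integrable lborel (\<lambda>x. u x \<bullet> cutoff_grad p (e k) x)" for k
    by (rule Bochner_Integration.integrable_bound[OF Bochner_Integration.integrable_add[OF vi gi], of _ k k])
      (use le[of _ k] in \<open>auto intro!: AE_I2 intro: order_trans[OF _ abs_ge_self]\<close>)
  have v0: "(\<lambda>k. integral\<^sup>L lborel (v k)) \<longlonglongrightarrow> 0"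
  proof -
    have "(\<lambda>k. integral\<^sup>L lborel (v k)) \<longlonglongrightarrow> (\<integral>x. 0 \<partial>(lborel :: 'a measure))"
    proof (rule integral_dominated_convergence[where w="\<lambda>x. (norm (u x))\<^sup>2"])
      show "AE x in lborel. (\<lambda>k. v k x) \<longlonglongrightarrow> 0"
        using AE_lborel_neq[of p]
      proof eventually_elim
        case (elim x)
        have "(\<lambda>k. 3 / 2 * e k) \<longlonglongrightarrow> 3 / 2 * 0" by (intro tendsto_intros e)
        then have "\<forall>\<^sub>F k in sequentially. 3 / 2 * e k < dist p x"
          using order_tendstoD(2)[of _ _ _ "dist p x"] elim by (metis mult_zero_right zero_less_dist_iff)
        then have "\<forall>\<^sub>F k in sequentially. v k x = 0"
          by eventually_elim (simp add: v_def)
        then show ?case by (rule tendsto_eventually)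
      qed
      show "AE x in lborel. norm (v k x) \<le> (norm (u x))\<^sup>2" for k
        by (intro AE_I2) (simp add: v_def indicator_def)
    qed (use u vi in auto)
    then show ?thesis by simp
  qed
  define A where "A = unit_ball_vol (real DIM('a)) * 12 powr 2 * 2 ^ DIM('a)"
  have "(\<lambda>k. A * e k powr (real DIM('a) - 2)) \<longlonglongrightarrow> A * 0 powr (real DIM('a) - 2)"
    by (intro tendsto_mult tendsto_const tendsto_powr' e(1)) (use dim e(2) in \<open>auto intro!: always_eventually less_imp_le\<close>)
  then have A0: "(\<lambda>k. A * e k powr (real DIM('a) - 2)) \<longlonglongrightarrow> 0" by simp
  show "(\<lambda>k. \<integral>x. u x \<bullet> cutoff_grad p (e k) x \<partial>lborel) \<longlonglongrightarrow> 0"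
  proof (rule Lim_null_comparison)
    show "(\<lambda>k. integral\<^sup>L lborel (v k) + A * e k powr (real DIM('a) - 2)) \<longlonglongrightarrow> 0"
      using tendsto_add[OF v0 A0] by simp
    have "norm (\<integral>x. u x \<bullet> cutoff_grad p (e k) x \<partial>lborel) \<le> integral\<^sup>L lborel (v k) + A * e k powr (real DIM('a) - 2)" for k
    proof -
      have "norm (\<integral>x. u x \<bullet> cutoff_grad p (e k) x \<partial>lborel) \<le> (\<integral>x. v k x + g k x \<partial>lborel)"
        by (rule Bochner_Integration.integral_norm_bound_integral[OF int _ le]) (use vi gi in auto)
      also have "\<dots> = integral\<^sup>L lborel (v k) + integral\<^sup>L lborel (g k)" using vi gi by simp
      also have "integral\<^sup>L lborel (g k) \<le> A * e k powr (real DIM('a) - 2)"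
        unfolding g_def A_def using integral_cutoff_grad_powr(2)[OF e(2), of 2 p k] by simp
      finally show ?thesis by simp
    qed
    then show "\<forall>\<^sub>F k in sequentially. norm (\<integral>x. u x \<bullet> cutoff_grad p (e k) x \<partial>lborel)
        \<le> integral\<^sup>L lborel (v k) + A * e k powr (real DIM('a) - 2)"
      by (intro always_eventually allI)
  qed
qed

section \<open>Ellipticity of P and the energy inequality with cutoff\<close>

context singular_flow
begin

text \<open>\<open>c1\<close> turns H' \<le> (L0 + 1) \<rho> into c1 H' \<le> \<rho>/2.
  \<open>K1\<close> is the product of 1/2 + L0, which bounds |P| by \<rho> |q|, and 2/c0, which
  bounds \<rho> by H'.\<close>

definition "c1 = 1 / (2 * (L0 + 1))"
definition "K1 = (1 + 2 * L0) / c0"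

lemma c1: "c1 > 0" "c1 \<le> 1" and K1: "K1 > 0"
  using L0 c0 by (auto simp: c1_def K1_def field_simps)

text \<open>\<open>Dh\<close> is a positive multiple of q, so only P \<bullet> q matters. Where
  \<rho>' < 0, Cauchy-Schwarz bounds the negative term and leaves the factor \<rho>/2 + Q \<rho>' =
  H' itself; where \<rho>' \<ge> 0, that term is dropped and \<rho>/2 is compared with H'.\<close>

lemma P_coercive: "P x \<bullet> Dh x \<ge> c1 * (norm (Dh x))\<^sup>2"
proof -
  define y where "y = \<rho> (Q x) / 2 + Q x * \<rho>' (Q x)"
  have y: "y > 0" unfolding y_def by (rule H'_pos[OF Q_nonneg])
  have Dh: "Dh x = y *\<^sub>R q x" by (simp add: Dh_def y_def)
  have cs: "(w x \<bullet> q x)\<^sup>2 \<le> Q x * (q x \<bullet> q x)"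
    unfolding Q_def by (rule Cauchy_Schwarz_ineq)
  have "c1 * y * (q x \<bullet> q x) \<le> r x / 2 * (q x \<bullet> q x) + r' x * (w x \<bullet> q x)\<^sup>2"
  proof (cases "r' x < 0")
    case True
    have "r' x * (Q x * (q x \<bullet> q x)) \<le> r' x * (w x \<bullet> q x)\<^sup>2"
      using True cs by (intro mult_left_mono_neg) auto
    moreover have "c1 * (y * (q x \<bullet> q x)) \<le> 1 * (y * (q x \<bullet> q x))"
      using c1 y by (intro mult_right_mono) auto
    ultimately show ?thesis by (simp add: y_def r_def r'_def algebra_simps)
  next
    case False
    have "c1 * y \<le> r x / 2"
      using H'_upper[OF Q_nonneg[of x]] L0 by (simp add: c1_def y_def r_def field_simps)
    then have "c1 * y * (q x \<bullet> q x) \<le> r x / 2 * (q x \<bullet> q x)" by (intro mult_right_mono) auto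
    moreover have "0 \<le> r' x * (w x \<bullet> q x)\<^sup>2" using False by simp
    ultimately show ?thesis by linarith
  qed
  from mult_left_mono[OF this less_imp_le[OF y]] show ?thesis
    unfolding Dh P_def norm_scaleR power_mult_distrib power2_norm_eq_inner
    by (simp add: inner_add_left power2_eq_square algebra_simps)
qed

lemma norm_P: "norm (P x) \<le> K1 * norm (Dh x)"
proof -
  define y where "y = \<rho> (Q x) / 2 + Q x * \<rho>' (Q x)"
  have y: "y > 0" unfolding y_def by (rule H'_pos[OF Q_nonneg])
  have r: "r x > 0" unfolding r_def by (rule rho_pos[OF Q_nonneg])
  have Dh: "norm (Dh x) = y * norm (q x)" using y by (simp add: Dh_def y_def)
  have "norm (P x) \<le> r x / 2 * norm (q x) + \<bar>r' x\<bar> * \<bar>w x \<bullet> q x\<bar> * norm (w x)"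
    unfolding P_def using norm_triangle_ineq[of "(r x / 2) *\<^sub>R q x" "(r' x * (w x \<bullet> q x)) *\<^sub>R w x"] r by (simp add: abs_mult)
  also have "\<bar>r' x\<bar> * \<bar>w x \<bullet> q x\<bar> * norm (w x) \<le> \<bar>r' x\<bar> * (norm (w x) * norm (q x)) * norm (w x)"
    by (intro mult_right_mono mult_left_mono Cauchy_Schwarz_ineq2) auto
  also have "\<dots> = \<bar>r' x\<bar> * Q x * norm (q x)"
    by (simp add: Q_def dot_square_norm power2_eq_square)
  also have "\<bar>r' x\<bar> * Q x * norm (q x) \<le> L0 * r x * norm (q x)"
    using rho'_bound[OF Q_nonneg[of x]] by (intro mult_right_mono) (auto simp: r_def r'_def)
  finally have "norm (P x) \<le> (1 / 2 + L0) * (r x * norm (q x))" by (simp add: algebra_simps)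
  also have "\<dots> \<le> (1 / 2 + L0) * (2 * y / c0 * norm (q x))"
  proof -
    have "r x \<le> 2 * y / c0"
      using H'_lower[OF Q_nonneg[of x]] c0 by (simp add: y_def r_def field_simps)
    then show ?thesis using L0 by (intro mult_left_mono mult_right_mono) auto
  qed
  finally show ?thesis unfolding Dh K1_def by (simp add: algebra_simps)
qed

text \<open>As \<kappa> is supported in a shell, \<kappa>^2 h is an admissible test function
  although h is singular at p. Half of the coercivity constant pays for the cross term 2 h \<kappa>
  (P \<bullet> \<kappa>g); completing the square costs 2 K1^2 / c1.\<close>

lemma caccioppoli:
  assumes \<kappa>: "C1_grad UNIV \<kappa> \<kappa>g" and 0: "\<And>x. x \<notin> shell p s t \<Longrightarrow> \<kappa> x = 0"
    and s: "0 < s" "0 < t" and sub: "cball p (3 * t) \<subseteq> \<Omega>"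
  shows "integrable lborel (\<lambda>x. (\<kappa> x)\<^sup>2 * (norm (Dh x))\<^sup>2)"
    "integrable lborel (\<lambda>x. pot x * (h x)\<^sup>2 * (\<kappa> x)\<^sup>2)"
    "integrable lborel (\<lambda>x. (norm (\<kappa>g x))\<^sup>2 * (h x)\<^sup>2)"
    "c1 / 2 * (\<integral>x. (\<kappa> x)\<^sup>2 * (norm (Dh x))\<^sup>2 \<partial>lborel)
      \<le> Ksub * (\<integral>x. pot x * (h x)\<^sup>2 * (\<kappa> x)\<^sup>2 \<partial>lborel)
        + 2 * K1\<^sup>2 / c1 * (\<integral>x. (norm (\<kappa>g x))\<^sup>2 * (h x)\<^sup>2 \<partial>lborel)"
proof -
  define K where "K = shell p s t"
  have K: "compact K" "closed K" "K \<subseteq> U"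
    using s sub subset_trans[OF _ sub, of "cball p t"] cball_subset_cball_iff[of p t p "3 * t"]
      shell_subset_U[of s t] by (simp_all add: K_def compact_shell compact_imp_closed)
  have \<kappa>0: "\<kappa> x = 0" if "x \<notin> K" for x using that 0 by (auto simp: K_def)
  have \<kappa>g0: "\<kappa>g x = 0" if "x \<notin> K" for x
    by (rule C1_grad_zero_outside[OF \<kappa> K(2) _ that]) (rule \<kappa>0)
  note cont = cont_U cont_P cont_pot continuous_on_subset[OF C1_grad_cont[OF \<kappa>] subset_UNIV]
    continuous_on_subset[OF C1_grad_cont_grad[OF \<kappa>] subset_UNIV]
  have int: "integrable lborel g" if "continuous_on U g" "\<And>x. x \<notin> K \<Longrightarrow> g x = 0" for g :: "real^'n \<Rightarrow> real"
    by (rule integrable_compact_support[OF continuous_on_zero_extend[OF that(1) open_U K(2,3) that(2)] K(1) that(2)])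
  show i1: "integrable lborel (\<lambda>x. (\<kappa> x)\<^sup>2 * (norm (Dh x))\<^sup>2)"
    by (rule int) (use cont \<kappa>0 in \<open>auto intro!: continuous_intros\<close>)
  show i2: "integrable lborel (\<lambda>x. pot x * (h x)\<^sup>2 * (\<kappa> x)\<^sup>2)"
    by (rule int) (use cont \<kappa>0 in \<open>auto intro!: continuous_intros\<close>)
  show i3: "integrable lborel (\<lambda>x. (norm (\<kappa>g x))\<^sup>2 * (h x)\<^sup>2)"
    by (rule int) (use cont \<kappa>g0 in \<open>auto intro!: continuous_intros\<close>)
  define z where "z x = (\<kappa> x * \<kappa> x) *\<^sub>R Dh x + h x *\<^sub>R (\<kappa> x *\<^sub>R \<kappa>g x + \<kappa> x *\<^sub>R \<kappa>g x)" for x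
  have z: "C1_grad UNIV (\<lambda>x. \<kappa> x * \<kappa> x * h x) z"
    unfolding z_def[abs_def]
    by (rule C1_grad_mult_extend[OF C1_h C1_grad_mult[OF \<kappa> \<kappa>] open_U K(2,3)]) (simp add: \<kappa>0)
  have W: "integrable lborel (\<lambda>x. P x \<bullet> z x)"
    "(\<integral>x. P x \<bullet> z x \<partial>lborel) \<le> Ksub * (\<integral>x. pot x * h x * (\<kappa> x * \<kappa> x * h x) \<partial>lborel)"
    using weak_subsolution_off_p[OF z _ _ s sub] 0 h_nonneg by auto
  have le: "c1 / 2 * ((\<kappa> x)\<^sup>2 * (norm (Dh x))\<^sup>2) - 2 * K1\<^sup>2 / c1 * ((norm (\<kappa>g x))\<^sup>2 * (h x)\<^sup>2) \<le> P x \<bullet> z x" for x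
  proof -
    define A where "A = \<bar>\<kappa> x\<bar> * norm (Dh x)"
    define D where "D = h x * norm (\<kappa>g x)"
    have "\<bar>P x \<bullet> \<kappa>g x\<bar> \<le> K1 * norm (Dh x) * norm (\<kappa>g x)"
      by (rule order_trans[OF Cauchy_Schwarz_ineq2]) (intro mult_right_mono norm_P norm_ge_zero)
    then have "\<bar>2 * h x * \<kappa> x * (P x \<bullet> \<kappa>g x)\<bar> \<le> 2 * h x * \<bar>\<kappa> x\<bar> * (K1 * norm (Dh x) * norm (\<kappa>g x))"
      unfolding abs_mult using h_nonneg[of x] by (intro mult_mono) auto
    also have "\<dots> = 2 * K1 * A * D" by (simp add: A_def D_def)
    finally have 1: "\<bar>2 * h x * \<kappa> x * (P x \<bullet> \<kappa>g x)\<bar> \<le> 2 * K1 * A * D" .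
    have 2: "(\<kappa> x)\<^sup>2 * (P x \<bullet> Dh x) \<ge> c1 * A\<^sup>2"
      using mult_left_mono[OF P_coercive[of x], of "(\<kappa> x)\<^sup>2"] by (simp add: A_def power_mult_distrib mult_ac)
    have 3: "c1 * A\<^sup>2 - 2 * K1 * A * D - (c1 / 2 * A\<^sup>2 - 2 * K1\<^sup>2 / c1 * D\<^sup>2) = c1 / 2 * (A - 2 * K1 * D / c1)\<^sup>2"
      using c1 by (simp add: power2_eq_square field_simps)
    have 4: "0 \<le> c1 / 2 * (A - 2 * K1 * D / c1)\<^sup>2" using c1 by simp
    have "P x \<bullet> z x = (\<kappa> x)\<^sup>2 * (P x \<bullet> Dh x) + 2 * h x * \<kappa> x * (P x \<bullet> \<kappa>g x)"
      unfolding z_def inner_add_right inner_scaleR_right by (simp add: power2_eq_square algebra_simps)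
    then have "P x \<bullet> z x \<ge> c1 / 2 * A\<^sup>2 - 2 * K1\<^sup>2 / c1 * D\<^sup>2" using 1 2 3 4 by linarith
    then show ?thesis by (simp add: A_def D_def power_mult_distrib mult_ac)
  qed
  have "c1 / 2 * (\<integral>x. (\<kappa> x)\<^sup>2 * (norm (Dh x))\<^sup>2 \<partial>lborel) - 2 * K1\<^sup>2 / c1 * (\<integral>x. (norm (\<kappa>g x))\<^sup>2 * (h x)\<^sup>2 \<partial>lborel)
      = (\<integral>x. c1 / 2 * ((\<kappa> x)\<^sup>2 * (norm (Dh x))\<^sup>2) - 2 * K1\<^sup>2 / c1 * ((norm (\<kappa>g x))\<^sup>2 * (h x)\<^sup>2) \<partial>lborel)"
    using i1 i3 by simp
  also have "\<dots> \<le> (\<integral>x. P x \<bullet> z x \<partial>lborel)"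
    by (rule integral_mono[OF _ W(1) le]) (use i1 i3 in auto)
  also have "\<dots> \<le> Ksub * (\<integral>x. pot x * (h x)\<^sup>2 * (\<kappa> x)\<^sup>2 \<partial>lborel)"
    using W(2) by (simp add: power2_eq_square mult_ac)
  finally show "c1 / 2 * (\<integral>x. (\<kappa> x)\<^sup>2 * (norm (Dh x))\<^sup>2 \<partial>lborel)
      \<le> Ksub * (\<integral>x. pot x * (h x)\<^sup>2 * (\<kappa> x)\<^sup>2 \<partial>lborel)
        + 2 * K1\<^sup>2 / c1 * (\<integral>x. (norm (\<kappa>g x))\<^sup>2 * (h x)\<^sup>2 \<partial>lborel)" by simp
qed

end

section \<open>Removing the singularity\<close>

text \<open>R / (k + 2): the shift by 2 keeps the radius strictly below R already for k = 0.\<close>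

definition radius :: "real \<Rightarrow> nat \<Rightarrow> real" where
  "radius R k = R * inverse (real (Suc (Suc k)))"

lemma radius_tendsto_0: "radius R \<longlonglongrightarrow> 0"
  using tendsto_mult[OF tendsto_const[of R] LIMSEQ_Suc[OF LIMSEQ_inverse_real_of_nat]]
  by (simp add: radius_def[abs_def])

lemma radius_pos: "0 < R \<Longrightarrow> 0 < radius R k"
  unfolding radius_def by (intro mult_pos_pos) auto

lemma radius_less: "0 < R \<Longrightarrow> radius R k < R"
  unfolding radius_def using mult_strict_left_mono[of "inverse (real (Suc (Suc k)))" 1 R]
  by (simp add: inverse_eq_divide)

lemma ball_measurable [measurable]: "ball (c::'a::euclidean_space) R \<in> sets borel"
  by simp

lemma integrable_real_bound:
  fixes g :: "'a \<Rightarrow> real" and f :: "'a \<Rightarrow> 'b::{banach, second_countable_topology}"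
  assumes "integrable M g" "f \<in> borel_measurable M" "\<And>x. norm (f x) \<le> g x"
  shows "integrable M f"
  by (rule Bochner_Integration.integrable_bound[OF assms(1,2)])
    (use assms(3) order_trans[OF _ abs_ge_self] in \<open>auto intro!: AE_I2\<close>)

context singular_flow
begin

lemma N_gt_2: "real CARD('n) > 2"
  using dim by simp

lemma h_sq_le: "(h x)\<^sup>2 \<le> 1 + h x powr (2 * real CARD('n) / (real CARD('n) - 2))"
  using young_critical'[of "real CARD('n)" 1 "h x"] N_gt_2 h_nonneg by simp

lemma pot_le: "pot x \<le> pot x powr (real CARD('n) / 2) + 1"
  using young_critical[of "real CARD('n)" "pot x" 1] N_gt_2 pot_nonneg by simp

lemma pot_h_sq_le: "pot x * (h x)\<^sup>2 \<le> pot x powr (real CARD('n) / 2) + h x powr (2 * real CARD('n) / (real CARD('n) - 2))"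
  by (rule young_critical[OF N_gt_2 pot_nonneg h_nonneg])

text \<open>\<open>pot\<close> is Borel, being the zero extension of a continuous function, so its
  integrability descends from the completed measure to \<open>lborel\<close>.\<close>

lemma integrable_pot: "integrable lborel (\<lambda>x. pot x powr (real CARD('n) / 2))"
proof -
  have "integrable lebesgue (\<lambda>x. pot x powr (real CARD('n) / 2))"
  proof (rule Bochner_Integration.integrable_bound[OF F_integrable])
    show "(\<lambda>x. pot x powr (real CARD('n) / 2)) \<in> borel_measurable lebesgue"
      by (rule measurable_completion) measurable
    show "AE x in lebesgue. norm (pot x powr (real CARD('n) / 2)) \<le> norm (F x powr (real CARD('n) / 2))"
      using F_ge pot_nonneg by (intro AE_I2) (auto simp: pot_def[symmetric] intro!: powr_mono2)
  qed
  then show ?thesis by (subst (asm) integrable_completion) auto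
qed

lemma integrable_h: "integrable lborel (\<lambda>x. h x powr (2 * real CARD('n) / (real CARD('n) - 2)))"
proof -
  have "integrable lebesgue (\<lambda>x. h x powr (2 * real CARD('n) / (real CARD('n) - 2)))"
    using H_integrable h_nonneg by (simp add: h_def Q_def)
  then show ?thesis by (subst (asm) integrable_completion) auto
qed

lemma integrable_indicator_ball: "integrable lborel (\<lambda>x. indicator (ball (c::'a::euclidean_space) R) x :: real)"
  by (rule Bochner_Integration.integrable_bound[OF integrable_indicator_cball[of c R]])
    (auto simp: indicator_def)

text \<open>The point is that A does not depend on the inner radius e. After Young's inequality the
  cutoff enters only through the integral of the n-th power of its gradient, and for s = n the power
  of \<epsilon> in \<open>integral_cutoff_grad_powr\<close> is 0.\<close>

lemma gradient_energy_bound: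
  assumes R: "0 < R" and sub: "cball p (5 * R) \<subseteq> \<Omega>"
  obtains A where
    "\<And>e. 0 < e \<Longrightarrow> e < R \<Longrightarrow> integrable lborel (\<lambda>x. (shell_cutoff p e R x)\<^sup>2 * (norm (Dh x))\<^sup>2)"
    "\<And>e. 0 < e \<Longrightarrow> e < R \<Longrightarrow> (\<integral>x. (shell_cutoff p e R x)\<^sup>2 * (norm (Dh x))\<^sup>2 \<partial>lborel) \<le> A"
proof -
  define A1 where "A1 = (\<integral>x. pot x powr (real CARD('n) / 2) \<partial>lborel)"
  define A2 where "A2 = (\<integral>x. h x powr (2 * real CARD('n) / (real CARD('n) - 2)) \<partial>lborel)"
  define V where "V = unit_ball_vol (real CARD('n)) * 12 powr real CARD('n) * 2 ^ CARD('n)"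
  define A where "A = (Ksub * (A1 + A2) + 2 * K1\<^sup>2 / c1 * (2 powr real CARD('n) * (V + V) + A2)) / (c1 / 2)"
  have bound: "integrable lborel (\<lambda>x. (shell_cutoff p e R x)\<^sup>2 * (norm (Dh x))\<^sup>2) \<and>
     (\<integral>x. (shell_cutoff p e R x)\<^sup>2 * (norm (Dh x))\<^sup>2 \<partial>lborel) \<le> A" if e: "0 < e" for e
  proof -
    let ?\<kappa> = "shell_cutoff p e R" and ?\<kappa>g = "shell_cutoff_grad p e R"
    \<comment> \<open>The cutoff reaches out to 3/2 R and \<open>caccioppoli\<close> needs three
      times that radius; 9/2 is rounded up to 5.\<close>
    have sub': "cball p (3 * (3 / 2 * R)) \<subseteq> \<Omega>"
      using sub R subset_trans[OF _ sub, of "cball p (3 * (3 / 2 * R))"]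
        cball_subset_cball_iff[of p "3 * (3 / 2 * R)" p "5 * R"] by simp
    have t: "0 < 3 / 2 * R" using R by simp
    note C = caccioppoli[OF C1_grad_shell_cutoff[of p e R] shell_cutoff_eq_0[OF e R] e t sub']
    have i1: "(\<integral>x. pot x * (h x)\<^sup>2 * (?\<kappa> x)\<^sup>2 \<partial>lborel) \<le> A1 + A2"
    proof -
      have "(\<integral>x. pot x * (h x)\<^sup>2 * (?\<kappa> x)\<^sup>2 \<partial>lborel)
          \<le> (\<integral>x. pot x powr (real CARD('n) / 2) + h x powr (2 * real CARD('n) / (real CARD('n) - 2)) \<partial>lborel)"
      proof (rule integral_mono[OF C(2)])
        show "pot x * (h x)\<^sup>2 * (?\<kappa> x)\<^sup>2 \<le> pot x powr (real CARD('n) / 2) + h x powr (2 * real CARD('n) / (real CARD('n) - 2))" for x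
          using mult_left_le[of "(?\<kappa> x)\<^sup>2" "pot x * (h x)\<^sup>2"] shell_cutoff_bounds[of p e R x] pot_nonneg[of x]
            pot_h_sq_le[of x] power_le_one[of "?\<kappa> x" 2] by simp
      qed (use integrable_pot integrable_h in auto)
      then show ?thesis using integrable_pot integrable_h by (simp add: A1_def A2_def)
    qed
    have gi: "integrable lborel (\<lambda>x. norm (cutoff_grad p s x) powr real CARD('n))"
      "(\<integral>x. norm (cutoff_grad p s x) powr real CARD('n) \<partial>lborel) \<le> V" if "0 < s" for s
      using integral_cutoff_grad_powr[of s "real CARD('n)" p] that N_gt_2 by (auto simp: V_def)
    have i2: "(\<integral>x. (norm (?\<kappa>g x))\<^sup>2 * (h x)\<^sup>2 \<partial>lborel) \<le> 2 powr real CARD('n) * (V + V) + A2"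
    proof -
      have "(\<integral>x. (norm (?\<kappa>g x))\<^sup>2 * (h x)\<^sup>2 \<partial>lborel)
         \<le> (\<integral>x. 2 powr real CARD('n) * (norm (cutoff_grad p e x) powr real CARD('n) + norm (cutoff_grad p R x) powr real CARD('n))
              + h x powr (2 * real CARD('n) / (real CARD('n) - 2)) \<partial>lborel)"
      proof (rule integral_mono[OF C(3)])
        fix x
        have "(norm (?\<kappa>g x))\<^sup>2 * (h x)\<^sup>2 \<le> norm (?\<kappa>g x) powr real CARD('n) + h x powr (2 * real CARD('n) / (real CARD('n) - 2))"
          by (rule young_critical'[OF N_gt_2 norm_ge_zero h_nonneg])
        also have "norm (?\<kappa>g x) powr real CARD('n) \<le> (norm (cutoff_grad p e x) + norm (cutoff_grad p R x)) powr real CARD('n)"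
          by (intro powr_mono2 norm_shell_cutoff_grad) auto
        also have "\<dots> \<le> 2 powr real CARD('n) * (norm (cutoff_grad p e x) powr real CARD('n) + norm (cutoff_grad p R x) powr real CARD('n))"
          by (rule powr_add_le) auto
        finally show "(norm (?\<kappa>g x))\<^sup>2 * (h x)\<^sup>2
            \<le> 2 powr real CARD('n) * (norm (cutoff_grad p e x) powr real CARD('n) + norm (cutoff_grad p R x) powr real CARD('n)) + h x powr (2 * real CARD('n) / (real CARD('n) - 2))"
          by simp
      qed (use gi e R integrable_h in auto)
      also have "\<dots> = 2 powr real CARD('n) * ((\<integral>x. norm (cutoff_grad p e x) powr real CARD('n) \<partial>lborel)
          + (\<integral>x. norm (cutoff_grad p R x) powr real CARD('n) \<partial>lborel)) + A2"
        using gi(1)[OF e] gi(1)[OF R] integrable_h by (simp add: A2_def)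
      also have "\<dots> \<le> 2 powr real CARD('n) * (V + V) + A2"
        using gi(2)[OF e] gi(2)[OF R] by (intro add_mono mult_left_mono) auto
      finally show ?thesis .
    qed
    have "c1 / 2 * (\<integral>x. (?\<kappa> x)\<^sup>2 * (norm (Dh x))\<^sup>2 \<partial>lborel)
        \<le> Ksub * (A1 + A2) + 2 * K1\<^sup>2 / c1 * (2 powr real CARD('n) * (V + V) + A2)"
    proof -
      have "Ksub * (\<integral>x. pot x * (h x)\<^sup>2 * (?\<kappa> x)\<^sup>2 \<partial>lborel) \<le> Ksub * (A1 + A2)"
        using i1 Ksub_pos by (intro mult_left_mono) auto
      moreover have "2 * K1\<^sup>2 / c1 * (\<integral>x. (norm (?\<kappa>g x))\<^sup>2 * (h x)\<^sup>2 \<partial>lborel)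
          \<le> 2 * K1\<^sup>2 / c1 * (2 powr real CARD('n) * (V + V) + A2)"
        using c1 by (intro mult_left_mono[OF i2]) auto
      ultimately show ?thesis using C(4) by linarith
    qed
    then show ?thesis using C(1) c1 by (simp add: A_def field_simps)
  qed
  then show ?thesis using that by blast
qed

text \<open>Fatou's lemma turns the uniform energy bound into integrability: as the inner radius
  shrinks, the shell cutoffs tend to 1 on the ball without p, and at p itself the extended
  \<open>Dh\<close> is 0.\<close>

lemma integrable_gradient_sq:
  assumes R: "0 < R" and sub: "cball p (5 * R) \<subseteq> \<Omega>"
  shows "integrable lborel (\<lambda>x. indicator (ball p R) x * (norm (Dh x))\<^sup>2)"
proof (rule integrableI_bounded)
  obtain A where A:
    "\<And>e. 0 < e \<Longrightarrow> e < R \<Longrightarrow> integrable lborel (\<lambda>x. (shell_cutoff p e R x)\<^sup>2 * (norm (Dh x))\<^sup>2)"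
    "\<And>e. 0 < e \<Longrightarrow> e < R \<Longrightarrow> (\<integral>x. (shell_cutoff p e R x)\<^sup>2 * (norm (Dh x))\<^sup>2 \<partial>lborel) \<le> A"
    using gradient_energy_bound[OF R sub] by blast
  define e where "e = radius R"
  have e: "0 < e k" "e k < R" for k
    using R by (simp_all add: e_def radius_pos radius_less)
  have e0: "e \<longlonglongrightarrow> 0" unfolding e_def by (rule radius_tendsto_0)
  have [measurable]: "shell_cutoff p (e k) R \<in> borel_measurable borel" for k
    by (intro borel_measurable_continuous_onI C1_grad_cont[OF C1_grad_shell_cutoff])
  show "(\<lambda>x. indicator (ball p R) x * (norm (Dh x))\<^sup>2) \<in> borel_measurable lborel" by measurable
  have "(\<integral>\<^sup>+ x. ennreal (norm (indicator (ball p R) x * (norm (Dh x))\<^sup>2)) \<partial>lborel)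
      \<le> (\<integral>\<^sup>+ x. liminf (\<lambda>k. ennreal ((shell_cutoff p (e k) R x)\<^sup>2 * (norm (Dh x))\<^sup>2)) \<partial>lborel)"
  proof (rule nn_integral_mono)
    fix x
    show "ennreal (norm (indicator (ball p R) x * (norm (Dh x))\<^sup>2))
        \<le> liminf (\<lambda>k. ennreal ((shell_cutoff p (e k) R x)\<^sup>2 * (norm (Dh x))\<^sup>2))"
    proof (cases "x \<in> ball p R \<and> x \<noteq> p")
      case True
      have 1: "(\<lambda>k. cutoff p (e k) x) \<longlonglongrightarrow> 1" by (rule cutoff_tendsto_1[OF e0 e(1)]) (use True in auto)
      have "cutoff p R x = 0" using True R by (intro cutoff_eq_0) auto
      then have "(\<lambda>k. (shell_cutoff p (e k) R x)\<^sup>2 * (norm (Dh x))\<^sup>2) \<longlonglongrightarrow> (1 * (1 - 0))\<^sup>2 * (norm (Dh x))\<^sup>2"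
        unfolding shell_cutoff_def by (intro tendsto_intros 1) simp
      then have "(\<lambda>k. ennreal ((shell_cutoff p (e k) R x)\<^sup>2 * (norm (Dh x))\<^sup>2)) \<longlonglongrightarrow> ennreal ((norm (Dh x))\<^sup>2)"
        by (intro tendsto_ennrealI) simp
      from lim_imp_Liminf[OF _ this] show ?thesis using True by simp
    next
      case False
      then show ?thesis using zero_off_U(8)[of p] by (auto simp: U_def)
    qed
  qed
  also have "\<dots> \<le> liminf (\<lambda>k. \<integral>\<^sup>+ x. ennreal ((shell_cutoff p (e k) R x)\<^sup>2 * (norm (Dh x))\<^sup>2) \<partial>lborel)"
    by (rule nn_integral_liminf) measurable
  also have "\<dots> \<le> ennreal A"
  proof -
    have "(\<integral>\<^sup>+ x. ennreal ((shell_cutoff p (e k) R x)\<^sup>2 * (norm (Dh x))\<^sup>2) \<partial>lborel) \<le> ennreal A" for k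
      using A[OF e] by (subst nn_integral_eq_integral) (auto intro!: ennreal_leI)
    then have "liminf (\<lambda>k. \<integral>\<^sup>+ x. ennreal ((shell_cutoff p (e k) R x)\<^sup>2 * (norm (Dh x))\<^sup>2) \<partial>lborel) \<le> liminf (\<lambda>k::nat. ennreal A)"
      by (intro Liminf_mono always_eventually allI)
    then show ?thesis by (simp add: Liminf_const)
  qed
  also have "\<dots> < \<infinity>" by simp
  finally show "(\<integral>\<^sup>+ x. ennreal (norm (indicator (ball p R) x * (norm (Dh x))\<^sup>2)) \<partial>lborel) < \<infinity>" .
qed

context
  fixes R :: real
  assumes R: "0 < R" and sub: "cball p (5 * R) \<subseteq> \<Omega>"
begin

lemma integrable_h_sq: "integrable lborel (\<lambda>x. indicator (ball p R) x * (h x)\<^sup>2)"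
proof (rule Bochner_Integration.integrable_bound)
  show "integrable lborel (\<lambda>x. indicator (ball p R) x + h x powr (2 * real CARD('n) / (real CARD('n) - 2)))"
    by (intro Bochner_Integration.integrable_add integrable_indicator_ball integrable_h)
  show "AE x in lborel. norm (indicator (ball p R) x * (h x)\<^sup>2) \<le> norm (indicator (ball p R) x + h x powr (2 * real CARD('n) / (real CARD('n) - 2)))"
    using h_sq_le by (intro AE_I2) (auto simp: indicator_def)
qed measurable

lemma integrable_P_sq: "integrable lborel (\<lambda>x. indicator (ball p R) x * (norm (P x))\<^sup>2)"
proof (rule Bochner_Integration.integrable_bound)
  show "integrable lborel (\<lambda>x. K1\<^sup>2 * (indicator (ball p R) x * (norm (Dh x))\<^sup>2))"
    by (intro integrable_mult_right integrable_gradient_sq R sub)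
  have "(norm (P x))\<^sup>2 \<le> K1\<^sup>2 * (norm (Dh x))\<^sup>2" for x
    using power_mono[OF norm_P[of x] norm_ge_zero, of 2] by (simp add: power_mult_distrib)
  then show "AE x in lborel. norm (indicator (ball p R) x * (norm (P x))\<^sup>2) \<le> norm (K1\<^sup>2 * (indicator (ball p R) x * (norm (Dh x))\<^sup>2))"
    by (intro AE_I2) (auto simp: indicator_def)
qed measurable

lemma integrable_sq_mult_bounded:
  fixes u v :: "real^'n \<Rightarrow> 'b::euclidean_space"
  assumes [measurable]: "u \<in> borel_measurable borel" "v \<in> borel_measurable borel"
    and u: "integrable lborel (\<lambda>x. indicator (ball p R) x * (norm (u x))\<^sup>2)"
    and v: "\<And>x. norm (v x) \<le> L" "\<And>x. x \<notin> ball p R \<Longrightarrow> v x = 0"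
  shows "integrable lborel (\<lambda>x. u x \<bullet> v x)" "integrable lborel (\<lambda>x. (norm (u x) * norm (v x))\<^sup>2)"
proof -
  have L: "L \<ge> 0" using v(1)[of p] norm_ge_zero order_trans by blast
  show "integrable lborel (\<lambda>x. u x \<bullet> v x)"
  proof (rule Bochner_Integration.integrable_bound)
    show "integrable lborel (\<lambda>x. L * (indicator (ball p R) x + indicator (ball p R) x * (norm (u x))\<^sup>2))"
      by (intro integrable_mult_right Bochner_Integration.integrable_add integrable_indicator_ball u)
    have "norm (u x \<bullet> v x) \<le> L * (indicator (ball p R) x + indicator (ball p R) x * (norm (u x))\<^sup>2)" for x
    proof (cases "x \<in> ball p R")
      case True
      have "norm (u x \<bullet> v x) \<le> norm (u x) * norm (v x)" unfolding real_norm_def by (rule Cauchy_Schwarz_ineq2)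
      also have "\<dots> \<le> (1 + (norm (u x))\<^sup>2) * L"
      proof (intro mult_mono v(1))
        have "0 \<le> (norm (u x) - 1/2)\<^sup>2" by simp
        then show "norm (u x) \<le> 1 + (norm (u x))\<^sup>2" by (simp add: power2_eq_square algebra_simps)
      qed auto
      finally show ?thesis using True by (simp add: algebra_simps)
    qed (simp add: v(2))
    then show "AE x in lborel. norm (u x \<bullet> v x) \<le> norm (L * (indicator (ball p R) x + indicator (ball p R) x * (norm (u x))\<^sup>2))"
      by (intro AE_I2) (metis abs_ge_self order_trans real_norm_def)
  qed measurable
  show "integrable lborel (\<lambda>x. (norm (u x) * norm (v x))\<^sup>2)"
  proof (rule Bochner_Integration.integrable_bound)
    show "integrable lborel (\<lambda>x. L\<^sup>2 * (indicator (ball p R) x * (norm (u x))\<^sup>2))"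
      using u by auto
    have "(norm (u x) * norm (v x))\<^sup>2 \<le> L\<^sup>2 * (indicator (ball p R) x * (norm (u x))\<^sup>2)" for x
    proof (cases "x \<in> ball p R")
      case True
      have "(norm (u x))\<^sup>2 * (norm (v x))\<^sup>2 \<le> (norm (u x))\<^sup>2 * L\<^sup>2"
        using v(1)[of x] by (intro mult_left_mono power_mono) auto
      then show ?thesis using True by (simp add: power_mult_distrib mult.commute)
    qed (simp add: v(2))
    then show "AE x in lborel. norm ((norm (u x) * norm (v x))\<^sup>2) \<le> norm (L\<^sup>2 * (indicator (ball p R) x * (norm (u x))\<^sup>2))"
      by (intro AE_I2) (metis abs_ge_self abs_of_nonneg order_trans real_norm_def zero_le_power2)
  qed measurable
qed

lemma integrable_pot_h: "integrable lborel (\<lambda>x. indicator (ball p R) x * (pot x * h x))"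
proof (rule Bochner_Integration.integrable_bound)
  \<comment> \<open>With h \<le> 1 + h^2, the power of \<open>pot\<close> arises twice, once from
    \<open>pot\<close> and once from pot h^2; this is the factor 2.\<close>
  show "integrable lborel (\<lambda>x. 2 * pot x powr (real CARD('n) / 2) + h x powr (2 * real CARD('n) / (real CARD('n) - 2)) + indicator (ball p R) x)"
    by (intro integrable_mult_right Bochner_Integration.integrable_add integrable_indicator_ball integrable_h integrable_pot)
  have "pot x * h x \<le> 2 * pot x powr (real CARD('n) / 2) + h x powr (2 * real CARD('n) / (real CARD('n) - 2)) + 1" for x
  proof -
    have "0 \<le> (h x - 1/2)\<^sup>2" by simp
    then have "h x \<le> 1 + (h x)\<^sup>2" by (simp add: power2_eq_square algebra_simps)
    then have "pot x * h x \<le> pot x * (1 + (h x)\<^sup>2)" using pot_nonneg by (intro mult_left_mono) auto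
    then show ?thesis using pot_le[of x] pot_h_sq_le[of x] by (simp add: distrib_left)
  qed
  then show "AE x in lborel. norm (indicator (ball p R) x * (pot x * h x))
      \<le> norm (2 * pot x powr (real CARD('n) / 2) + h x powr (2 * real CARD('n) / (real CARD('n) - 2)) + indicator (ball p R) x)"
    using pot_nonneg h_nonneg by (intro AE_I2) (auto simp: indicator_def)
qed measurable

section \<open>Test functions whose support may contain p\<close>

context
  fixes \<phi> :: "real^'n \<Rightarrow> real" and \<phi>g :: "real^'n \<Rightarrow> real^'n" and K :: "(real^'n) set"
  assumes \<phi>: "C1_grad UNIV \<phi> \<phi>g" and K: "compact K" "K \<subseteq> ball p R" and \<phi>0: "\<And>x. x \<notin> K \<Longrightarrow> \<phi> x = 0"
begin

lemma test_measurable [measurable]: "\<phi> \<in> borel_measurable borel" "\<phi>g \<in> borel_measurable borel"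
  using C1_grad_cont[OF \<phi>] C1_grad_cont_grad[OF \<phi>] by (auto intro: borel_measurable_continuous_onI)

lemma test_grad_0: "x \<notin> ball p R \<Longrightarrow> \<phi> x = 0" "x \<notin> ball p R \<Longrightarrow> \<phi>g x = 0"
  using C1_grad_zero_outside[OF \<phi> compact_imp_closed[OF K(1)] \<phi>0] \<phi>0 K(2) by blast+

lemma test_bounded: obtains L where "\<And>x. \<bar>\<phi> x\<bar> \<le> L" "\<And>x. norm (\<phi>g x) \<le> L"
proof -
  obtain L1 where L1: "\<And>x. norm (\<phi>g x) \<le> L1" using C1_grad_bounded[OF \<phi> K(1) \<phi>0] by blast
  have "compact (\<phi> ` K)"
    using K(1) C1_grad_cont[OF \<phi>] continuous_on_subset compact_continuous_image by (metis top_greatest)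
  then obtain L2 where L2: "\<forall>y\<in>\<phi> ` K. norm y \<le> L2" using compact_imp_bounded bounded_iff by metis
  have "\<bar>\<phi> x\<bar> \<le> max L1 L2" for x
    using L2 \<phi>0[of x] order_trans[OF norm_ge_zero L1[of x]] by (cases "x \<in> K") (auto simp: le_max_iff_disj)
  moreover have "norm (\<phi>g x) \<le> max L1 L2" for x using L1 by (simp add: le_max_iff_disj)
  ultimately show ?thesis using that by blast
qed

lemma test_integrable:
  "integrable lborel (\<lambda>x. h x * (\<phi>g x \<bullet> v))" "integrable lborel (\<lambda>x. \<phi> x * (Dh x \<bullet> v))"
  "integrable lborel (\<lambda>x. P x \<bullet> \<phi>g x)" "integrable lborel (\<lambda>x. pot x * h x * \<phi> x)"
  "integrable lborel (\<lambda>x. (norm ((h x * \<phi> x) *\<^sub>R v))\<^sup>2)" "integrable lborel (\<lambda>x. (norm (\<phi> x *\<^sub>R P x))\<^sup>2)"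
proof -
  obtain L where L: "\<And>x. \<bar>\<phi> x\<bar> \<le> L" "\<And>x. norm (\<phi>g x) \<le> L" using test_bounded by blast
  have L0: "L \<ge> 0" using L(1) abs_ge_zero order_trans by blast
  have hi: "integrable lborel (\<lambda>x. indicator (ball p R) x * (norm (h x))\<^sup>2)" using integrable_h_sq by simp
  have \<phi>v: "norm (\<phi>g x \<bullet> v) \<le> L * norm v" for x
    by (metis Cauchy_Schwarz_ineq2 L(2) mult_right_mono norm_ge_zero order_trans real_norm_def)
  have \<phi>v': "norm (\<phi> x *\<^sub>R v) \<le> L * norm v" for x using L(1)[of x] by (simp add: mult_right_mono)
  show "integrable lborel (\<lambda>x. h x * (\<phi>g x \<bullet> v))"
    using integrable_sq_mult_bounded(1)[OF _ _ hi \<phi>v] test_grad_0 by simp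
  show "integrable lborel (\<lambda>x. \<phi> x * (Dh x \<bullet> v))"
    using integrable_sq_mult_bounded(1)[OF _ _ integrable_gradient_sq[OF R sub] \<phi>v'] test_grad_0 by simp
  show "integrable lborel (\<lambda>x. P x \<bullet> \<phi>g x)"
    using integrable_sq_mult_bounded(1)[OF _ _ integrable_P_sq L(2)] test_grad_0 by simp
  have "integrable lborel (\<lambda>x. (norm (h x) * norm (\<phi> x * norm v))\<^sup>2)"
    using integrable_sq_mult_bounded(2)[OF _ _ hi, of "\<lambda>x. \<phi> x * norm v" "L * norm v"] \<phi>v' test_grad_0 by (simp add: abs_mult)
  then show "integrable lborel (\<lambda>x. (norm ((h x * \<phi> x) *\<^sub>R v))\<^sup>2)" by (simp add: abs_mult mult_ac)
  \<comment> \<open>\<open>integrable_sq_mult_bounded\<close> takes two vector fields. The scalar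
    \<phi> is turned into one by an arbitrary unit vector, which leaves the norm unchanged.\<close>
  have "norm (\<phi> x *\<^sub>R axis undefined 1 :: real^'n) \<le> L" for x using L(1)[of x] by (simp add: norm_axis_1)
  from integrable_sq_mult_bounded(2)[OF _ _ integrable_P_sq this] test_grad_0
  show "integrable lborel (\<lambda>x. (norm (\<phi> x *\<^sub>R P x))\<^sup>2)" by (simp add: norm_axis_1 mult.commute)
  show "integrable lborel (\<lambda>x. pot x * h x * \<phi> x)"
  proof (rule Bochner_Integration.integrable_bound)
    show "integrable lborel (\<lambda>x. L * (indicator (ball p R) x * (pot x * h x)))"
      using integrable_pot_h by auto
    have "norm (pot x * h x * \<phi> x) \<le> L * (indicator (ball p R) x * (pot x * h x))" for x
    proof (cases "x \<in> ball p R")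
      case True
      have "(pot x * h x) * \<bar>\<phi> x\<bar> \<le> (pot x * h x) * L"
        using L(1)[of x] pot_nonneg h_nonneg by (intro mult_left_mono) auto
      then show ?thesis using True pot_nonneg h_nonneg by (simp add: abs_mult mult_ac)
    qed (simp add: test_grad_0)
    then show "AE x in lborel. norm (pot x * h x * \<phi> x) \<le> norm (L * (indicator (ball p R) x * (pot x * h x)))"
      by (intro AE_I2) (metis abs_ge_self order_trans real_norm_def)
  qed measurable
qed

lemma cut_test:
  "C1_grad UNIV (\<lambda>x. cutoff p (radius R k) x * \<phi> x) (\<lambda>x. cutoff p (radius R k) x *\<^sub>R \<phi>g x + \<phi> x *\<^sub>R cutoff_grad p (radius R k) x)"
  "x \<notin> shell p (radius R k) R \<Longrightarrow> cutoff p (radius R k) x * \<phi> x = 0"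
proof -
  show "C1_grad UNIV (\<lambda>x. cutoff p (radius R k) x * \<phi> x) (\<lambda>x. cutoff p (radius R k) x *\<^sub>R \<phi>g x + \<phi> x *\<^sub>R cutoff_grad p (radius R k) x)"
    by (rule C1_grad_mult[OF C1_grad_cutoff \<phi>])
  show "cutoff p (radius R k) x * \<phi> x = 0" if "x \<notin> shell p (radius R k) R"
    using that test_grad_0(1)[of x] cutoff_eq_0[OF radius_pos[OF R], of p x] by (auto simp: shell_def)
qed

lemma sub_R: "c \<le> 5 \<Longrightarrow> cball p (c * R) \<subseteq> \<Omega>"
  using subset_trans[OF subset_cball sub] mult_right_mono[of c 5 R] R by simp

text \<open>Away from p this is integration by parts for cutoff * \<phi> * h. The cutoff leaves the
  error (h \<phi> v) \<bullet> grad cutoff, which tends to 0 because h \<phi> is square integrable;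
  so p carries no part of the distributional gradient.\<close>

lemma weak_gradient: "(\<integral>x. h x * (\<phi>g x \<bullet> v) \<partial>lborel) = - (\<integral>x. \<phi> x * (Dh x \<bullet> v) \<partial>lborel)"
proof -
  define g where "g x = h x * (\<phi>g x \<bullet> v) + \<phi> x * (Dh x \<bullet> v)" for x
  have g: "integrable lborel g" unfolding g_def[abs_def] using test_integrable(1,2) by auto
  have 1: "(\<lambda>k. \<integral>x. cutoff p (radius R k) x * g x \<partial>lborel) \<longlonglongrightarrow> integral\<^sup>L lborel g"
    by (rule integral_cutoff_tendsto[OF radius_tendsto_0 radius_pos[OF R] g])
  have d: "DIM(real^'n) > 2" using dim by simp
  have m: "(\<lambda>x. (h x * \<phi> x) *\<^sub>R v) \<in> borel_measurable borel" by measurable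
  note V = integral_cutoff_grad_vanishes[OF d radius_tendsto_0 radius_pos[OF R] m test_integrable(5), of p]
  have eq: "(\<integral>x. cutoff p (radius R k) x * g x \<partial>lborel) = - (\<integral>x. ((h x * \<phi> x) *\<^sub>R v) \<bullet> cutoff_grad p (radius R k) x \<partial>lborel)" for k
  proof -
    let ?K = "shell p (radius R k) R"
    have KU: "?K \<subseteq> U" using shell_subset_U[OF radius_pos[OF R] sub_R[of 1]] by simp
    have C: "C1_grad UNIV (\<lambda>x. (cutoff p (radius R k) x * \<phi> x) * h x)
       (\<lambda>x. (cutoff p (radius R k) x * \<phi> x) *\<^sub>R Dh x + h x *\<^sub>R (cutoff p (radius R k) x *\<^sub>R \<phi>g x + \<phi> x *\<^sub>R cutoff_grad p (radius R k) x))"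
      by (rule C1_grad_mult_extend[OF C1_h cut_test(1) open_U compact_imp_closed[OF compact_shell] KU cut_test(2)])
    have "(\<integral>x. ((cutoff p (radius R k) x * \<phi> x) *\<^sub>R Dh x + h x *\<^sub>R (cutoff p (radius R k) x *\<^sub>R \<phi>g x + \<phi> x *\<^sub>R cutoff_grad p (radius R k) x)) \<bullet> v \<partial>lborel) = 0"
      by (rule integral_gradient_eq_0[OF C compact_shell[of p "radius R k" R]]) (subst cut_test(2), assumption, simp)
    moreover have "((cutoff p (radius R k) x * \<phi> x) *\<^sub>R Dh x + h x *\<^sub>R (cutoff p (radius R k) x *\<^sub>R \<phi>g x + \<phi> x *\<^sub>R cutoff_grad p (radius R k) x)) \<bullet> v
        = cutoff p (radius R k) x * g x + ((h x * \<phi> x) *\<^sub>R v) \<bullet> cutoff_grad p (radius R k) x" for x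
      unfolding g_def inner_add_left inner_add_right inner_scaleR_left inner_scaleR_right
      by (simp add: algebra_simps inner_commute)
    ultimately show ?thesis using V(2)[of k] integrable_cutoff_mult[OF g, of p "radius R k"] by simp
  qed
  have "(\<lambda>k. \<integral>x. cutoff p (radius R k) x * g x \<partial>lborel) \<longlonglongrightarrow> - 0"
    unfolding eq by (intro tendsto_minus V(1))
  then have "integral\<^sup>L lborel g = 0" using LIMSEQ_unique[OF 1] by simp
  then show ?thesis unfolding g_def using test_integrable(1,2)[of v] by simp
qed

text \<open>The limit is the one of \<open>weak_gradient\<close>, now with the error \<phi> P
  \<bullet> grad cutoff. It tends to 0 because P is square integrable near p, which is what the
  energy estimate provides.\<close>

lemma weak_subsolution:
  assumes nn: "\<And>x. \<phi> x \<ge> 0"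
  shows "(\<integral>x. P x \<bullet> \<phi>g x \<partial>lborel) \<le> Ksub * (\<integral>x. pot x * h x * \<phi> x \<partial>lborel)"
proof -
  have 1: "(\<lambda>k. \<integral>x. cutoff p (radius R k) x * (P x \<bullet> \<phi>g x) \<partial>lborel) \<longlonglongrightarrow> (\<integral>x. P x \<bullet> \<phi>g x \<partial>lborel)"
    by (rule integral_cutoff_tendsto[OF radius_tendsto_0 radius_pos[OF R] test_integrable(3)])
  have 2: "(\<lambda>k. \<integral>x. cutoff p (radius R k) x * (pot x * h x * \<phi> x) \<partial>lborel) \<longlonglongrightarrow> (\<integral>x. pot x * h x * \<phi> x \<partial>lborel)"
    by (rule integral_cutoff_tendsto[OF radius_tendsto_0 radius_pos[OF R] test_integrable(4)])
  have d: "DIM(real^'n) > 2" using dim by simp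
  have m: "(\<lambda>x. \<phi> x *\<^sub>R P x) \<in> borel_measurable borel" by measurable
  note V = integral_cutoff_grad_vanishes[OF d radius_tendsto_0 radius_pos[OF R] m test_integrable(6), of p]
  have le: "(\<integral>x. cutoff p (radius R k) x * (P x \<bullet> \<phi>g x) \<partial>lborel) + (\<integral>x. (\<phi> x *\<^sub>R P x) \<bullet> cutoff_grad p (radius R k) x \<partial>lborel)
      \<le> Ksub * (\<integral>x. cutoff p (radius R k) x * (pot x * h x * \<phi> x) \<partial>lborel)" for k
  proof -
    have "(\<integral>x. P x \<bullet> (cutoff p (radius R k) x *\<^sub>R \<phi>g x + \<phi> x *\<^sub>R cutoff_grad p (radius R k) x) \<partial>lborel)
        \<le> Ksub * (\<integral>x. pot x * h x * (cutoff p (radius R k) x * \<phi> x) \<partial>lborel)"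
      by (rule weak_subsolution_off_p(3)[OF cut_test(1,2) _ radius_pos[OF R] R sub_R])
        (auto intro!: mult_nonneg_nonneg nn cutoff_bounds)
    moreover have "P x \<bullet> (cutoff p (radius R k) x *\<^sub>R \<phi>g x + \<phi> x *\<^sub>R cutoff_grad p (radius R k) x)
        = cutoff p (radius R k) x * (P x \<bullet> \<phi>g x) + (\<phi> x *\<^sub>R P x) \<bullet> cutoff_grad p (radius R k) x" for x
      by (simp add: inner_add_right)
    ultimately show ?thesis
      using V(2)[of k] integrable_cutoff_mult[OF test_integrable(3), of p "radius R k"] by (simp add: mult_ac)
  qed
  have "(\<integral>x. P x \<bullet> \<phi>g x \<partial>lborel) + 0 \<le> Ksub * (\<integral>x. pot x * h x * \<phi> x \<partial>lborel)"
    by (rule LIMSEQ_le[OF tendsto_add[OF 1 V(1)] tendsto_mult[OF tendsto_const 2]]) (use le in auto)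
  then show ?thesis by simp
qed

text \<open>As h and \<phi> are nonnegative, replacing \<open>pot\<close> by the larger F preserves
  the inequality. F is only Lebesgue measurable, hence the passage to the completed measure.\<close>

lemma weak_subsolution_lebesgue:
  assumes nn: "\<And>x. \<phi> x \<ge> 0"
  shows "integrable lebesgue (\<lambda>x. P x \<bullet> \<phi>g x - Ksub * F x * h x * \<phi> x)"
    "(\<integral>x. P x \<bullet> \<phi>g x - Ksub * F x * h x * \<phi> x \<partial>lebesgue) \<le> 0"
proof -
  obtain L where L: "\<And>x. \<bar>\<phi> x\<bar> \<le> L" "\<And>x. norm (\<phi>g x) \<le> L" using test_bounded by blast
  have L0: "L \<ge> 0" using L(1) abs_ge_zero order_trans by blast
  note [measurable] = F_measurable
  have [measurable]: "h \<in> borel_measurable lebesgue" "\<phi> \<in> borel_measurable lebesgue"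
    by (auto intro!: measurable_completion)
  have F0: "F x \<ge> 0" for x
    by (rule order_trans[OF _ F_ge]) simp
  have F: "integrable lebesgue (\<lambda>x. F x * h x * \<phi> x)"
  proof (rule integrable_real_bound)
    show "integrable lebesgue (\<lambda>x. L * (2 * F x powr (real CARD('n) / 2) + h x powr (2 * real CARD('n) / (real CARD('n) - 2)) + indicator (ball p R) x))"
      using integrable_h integrable_indicator_ball[of p R]
      by (intro integrable_mult_right Bochner_Integration.integrable_add F_integrable) (simp_all add: integrable_completion)
    show "norm (F x * h x * \<phi> x) \<le> L * (2 * F x powr (real CARD('n) / 2) + h x powr (2 * real CARD('n) / (real CARD('n) - 2)) + indicator (ball p R) x)" for x
    proof (cases "x \<in> ball p R")
      case True
      have "0 \<le> (h x - 1/2)\<^sup>2" by simp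
      then have "h x \<le> 1 + (h x)\<^sup>2" by (simp add: power2_eq_square algebra_simps)
      then have "F x * h x \<le> F x * (1 + (h x)\<^sup>2)" using F0 by (intro mult_left_mono) auto
      then have 1: "F x * h x \<le> 2 * F x powr (real CARD('n) / 2) + h x powr (2 * real CARD('n) / (real CARD('n) - 2)) + 1"
        using young_critical[OF N_gt_2 F0, of 1 x] young_critical[OF N_gt_2 F0 h_nonneg, of x x]
        by (simp add: distrib_left)
      have "F x * h x * \<bar>\<phi> x\<bar> \<le> (2 * F x powr (real CARD('n) / 2) + h x powr (2 * real CARD('n) / (real CARD('n) - 2)) + 1) * L"
        using F0 h_nonneg by (intro mult_mono[OF 1 L(1)]) auto
      then show ?thesis using True F0 h_nonneg by (simp add: abs_mult mult.commute)
    next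
      case False
      then show ?thesis using L0 by (simp add: test_grad_0)
    qed
    show "(\<lambda>x. F x * h x * \<phi> x) \<in> borel_measurable lebesgue" by measurable
  qed
  have P: "integrable lebesgue (\<lambda>x. P x \<bullet> \<phi>g x)" "(\<integral>x. P x \<bullet> \<phi>g x \<partial>lebesgue) = (\<integral>x. P x \<bullet> \<phi>g x \<partial>lborel)"
    using test_integrable(3) by (simp_all add: integrable_completion integral_completion)
  have G: "integrable lebesgue (\<lambda>x. pot x * h x * \<phi> x)" "(\<integral>x. pot x * h x * \<phi> x \<partial>lebesgue) = (\<integral>x. pot x * h x * \<phi> x \<partial>lborel)"
    using test_integrable(4) by (simp_all add: integrable_completion integral_completion)
  have eq: "(\<lambda>x. P x \<bullet> \<phi>g x - Ksub * F x * h x * \<phi> x) = (\<lambda>x. P x \<bullet> \<phi>g x - Ksub * (F x * h x * \<phi> x))"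
    by (simp add: mult.assoc)
  show "integrable lebesgue (\<lambda>x. P x \<bullet> \<phi>g x - Ksub * F x * h x * \<phi> x)"
    unfolding eq by (intro Bochner_Integration.integrable_diff integrable_mult_right P F)
  have "(\<integral>x. pot x * h x * \<phi> x \<partial>lebesgue) \<le> (\<integral>x. F x * h x * \<phi> x \<partial>lebesgue)"
    using F_ge h_nonneg nn by (intro integral_mono G F mult_right_mono) (auto simp: pot_def)
  then have "Ksub * (\<integral>x. pot x * h x * \<phi> x \<partial>lebesgue) \<le> Ksub * (\<integral>x. F x * h x * \<phi> x \<partial>lebesgue)"
    using Ksub_pos by (intro mult_left_mono) auto
  then show "(\<integral>x. P x \<bullet> \<phi>g x - Ksub * F x * h x * \<phi> x \<partial>lebesgue) \<le> 0"
    unfolding eq using weak_subsolution[OF nn] P G F by simp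
qed

end

end

end

section \<open>From forms to vector fields\<close>

lemma shuffle_sign_singletons:
  "shuffle_sign {i} {j} = (if j < i then -1 else 1)"
proof -
  have "{(a, b). a \<in> {i} \<and> b \<in> {j} \<and> b < a} = (if j < i then {(i, j)} else {})" by auto
  then show ?thesis by (simp add: shuffle_sign_def)
qed

lemma shuffle_sign_Un_left:
  assumes "A \<inter> B = {}"
  shows "shuffle_sign (A \<union> B) C = shuffle_sign A C * shuffle_sign B C"
proof -
  let ?S = "\<lambda>A. {(i, j). i \<in> A \<and> j \<in> C \<and> j < i}"
  have "card (?S (A \<union> B)) = card (?S A \<union> ?S B)" by (rule arg_cong[of _ _ card]) auto
  also have "\<dots> = card (?S A) + card (?S B)"
    using assms by (intro card_Un_disjoint) (auto intro: finite_subset[OF _ finite])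
  finally show ?thesis by (simp add: shuffle_sign_def power_add)
qed

lemma shuffle_sign_Un_right:
  assumes "A \<inter> B = {}"
  shows "shuffle_sign C (A \<union> B) = shuffle_sign C A * shuffle_sign C B"
proof -
  let ?S = "\<lambda>A. {(i, j). i \<in> C \<and> j \<in> A \<and> j < i}"
  have "card (?S (A \<union> B)) = card (?S A \<union> ?S B)" by (rule arg_cong[of _ _ card]) auto
  also have "\<dots> = card (?S A) + card (?S B)"
    using assms by (intro card_Un_disjoint) (auto intro: finite_subset[OF _ finite])
  finally show ?thesis by (simp add: shuffle_sign_def power_add)
qed

text \<open>Each pair in A \<times> B is an inversion for exactly one of the two orders, so the two
  inversion counts add up to card A * card B.\<close>

lemma shuffle_sign_swap:
  assumes "A \<inter> B = {}"
  shows "shuffle_sign A B * shuffle_sign B A = (-1) ^ (card A * card B)"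
proof -
  let ?S = "\<lambda>A B. {(i, j). i \<in> A \<and> j \<in> B \<and> j < i}"
  have "card (?S B A) = card (prod.swap ` ?S B A)" by (simp add: card_image)
  then have "card (?S A B) + card (?S B A) = card (?S A B \<union> prod.swap ` ?S B A)"
    by (simp, intro card_Un_disjoint[symmetric]) (auto intro: finite_subset[OF _ finite])
  also have "?S A B \<union> prod.swap ` ?S B A = A \<times> B"
  proof -
    have "a < b \<or> b < a" if "a \<in> A" "b \<in> B" for a b using that assms by (metis disjoint_iff linorder_neqE)
    then show ?thesis by force
  qed
  finally show ?thesis by (simp add: shuffle_sign_def power_add[symmetric] card_cartesian_product)
qed

lemma wedge_1_form_nth:
  assumes "homogeneous 1 \<alpha>"
  shows "(\<alpha> \<and>\<^sub>\<Lambda> \<beta>) $ K = (\<Sum>k\<in>K. shuffle_sign {k} (K - {k}) * \<alpha> $ {k} * \<beta> $ (K - {k}))"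
proof -
  have "(\<alpha> \<and>\<^sub>\<Lambda> \<beta>) $ K = (\<Sum>I\<in>Pow K. shuffle_sign I (K - I) * \<alpha> $ I * \<beta> $ (K - I))"
    by (simp add: wedge_def)
  also have "\<dots> = (\<Sum>I\<in>(\<lambda>k. {k}) ` K. shuffle_sign I (K - I) * \<alpha> $ I * \<beta> $ (K - I))"
  proof (rule sum.mono_neutral_right)
    show "\<forall>I\<in>Pow K - (\<lambda>k. {k}) ` K. shuffle_sign I (K - I) * \<alpha> $ I * \<beta> $ (K - I) = 0"
    proof
      fix I assume I: "I \<in> Pow K - (\<lambda>k. {k}) ` K"
      have "card I \<noteq> 1"
      proof
        assume "card I = 1"
        then obtain k where "I = {k}" by (auto simp: card_1_singleton_iff)
        with I show False by auto
      qed
      then show "shuffle_sign I (K - I) * \<alpha> $ I * \<beta> $ (K - I) = 0"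
        using assms by (simp add: homogeneous_def)
    qed
  qed auto
  also have "\<dots> = (\<Sum>k\<in>K. shuffle_sign {k} (K - {k}) * \<alpha> $ {k} * \<beta> $ (K - {k}))"
    by (subst sum.reindex) auto
  finally show ?thesis .
qed

lemma wedge_1_forms_nth:
  assumes "homogeneous 1 \<alpha>" "i \<noteq> j"
  shows "(\<alpha> \<and>\<^sub>\<Lambda> \<beta>) $ {i, j} = shuffle_sign {i} {j} * (\<alpha> $ {i} * \<beta> $ {j} - \<alpha> $ {j} * \<beta> $ {i})"
proof -
  have "{i, j} - {i} = {j}" "{i, j} - {j} = {i}" using assms(2) by auto
  moreover have "shuffle_sign {j} {i} = - shuffle_sign {i} {j}"
    using assms(2) by (auto simp: shuffle_sign_singletons)
  ultimately show ?thesis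
    using assms(2) by (simp add: wedge_1_form_nth[OF assms(1)] algebra_simps)
qed

lemma inner_sharp_le: "sharp \<alpha> \<bullet> sharp \<alpha> \<le> \<alpha> \<bullet> \<alpha>"
proof -
  have "sharp \<alpha> \<bullet> sharp \<alpha> = (\<Sum>I\<in>range (\<lambda>j. {j}). \<alpha> $ I * \<alpha> $ I)"
    by (subst sum.reindex) (auto simp: sharp_def inner_vec_def inj_def)
  also have "\<dots> \<le> \<alpha> \<bullet> \<alpha>" unfolding inner_vec_def inner_real_def by (rule sum_mono2) auto
  finally show ?thesis .
qed

lemma inner_sharp:
  assumes "homogeneous 1 \<alpha>"
  shows "\<alpha> \<bullet> \<beta> = sharp \<alpha> \<bullet> sharp \<beta>"
proof -
  have "sharp \<alpha> \<bullet> sharp \<beta> = (\<Sum>I\<in>range (\<lambda>j. {j}). \<alpha> $ I * \<beta> $ I)"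
    by (subst sum.reindex) (auto simp: sharp_def inner_vec_def inj_def)
  also have "\<dots> = \<alpha> \<bullet> \<beta>"
    unfolding inner_vec_def inner_real_def
  proof (rule sum.mono_neutral_left)
    show "\<forall>I\<in>UNIV - range (\<lambda>j. {j}). \<alpha> $ I * \<beta> $ I = 0"
    proof
      fix I :: "'a set" assume I: "I \<in> UNIV - range (\<lambda>j. {j})"
      then have "card I \<noteq> 1" by (auto simp: card_1_singleton_iff)
      then show "\<alpha> $ I * \<beta> $ I = 0" using assms by (simp add: homogeneous_def)
    qed
  qed auto
  finally show ?thesis ..
qed

text \<open>Up to sign, wedging with \<alpha> between two Hodge stars is contraction with \<alpha>,
  here applied to the 2-form \<delta> \<and> \<alpha>. In dimension three the result is the double
  cross product a \<times> (d \<times> a), scaled by c.\<close>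

lemma sharp_triple:
  fixes \<alpha> \<delta> :: "'n::{finite,linorder} form"
  assumes \<alpha>: "homogeneous 1 \<alpha>" and \<delta>: "homogeneous 1 \<delta>"
  defines "a \<equiv> sharp \<alpha>" and "d \<equiv> sharp \<delta>"
  shows "sharp (\<star> (\<alpha> \<and>\<^sub>\<Lambda> \<star> (c *\<^sub>R (\<delta> \<and>\<^sub>\<Lambda> \<alpha>)))) = ((-1) ^ CARD('n) * c) *\<^sub>R ((a \<bullet> d) *\<^sub>R a - (a \<bullet> a) *\<^sub>R d)"
proof -
  have "(\<star> (\<alpha> \<and>\<^sub>\<Lambda> \<star> (c *\<^sub>R (\<delta> \<and>\<^sub>\<Lambda> \<alpha>)))) $ {i}
      = ((-1) ^ CARD('n) * c) * ((a \<bullet> d) * a $ i - (a \<bullet> a) * d $ i)" for i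
  proof -
    \<comment> \<open>The sign of {i, j} splits into those of {i} and {j}. The one of {j} then
      occurs twice and cancels; the rest are the two orders of {i} against its complement.\<close>
    have sign: "shuffle_sign (- {i}) {i} * (shuffle_sign {j} (- {i, j}) * (shuffle_sign {i, j} (- {i, j}) * shuffle_sign {i} {j}))
        = (-1) ^ (CARD('n) - 1)" if "j \<noteq> i" for j
    proof -
      have 1: "shuffle_sign {i, j} (- {i, j}) = shuffle_sign {i} (- {i, j}) * shuffle_sign {j} (- {i, j})"
        using shuffle_sign_Un_left[of "{i}" "{j}" "- {i, j}"] that by (auto simp: insert_commute)
      have "- {i} = - {i, j} \<union> {j}" using that by auto
      then have 2: "shuffle_sign {i} (- {i}) = shuffle_sign {i} (- {i, j}) * shuffle_sign {i} {j}"
        using shuffle_sign_Un_right[of "- {i, j}" "{j}" "{i}"] by auto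
      have "shuffle_sign (- {i}) {i} * (shuffle_sign {j} (- {i, j}) * (shuffle_sign {i, j} (- {i, j}) * shuffle_sign {i} {j}))
        = (shuffle_sign {j} (- {i, j}) * shuffle_sign {j} (- {i, j})) * (shuffle_sign (- {i}) {i} * shuffle_sign {i} (- {i}))"
        unfolding 1 2 by (simp only: mult_ac)
      also have "\<dots> = (-1) ^ (card (- {i}) * card {i})"
        unfolding shuffle_sign_sq by (subst shuffle_sign_swap) auto
      finally show ?thesis by (simp add: Compl_eq_Diff_UNIV card_Diff_subset)
    qed
    have "(\<star> (\<alpha> \<and>\<^sub>\<Lambda> \<star> (c *\<^sub>R (\<delta> \<and>\<^sub>\<Lambda> \<alpha>)))) $ {i} =
       (\<Sum>j\<in>- {i}. shuffle_sign (- {i}) {i} * (shuffle_sign {j} (- {i} - {j}) * \<alpha> $ {j} *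
           (shuffle_sign (- (- {i} - {j})) (- {i} - {j}) * (c * (\<delta> \<and>\<^sub>\<Lambda> \<alpha>) $ (- (- {i} - {j}))))))"
      unfolding hodge_def[of "\<alpha> \<and>\<^sub>\<Lambda> \<beta>" for \<beta>] vec_lambda_beta wedge_1_form_nth[OF \<alpha>, of _ "- {i}"]
      by (simp add: hodge_def sum_distrib_left)
    also have "\<dots> = (\<Sum>j\<in>- {i}. (-1) ^ (CARD('n) - 1) * c * (a $ j * (d $ i * a $ j - d $ j * a $ i)))"
    proof (rule sum.cong[OF refl])
      fix j assume "j \<in> - {i}"
      then have j: "j \<noteq> i" by simp
      have s: "- {i} - {j} = - {i, j}" by auto
      have "shuffle_sign (- {i}) {i} * (shuffle_sign {j} (- {i} - {j}) * \<alpha> $ {j} *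
           (shuffle_sign (- (- {i} - {j})) (- {i} - {j}) * (c * (\<delta> \<and>\<^sub>\<Lambda> \<alpha>) $ (- (- {i} - {j})))))
         = (shuffle_sign (- {i}) {i} * (shuffle_sign {j} (- {i, j}) * (shuffle_sign {i, j} (- {i, j}) * shuffle_sign {i} {j})))
            * c * (a $ j * (d $ i * a $ j - d $ j * a $ i))"
        unfolding s double_complement wedge_1_forms_nth[OF \<delta> j[symmetric]]
        by (simp add: a_def d_def sharp_def)
      also have "\<dots> = (-1) ^ (CARD('n) - 1) * c * (a $ j * (d $ i * a $ j - d $ j * a $ i))"
        unfolding sign[OF j] ..
      finally show "shuffle_sign (- {i}) {i} * (shuffle_sign {j} (- {i} - {j}) * \<alpha> $ {j} *
           (shuffle_sign (- (- {i} - {j})) (- {i} - {j}) * (c * (\<delta> \<and>\<^sub>\<Lambda> \<alpha>) $ (- (- {i} - {j})))))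
         = (-1) ^ (CARD('n) - 1) * c * (a $ j * (d $ i * a $ j - d $ j * a $ i))" .
    qed
    also have "\<dots> = (\<Sum>j\<in>UNIV. (-1) ^ (CARD('n) - 1) * c * (a $ j * (d $ i * a $ j - d $ j * a $ i)))"
      by (rule sum.mono_neutral_left) auto
    also have "\<dots> = (-1) ^ (CARD('n) - 1) * c * ((a \<bullet> a) * d $ i - (a \<bullet> d) * a $ i)"
    proof -
      have "(\<Sum>j\<in>UNIV. a $ j * (d $ i * a $ j - d $ j * a $ i)) = (a \<bullet> a) * d $ i - (a \<bullet> d) * a $ i"
        by (simp add: inner_vec_def right_diff_distrib sum_subtractf sum_distrib_left sum_distrib_right mult_ac)
      then show ?thesis unfolding sum_distrib_left[symmetric] by simp
    qed
    \<comment> \<open>Trading n - 1 for n flips the sign, which exchanges the two terms of the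
      difference.\<close>
    also have "(-1 :: real) ^ (CARD('n) - 1) = - ((-1) ^ CARD('n))"
      by (metis One_nat_def Suc_pred mult_minus1 power_Suc zero_less_card_finite minus_minus)
    finally show ?thesis by (simp add: algebra_simps)
  qed
  then show ?thesis by (simp add: sharp_def vec_eq_iff)
qed

section \<open>Gradients, partial derivatives and the exterior derivative\<close>

lemma has_derivative_grad:
  fixes g :: "'n::finite point \<Rightarrow> real"
  assumes "g differentiable (at x)"
  shows "(g has_derivative (\<lambda>h. grad g x \<bullet> h)) (at x)"
proof -
  let ?D = "frechet_derivative g (at x)"
  have D: "(g has_derivative ?D) (at x)" using assms by (simp add: frechet_derivative_works)
  then have lin: "linear ?D" by (rule has_derivative_linear)
  have "?D h = grad g x \<bullet> h" for h
  proof -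
    have "?D h = ?D (\<Sum>i\<in>UNIV. h $ i *\<^sub>R axis i 1)"
      using basis_expansion[of h] by (simp add: scalar_mult_eq_scaleR)
    also have "\<dots> = (\<Sum>i\<in>UNIV. h $ i * ?D (axis i 1))"
      by (simp add: linear_sum[OF lin] linear_scale[OF lin])
    finally show ?thesis by (simp add: grad_def partial_deriv_def inner_vec_def mult.commute)
  qed
  then show ?thesis using D by (metis (no_types, lifting) ext)
qed

lemma C1_grad_Ck_on:
  fixes g :: "'n::finite point \<Rightarrow> real"
  assumes "Ck_on (Suc 0) S g"
  shows "C1_grad S g (grad g)"
proof -
  have "continuous_on S (\<lambda>x. \<chi> i. partial_deriv i g x)"
    using assms by (intro continuous_on_vec_lambda) simp
  then have "continuous_on S (grad g)" by (simp add: grad_def[abs_def])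
  moreover have "(g has_derivative (\<lambda>h. grad g x \<bullet> h)) (at x)" if "x \<in> S" for x
    using assms that by (intro has_derivative_grad) simp
  ultimately show ?thesis by (simp add: C1_grad_def)
qed

lemma partial_deriv_C1_grad:
  assumes "C1_grad S g g'" "x \<in> S"
  shows "partial_deriv i g x = g' x $ i"
  using fun_cong[OF frechet_derivative_at[OF C1_gradD[OF assms]], of "axis i 1"]
  by (simp add: partial_deriv_def inner_axis)

lemma partial_deriv_nth:
  assumes "\<alpha> differentiable (at x)"
  shows "partial_deriv i (\<lambda>y. \<alpha> y $ I) x = partial_deriv i \<alpha> x $ I"
    and "(\<lambda>y. \<alpha> y $ I) differentiable (at x)"
proof -
  have D: "((\<lambda>y. \<alpha> y $ I) has_derivative (\<lambda>h. frechet_derivative \<alpha> (at x) h $ I)) (at x)"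
    using bounded_linear.has_derivative[OF bounded_linear_vec_nth assms[unfolded frechet_derivative_works]] .
  then show "(\<lambda>y. \<alpha> y $ I) differentiable (at x)" by (rule differentiableI)
  show "partial_deriv i (\<lambda>y. \<alpha> y $ I) x = partial_deriv i \<alpha> x $ I"
    using frechet_derivative_at[OF D] by (simp add: partial_deriv_def fun_eq_iff)
qed

lemma C1_grad_form_component:
  fixes \<alpha> :: "'n::finite point \<Rightarrow> 'n form"
  assumes "Ck_on (Suc 0) S \<alpha>"
  shows "C1_grad S (\<lambda>x. \<alpha> x $ I) (\<lambda>x. \<chi> i. partial_deriv i \<alpha> x $ I)"
proof -
  have "continuous_on S (\<lambda>x. \<chi> i. partial_deriv i \<alpha> x $ I)"
    using assms by (intro continuous_on_vec_lambda continuous_intros) simp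
  moreover have "((\<lambda>y. \<alpha> y $ I) has_derivative (\<lambda>h. (\<chi> i. partial_deriv i \<alpha> x $ I) \<bullet> h)) (at x)"
    if "x \<in> S" for x
  proof -
    have d: "\<alpha> differentiable (at x)" using assms that by simp
    have "grad (\<lambda>y. \<alpha> y $ I) x = (\<chi> i. partial_deriv i \<alpha> x $ I)"
      unfolding grad_def partial_deriv_nth(1)[OF d] ..
    then show ?thesis using has_derivative_grad[OF partial_deriv_nth(2)[OF d, of I]] by simp
  qed
  ultimately show ?thesis unfolding C1_grad_def by blast
qed

lemma C1_grad_cong:
  assumes "C1_grad S f g" "open S" "\<And>x. x \<in> S \<Longrightarrow> f' x = f x" "\<And>x. x \<in> S \<Longrightarrow> g' x = g x"
  shows "C1_grad S f' g'"
proof -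
  have "(f' has_derivative (\<lambda>h. g' x \<bullet> h)) (at x)" if "x \<in> S" for x
    using has_derivative_transform_within_open[OF C1_gradD[OF assms(1) that] assms(2) that] assms(3,4) that by simp
  moreover have "continuous_on S g'"
    using C1_grad_cont_grad[OF assms(1)] assms(4) by (metis continuous_on_cong)
  ultimately show ?thesis by (simp add: C1_grad_def)
qed

lemma dx_wedge_axis_empty: "dx i \<and>\<^sub>\<Lambda> axis {} c = c *\<^sub>R dx i"
proof -
  have "(dx i \<and>\<^sub>\<Lambda> axis {} c) $ K = (c *\<^sub>R dx i) $ K" for K
  proof (cases "K = {i}")
    case True
    then show ?thesis unfolding dx_wedge_nth by (simp add: dx_def axis_def)
  next
    case False
    then have "K - {i} \<noteq> {} \<or> i \<notin> K" by auto
    then show ?thesis using False unfolding dx_wedge_nth by (auto simp: dx_def axis_def)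
  qed
  then show ?thesis by (simp add: vec_eq_iff)
qed

lemma ext_d_zero_form:
  assumes "C1_grad S g g'" "x \<in> S"
  shows "ext_d (zero_form g) x = (\<Sum>i\<in>UNIV. g' x $ i *\<^sub>R dx i)"
proof -
  have lin: "bounded_linear (\<lambda>c::real. axis {} c :: 'a form)"
    by (intro linear_conv_bounded_linear[THEN iffD1] linearI) (auto simp: axis_def vec_eq_iff)
  have "(zero_form g has_derivative (\<lambda>h. axis {} (g' x \<bullet> h))) (at x)"
    unfolding zero_form_def[abs_def] by (rule bounded_linear.has_derivative[OF lin C1_gradD[OF assms]])
  from fun_cong[OF frechet_derivative_at[OF this]]
  have "partial_deriv i (zero_form g) x = axis {} (g' x $ i)" for i
    unfolding partial_deriv_def by (metis inner_axis inner_real_def mult.right_neutral)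
  then show ?thesis by (simp add: ext_d_def dx_wedge_axis_empty)
qed

lemma sum_dx:
  "homogeneous 1 (\<Sum>i\<in>UNIV. v $ i *\<^sub>R dx i :: 'n::finite form)"
  "sharp (\<Sum>i\<in>UNIV. v $ i *\<^sub>R dx i :: 'n form) = v"
proof -
  have nth: "(\<Sum>i\<in>UNIV. v $ i *\<^sub>R dx i :: 'n form) $ I = (\<Sum>i\<in>UNIV. if I = {i} then v $ i else 0)" for I
    by (auto simp: dx_def axis_def intro!: sum.cong)
  show "homogeneous 1 (\<Sum>i\<in>UNIV. v $ i *\<^sub>R dx i :: 'n form)"
    unfolding homogeneous_def nth by (auto intro!: sum.neutral)
  show "sharp (\<Sum>i\<in>UNIV. v $ i *\<^sub>R dx i :: 'n form) = v"
    unfolding sharp_def nth by (simp add: vec_eq_iff)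
qed

lemma ext_d_1_form_nth:
  assumes "i \<noteq> j"
  shows "ext_d \<omega> x $ {i, j} = shuffle_sign {i} {j} * (partial_deriv i \<omega> x $ {j} - partial_deriv j \<omega> x $ {i})"
proof -
  have "ext_d \<omega> x $ {i, j} = (\<Sum>k\<in>UNIV. if k \<in> {i, j} then shuffle_sign {k} ({i, j} - {k}) * partial_deriv k \<omega> x $ ({i, j} - {k}) else 0)"
    by (simp add: ext_d_def dx_wedge_nth)
  also have "\<dots> = (\<Sum>k\<in>{i, j}. shuffle_sign {k} ({i, j} - {k}) * partial_deriv k \<omega> x $ ({i, j} - {k}))"
    by (subst sum.inter_filter[symmetric]) (auto intro!: sum.cong)
  also have "\<dots> = shuffle_sign {i} {j} * partial_deriv i \<omega> x $ {j} + shuffle_sign {j} {i} * partial_deriv j \<omega> x $ {i}"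
  proof -
    have "{i, j} - {i} = {j}" "{i, j} - {j} = {i}" using assms by auto
    then show ?thesis using assms by simp
  qed
  also have "shuffle_sign {j} {i} = - shuffle_sign {i} {j}"
    using assms by (auto simp: shuffle_sign_singletons)
  finally show ?thesis by (simp add: algebra_simps)
qed

text \<open>The given forms have arbitrary values at p, whereas the extended fields are 0 there. A
  point is a null set, so one may be exchanged for the other.\<close>

lemma lebesgue_modify_point:
  fixes u g :: "'a::euclidean_space \<Rightarrow> 'b::euclidean_space"
  assumes g: "g \<in> borel_measurable lebesgue" and eq: "\<And>x. x \<noteq> p \<Longrightarrow> u x = g x"
  shows "u \<in> borel_measurable lebesgue"
    and "integrable lebesgue g \<Longrightarrow> integrable lebesgue u"
    and "integral\<^sup>L lebesgue u = integral\<^sup>L lebesgue g"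
proof -
  have "u = (\<lambda>x. if x = p then u p else g x)" using eq by auto
  moreover have "(\<lambda>x. if x = p then u p else g x) \<in> borel_measurable lebesgue"
  proof (rule measurable_If[OF _ g])
    have "{p} \<in> sets lebesgue" by simp
    then show "{x \<in> space lebesgue. x = p} \<in> sets lebesgue" by simp
  qed simp
  ultimately show u: "u \<in> borel_measurable lebesgue" by metis
  have "AE x in lebesgue. x \<noteq> p"
    using AE_lborel_neq[of p] by (rule AE_completion)
  then have ae: "AE x in lebesgue. u x = g x" by eventually_elim (rule eq)
  show "integrable lebesgue g \<Longrightarrow> integrable lebesgue u"
    using integrable_cong_AE[OF u g ae] by simp
  show "integral\<^sup>L lebesgue u = integral\<^sup>L lebesgue g"
    by (rule integral_cong_AE[OF u g ae])
qed

lemma lebesgue_on_modify_point: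
  fixes u g :: "'a::euclidean_space \<Rightarrow> 'b::euclidean_space"
  assumes D: "D \<in> sets lebesgue" and g: "g \<in> borel_measurable lebesgue"
    and eq: "\<And>x. x \<in> D \<Longrightarrow> x \<noteq> p \<Longrightarrow> u x = g x"
  shows "u \<in> borel_measurable (lebesgue_on D)"
    and "integrable lebesgue (\<lambda>x. indicator D x *\<^sub>R g x) \<Longrightarrow> integrable (lebesgue_on D) u"
    and "integral\<^sup>L (lebesgue_on D) u = (\<integral>x. indicator D x *\<^sub>R g x \<partial>lebesgue)"
proof -
  have g': "(\<lambda>x. indicator D x *\<^sub>R g x) \<in> borel_measurable lebesgue"
    using g D by measurable
  have eq': "indicator D x *\<^sub>R u x = indicator D x *\<^sub>R g x" if "x \<noteq> p" for x
    using eq[of x] that by (auto simp: indicator_def)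
  note L = lebesgue_modify_point[OF g' eq']
  show "u \<in> borel_measurable (lebesgue_on D)"
    using L(1) borel_measurable_restrict_space_iff[of D lebesgue u] D by simp
  show "integrable lebesgue (\<lambda>x. indicator D x *\<^sub>R g x) \<Longrightarrow> integrable (lebesgue_on D) u"
    using L(2) integrable_restrict_space[of D lebesgue u] D by simp
  show "integral\<^sup>L (lebesgue_on D) u = (\<integral>x. indicator D x *\<^sub>R g x \<partial>lebesgue)"
    using L(3) integral_restrict_space[of D lebesgue u] D by simp
qed

lemma test_function_C1_grad:
  assumes "test_function D \<zeta>"
  obtains K where "C1_grad UNIV \<zeta> (grad \<zeta>)" "compact K" "K \<subseteq> D" "\<And>x. x \<notin> K \<Longrightarrow> \<zeta> x = 0"
proof (rule that[of "closure {x. \<zeta> x \<noteq> 0}"])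
  have "Ck_on (Suc 0) UNIV \<zeta>" using assms unfolding test_function_def smooth_on_def by blast
  then show "C1_grad UNIV \<zeta> (grad \<zeta>)" by (rule C1_grad_Ck_on)
  show "\<zeta> x = 0" if "x \<notin> closure {x. \<zeta> x \<noteq> 0}" for x
    using that closure_subset[of "{x. \<zeta> x \<noteq> 0}"] by blast
qed (use assms in \<open>auto simp: test_function_def\<close>)

text \<open>\<Gamma> is known only through its values on \<open>U\<close>. As \<open>U\<close> is
  open, it inherits its degree and one continuous derivative from \<eta>, which has two.\<close>

lemma exact_1_form:
  fixes \<eta> :: "'n::{finite,linorder} point \<Rightarrow> real"
  assumes U: "open U" and \<eta>: "smooth_on U \<eta>" and \<Gamma>: "\<And>x. x \<in> U \<Longrightarrow> \<Gamma> x = ext_d (zero_form \<eta>) x"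
  shows "\<And>x. x \<in> U \<Longrightarrow> homogeneous 1 (\<Gamma> x)"
    and "C1_grad U (\<lambda>x. \<Gamma> x $ {j}) (\<lambda>x. \<chi> i. partial_deriv i \<Gamma> x $ {j})"
proof -
  have C2: "Ck_on (Suc (Suc 0)) U \<eta>" using \<eta> unfolding smooth_on_def by blast
  have g: "C1_grad U \<eta> (grad \<eta>)"
  proof (rule C1_grad_Ck_on)
    have "\<eta> differentiable (at x)" "partial_deriv i \<eta> differentiable (at x)" if "x \<in> U" for x i
      using C2 that by auto
    then show "Ck_on (Suc 0) U \<eta>"
      by (auto intro!: continuous_at_imp_continuous_on differentiable_imp_continuous_within)
  qed
  have gg: "C1_grad U (partial_deriv i \<eta>) (grad (partial_deriv i \<eta>))" for i
    by (rule C1_grad_Ck_on) (use C2 in auto)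
  have \<Gamma>': "\<Gamma> x = (\<Sum>i\<in>UNIV. partial_deriv i \<eta> x *\<^sub>R dx i)" if "x \<in> U" for x
    using \<Gamma>[OF that] ext_d_zero_form[OF g that] by (simp add: grad_def)
  have \<Gamma>'': "\<Gamma> x = (\<Sum>i\<in>UNIV. (\<chi> i. partial_deriv i \<eta> x) $ i *\<^sub>R dx i)" if "x \<in> U" for x
    using \<Gamma>'[OF that] by simp
  show hom: "homogeneous 1 (\<Gamma> x)" if "x \<in> U" for x
    unfolding \<Gamma>''[OF that] by (rule sum_dx)
  have comp: "\<Gamma> x $ {j} = partial_deriv j \<eta> x" if "x \<in> U" for x j
    using sum_dx(2)[of "\<chi> i. partial_deriv i \<eta> x"] unfolding \<Gamma>''[OF that, symmetric]
    by (simp add: sharp_def vec_eq_iff)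
  have "\<Gamma> differentiable (at x)" if "x \<in> U" for x
  proof -
    have "((\<lambda>x. \<Sum>i\<in>UNIV. partial_deriv i \<eta> x *\<^sub>R dx i) has_derivative
        (\<lambda>h. \<Sum>i\<in>UNIV. (grad (partial_deriv i \<eta>) x \<bullet> h) *\<^sub>R dx i)) (at x)"
      by (intro has_derivative_sum has_derivative_scaleR_left C1_gradD[OF gg that])
    then have "(\<Gamma> has_derivative (\<lambda>h. \<Sum>i\<in>UNIV. (grad (partial_deriv i \<eta>) x \<bullet> h) *\<^sub>R dx i)) (at x)"
      by (rule has_derivative_transform_within_open[OF _ U that]) (simp add: \<Gamma>')
    then show ?thesis by (rule differentiableI)
  qed
  then have "partial_deriv i \<Gamma> x $ {j} = grad (partial_deriv j \<eta>) x $ i" if "x \<in> U" for x i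
  proof -
    assume d: "\<And>x. x \<in> U \<Longrightarrow> \<Gamma> differentiable (at x)"
    have "C1_grad U (\<lambda>x. \<Gamma> x $ {j}) (grad (partial_deriv j \<eta>))"
      by (rule C1_grad_cong[OF gg U]) (auto simp: comp)
    from partial_deriv_C1_grad[OF this that] partial_deriv_nth(1)[OF d[OF that]]
    show ?thesis by metis
  qed
  then show "C1_grad U (\<lambda>x. \<Gamma> x $ {j}) (\<lambda>x. \<chi> i. partial_deriv i \<Gamma> x $ {j})"
    by (intro C1_grad_cong[OF gg[of j] U]) (auto simp: comp vec_eq_iff)
qed

text \<open>\<open>norm_nabla\<close> sums over all coefficients of the derivatives, the Jacobian
  only over those at singletons.\<close>

lemma norm_Jacobian_le_norm_nabla:
  "norm (\<chi> j i. partial_deriv i \<Gamma> x $ {j}) \<le> norm_nabla \<Gamma> x"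
proof -
  let ?B = "\<chi> j i. partial_deriv i \<Gamma> x $ {j}"
  have "?B \<bullet> ?B = (\<Sum>i\<in>UNIV. sharp (partial_deriv i \<Gamma> x) \<bullet> sharp (partial_deriv i \<Gamma> x))"
    by (simp add: inner_vec_def sharp_def) (rule sum.swap)
  also have "\<dots> \<le> (\<Sum>i\<in>UNIV. form_inner (partial_deriv i \<Gamma> x) (partial_deriv i \<Gamma> x))"
    unfolding form_inner_eq_inner by (intro sum_mono inner_sharp_le)
  finally show ?thesis by (simp add: norm_eq_sqrt_inner norm_nabla_def)
qed

lemma integrable_componentwise:
  fixes f :: "'a \<Rightarrow> 'b::euclidean_space"
  assumes "\<And>b. b \<in> Basis \<Longrightarrow> integrable N (\<lambda>x. f x \<bullet> b)"
  shows "integrable N f"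
proof -
  have "integrable N (\<lambda>x. \<Sum>b\<in>Basis. (f x \<bullet> b) *\<^sub>R b)"
    by (intro Bochner_Integration.integrable_sum integrable_scaleR_left assms)
  then show ?thesis by (simp add: euclidean_representation)
qed

text \<open>Translates the results for the zero-extended fields on \<open>lborel\<close> into
  statements about the original u, f and T on \<open>lebesgue_on D\<close>. The witnesses are the
  gradient \<open>Dh\<close> and a ball D around p on which the energy is finite.\<close>

lemma (in singular_flow) weak_solution:
  assumes u: "\<And>x. x \<in> \<Omega> - {p} \<Longrightarrow> u x = H (w x \<bullet> w x)"
    and f: "\<And>x. x \<in> \<Omega> - {p} \<Longrightarrow> f x = F x"
    and T: "\<And>x. x \<in> \<Omega> - {p} \<Longrightarrow> sharp (T x) =
      \<rho>' (w x \<bullet> w x) *\<^sub>R ((w x \<bullet> (2 *\<^sub>R (w x v* M x))) *\<^sub>R w x - (w x \<bullet> w x) *\<^sub>R (2 *\<^sub>R (w x v* M x)))"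
  shows "\<exists>C>0. \<exists>D nablaH. open D \<and> p \<in> D \<and> D \<subseteq> \<Omega> \<and>
         H12_gradient D u nablaH \<and>
         (\<forall>\<zeta>. test_function D \<zeta> \<and> (\<forall>x. \<zeta> x \<ge> 0) \<longrightarrow>
            integrable (lebesgue_on D)
              (\<lambda>x. (nablaH x + sharp (T x)) \<bullet> grad \<zeta> x - C * f x * u x * \<zeta> x) \<and>
            (\<integral>x. (nablaH x + sharp (T x)) \<bullet> grad \<zeta> x - C * f x * u x * \<zeta> x
               \<partial>lebesgue_on D) \<le> 0)"
proof -
  obtain e where e: "e > 0" "cball p e \<subseteq> \<Omega>"
    using open_domain p_in open_contains_cball by blast
  define R where "R = e / 5"
  have R: "0 < R" and sub: "cball p (5 * R) \<subseteq> \<Omega>" using e by (auto simp: R_def)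
  define D where "D = ball p R"
  have D: "open D" "p \<in> D" "D \<in> sets lebesgue" using R by (auto simp: D_def)
  have D\<Omega>: "D \<subseteq> \<Omega>" using sub R by (force simp: D_def subset_iff)
  have uh: "u x = h x" if "x \<in> D" "x \<noteq> p" for x
    using u[of x] D\<Omega> that by (auto simp: h_def Q_def)
  have lebm: "g \<in> borel_measurable lebesgue" if "g \<in> borel_measurable borel" for g :: "real^'n \<Rightarrow> 'b::euclidean_space"
    by (rule measurable_completion) (use that in simp)
  have lebi: "integrable lebesgue g" "integral\<^sup>L lebesgue g = integral\<^sup>L lborel g" if "integrable lborel g" for g :: "real^'n \<Rightarrow> 'b::euclidean_space"
    using that by (simp_all add: integrable_completion integral_completion)
  have H12: "H12_gradient D u Dh"
    unfolding H12_gradient_def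
  proof (intro conjI allI impI)
    have m: "(\<lambda>x. (h x)\<^sup>2) \<in> borel_measurable lebesgue" "(\<lambda>x. (norm (Dh x))\<^sup>2) \<in> borel_measurable lebesgue"
      "h \<in> borel_measurable lebesgue" "Dh \<in> borel_measurable lebesgue"
      by (rule lebm; measurable)+
    show "Lp_on 2 D u"
      unfolding Lp_on_def
    proof
      show "u \<in> borel_measurable (lebesgue_on D)"
        by (rule lebesgue_on_modify_point(1)[OF D(3) m(3) uh])
      show "integrable (lebesgue_on D) (\<lambda>x. norm (u x) powr 2)"
        by (rule lebesgue_on_modify_point(2)[OF D(3) m(1), of p])
          (use uh lebi(1)[OF integrable_h_sq[OF R sub]] in \<open>auto simp: D_def\<close>)
    qed
    show "Lp_on 2 D Dh"
      unfolding Lp_on_def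
    proof
      show "Dh \<in> borel_measurable (lebesgue_on D)"
        by (rule lebesgue_on_modify_point(1)[OF D(3) m(4), of p]) simp
      show "integrable (lebesgue_on D) (\<lambda>x. norm (Dh x) powr 2)"
        by (rule lebesgue_on_modify_point(2)[OF D(3) m(2), of p])
          (use lebi(1)[OF integrable_gradient_sq[OF R sub]] in \<open>auto simp: D_def\<close>)
    qed
    fix \<phi> assume "test_function D \<phi>"
    then obtain K where \<phi>: "C1_grad UNIV \<phi> (grad \<phi>)" "compact K" "K \<subseteq> ball p R" "\<And>x. x \<notin> K \<Longrightarrow> \<phi> x = 0"
      unfolding D_def by (rule test_function_C1_grad) blast
    note test = R sub \<phi>
    have \<phi>0: "\<phi> x = 0" "grad \<phi> x = 0" if "x \<notin> D" for x
      using test_grad_0[OF test] that by (auto simp: D_def)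
    have [measurable]: "\<phi> \<in> borel_measurable borel" "grad \<phi> \<in> borel_measurable borel"
      using C1_grad_cont[OF \<phi>(1)] C1_grad_cont_grad[OF \<phi>(1)] by (auto intro: borel_measurable_continuous_onI)
    have i: "integrable lborel (\<lambda>x. h x *\<^sub>R grad \<phi> x)" "integrable lborel (\<lambda>x. \<phi> x *\<^sub>R Dh x)"
      by (rule integrable_componentwise; use test_integrable(1,2)[OF test] in simp)+
    have "(\<integral>x. h x *\<^sub>R grad \<phi> x \<partial>lborel) \<bullet> v = (- (\<integral>x. \<phi> x *\<^sub>R Dh x \<partial>lborel)) \<bullet> v" for v
      using weak_gradient[OF test, of v] i
        integral_inner_left[of v lborel "\<lambda>x. h x *\<^sub>R grad \<phi> x"] integral_inner_left[of v lborel "\<lambda>x. \<phi> x *\<^sub>R Dh x"]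
      by simp
    then have "(\<integral>x. h x *\<^sub>R grad \<phi> x \<partial>lborel) = - (\<integral>x. \<phi> x *\<^sub>R Dh x \<partial>lborel)"
      by (rule euclidean_eqI)
    moreover have "(\<integral>x. u x *\<^sub>R grad \<phi> x \<partial>lebesgue_on D) = (\<integral>x. h x *\<^sub>R grad \<phi> x \<partial>lborel)"
    proof -
      have "(\<integral>x. u x *\<^sub>R grad \<phi> x \<partial>lebesgue_on D) = (\<integral>x. indicator D x *\<^sub>R (h x *\<^sub>R grad \<phi> x) \<partial>lebesgue)"
        by (rule lebesgue_on_modify_point(3)[OF D(3), of _ p]) (auto intro!: lebm simp: uh)
      also have "(\<lambda>x. indicator D x *\<^sub>R (h x *\<^sub>R grad \<phi> x)) = (\<lambda>x. h x *\<^sub>R grad \<phi> x)"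
        using \<phi>0 by (auto simp: indicator_def fun_eq_iff)
      finally show ?thesis using lebi(2)[OF i(1)] by simp
    qed
    moreover have "(\<integral>x. \<phi> x *\<^sub>R Dh x \<partial>lebesgue_on D) = (\<integral>x. \<phi> x *\<^sub>R Dh x \<partial>lborel)"
    proof -
      have "(\<integral>x. \<phi> x *\<^sub>R Dh x \<partial>lebesgue_on D) = (\<integral>x. indicator D x *\<^sub>R (\<phi> x *\<^sub>R Dh x) \<partial>lebesgue)"
        by (rule lebesgue_on_modify_point(3)[OF D(3), of _ p]) (auto intro!: lebm)
      also have "(\<lambda>x. indicator D x *\<^sub>R (\<phi> x *\<^sub>R Dh x)) = (\<lambda>x. \<phi> x *\<^sub>R Dh x)"
        using \<phi>0 by (auto simp: indicator_def fun_eq_iff)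
      finally show ?thesis using lebi(2)[OF i(2)] by simp
    qed
    ultimately show "(\<integral>x. u x *\<^sub>R grad \<phi> x \<partial>lebesgue_on D) = - (\<integral>x. \<phi> x *\<^sub>R Dh x \<partial>lebesgue_on D)"
      by simp
  qed
  have sub: "integrable (lebesgue_on D) (\<lambda>x. (Dh x + sharp (T x)) \<bullet> grad \<zeta> x - Ksub * f x * u x * \<zeta> x) \<and>
      (\<integral>x. (Dh x + sharp (T x)) \<bullet> grad \<zeta> x - Ksub * f x * u x * \<zeta> x \<partial>lebesgue_on D) \<le> 0"
    if \<zeta>: "test_function D \<zeta>" and nn: "\<And>x. \<zeta> x \<ge> 0" for \<zeta>
  proof -
    obtain K where \<phi>: "C1_grad UNIV \<zeta> (grad \<zeta>)" "compact K" "K \<subseteq> ball p R" "\<And>x. x \<notin> K \<Longrightarrow> \<zeta> x = 0"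
      using \<zeta> unfolding D_def by (rule test_function_C1_grad) blast
    note test = R sub \<phi>
    define g where "g x = P x \<bullet> grad \<zeta> x - Ksub * F x * h x * \<zeta> x" for x
    have g: "integrable lebesgue g" "integral\<^sup>L lebesgue g \<le> 0"
      unfolding g_def[abs_def] using weak_subsolution_lebesgue[OF test nn] by auto
    have g0: "(\<lambda>x. indicator D x *\<^sub>R g x) = g"
      using test_grad_0[OF test] by (auto simp: indicator_def fun_eq_iff D_def g_def)
    have eq: "(Dh x + sharp (T x)) \<bullet> grad \<zeta> x - Ksub * f x * u x * \<zeta> x = g x" if "x \<in> D" "x \<noteq> p" for x
    proof -
      have x: "x \<in> \<Omega> - {p}" using that D\<Omega> by auto
      \<comment> \<open>The term Q \<rho>' q of the gradient of H cancels against the same term of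
        T; what remains is \<open>P\<close>.\<close>
      have "Dh x + sharp (T x) = P x"
        unfolding T[OF x] P_def Dh_def r_def r'_def q_def[symmetric] Q_def[symmetric]
        by (simp add: algebra_simps)
      then show ?thesis by (simp add: g_def f[OF x] uh[OF that])
    qed
    have "g \<in> borel_measurable lebesgue" using g(1) by auto
    from lebesgue_on_modify_point[OF D(3) this eq, simplified g0] g
    show ?thesis by auto
  qed
  show ?thesis
    using Ksub_pos D(1,2) D\<Omega> H12 sub by blast
qed

theorem theorem6:
  fixes C0 :: real
  assumes "CARD('n::{finite,linorder}) > 2" and "C0 > 0"
  shows "\<exists>\<epsilon>>0. \<forall>(\<Omega> :: 'n point set) p (\<rho> :: real \<Rightarrow> real) \<rho>' H
            (\<eta> :: 'n point \<Rightarrow> real) (\<Gamma> :: 'n point \<Rightarrow> 'n form) (\<omega> :: 'n point \<Rightarrow> 'n form) Q f T.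
      open \<Omega> \<and> connected \<Omega> \<and> bounded \<Omega> \<and> interior_sphere_condition \<Omega> \<and> p \<in> \<Omega> \<and>
      (\<forall>q\<ge>0. \<rho> q > 0 \<and> (\<rho> has_real_derivative \<rho>' q) (at q within {0..})) \<and>
      continuous_on {0..} \<rho>' \<and>
      (\<forall>q\<ge>0. (H has_real_derivative \<rho> q / 2 + q * \<rho>' q) (at q within {0..})) \<and> H 0 = 0 \<and>
      (\<forall>q\<ge>0. \<rho>' q > 0 \<longrightarrow> \<rho> q / 2 + q * \<rho>' q \<le> C0 * \<rho> q) \<and>
      (\<forall>q\<ge>0. \<rho>' q < 0 \<longrightarrow> \<rho> q / 2 + q * \<rho>' q \<ge> inverse C0 * \<rho> q) \<and>
      smooth_on (\<Omega> - {p}) \<eta> \<and> smooth_on (\<Omega> - {p}) \<omega> \<and>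
      (\<forall>x\<in>\<Omega> - {p}. homogeneous 1 (\<omega> x)) \<and>
      Q = (\<lambda>x. form_inner (\<omega> x) (\<omega> x)) \<and>
      (\<forall>x\<in>\<Omega> - {p}. \<Gamma> x = ext_d (zero_form \<eta>) x) \<and>
      (\<forall>x\<in>\<Omega> - {p}. ext_d \<omega> x = \<Gamma> x \<and>\<^sub>\<Lambda> \<omega> x) \<and>
      (\<forall>x\<in>\<Omega> - {p}. codiff 1 (\<lambda>y. \<rho> (Q y) *\<^sub>R \<omega> y) x = \<star> (\<Gamma> x \<and>\<^sub>\<Lambda> \<star> (\<rho> (Q x) *\<^sub>R \<omega> x))) \<and>
      Lp_on (2 * real CARD('n) / (real CARD('n) - 2)) \<Omega> (\<lambda>x. H (Q x)) \<and>
      f = (\<lambda>x. norm_nabla \<Gamma> x + form_inner (\<Gamma> x) (\<Gamma> x)) \<and>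
      Lp_on (real CARD('n) / 2) \<Omega> f \<and> Lp_norm (real CARD('n) / 2) \<Omega> f < \<epsilon> \<and>
      T = (\<lambda>x. (-1) ^ (3 * CARD('n)) *\<^sub>R
             \<star> (\<omega> x \<and>\<^sub>\<Lambda> \<star> (\<rho>' (Q x) *\<^sub>R (ext_d (zero_form Q) x \<and>\<^sub>\<Lambda> \<omega> x)))) \<longrightarrow>
      (\<exists>C>0. \<exists>D nablaH. open D \<and> p \<in> D \<and> D \<subseteq> \<Omega> \<and>
         H12_gradient D (\<lambda>x. H (Q x)) nablaH \<and>
         (\<forall>\<zeta>. test_function D \<zeta> \<and> (\<forall>x. \<zeta> x \<ge> 0) \<longrightarrow>
            integrable (lebesgue_on D)
              (\<lambda>x. (nablaH x + sharp (T x)) \<bullet> grad \<zeta> x - C * f x * H (Q x) * \<zeta> x) \<and>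
            (\<integral>x. (nablaH x + sharp (T x)) \<bullet> grad \<zeta> x - C * f x * H (Q x) * \<zeta> x
               \<partial>lebesgue_on D) \<le> 0))"
proof (rule exI[of _ 1], intro conjI allI impI)
  fix \<Omega> :: "'n point set" and p and \<rho> \<rho>' H :: "real \<Rightarrow> real" and \<eta> :: "'n point \<Rightarrow> real"
    and \<Gamma> \<omega> :: "'n point \<Rightarrow> 'n form" and Q f :: "'n point \<Rightarrow> real" and T :: "'n point \<Rightarrow> 'n form"
  let ?N = "real CARD('n)"
  assume A: "open \<Omega> \<and> connected \<Omega> \<and> bounded \<Omega> \<and> interior_sphere_condition \<Omega> \<and> p \<in> \<Omega> \<and>
      (\<forall>q\<ge>0. \<rho> q > 0 \<and> (\<rho> has_real_derivative \<rho>' q) (at q within {0..})) \<and>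
      continuous_on {0..} \<rho>' \<and>
      (\<forall>q\<ge>0. (H has_real_derivative \<rho> q / 2 + q * \<rho>' q) (at q within {0..})) \<and> H 0 = 0 \<and>
      (\<forall>q\<ge>0. \<rho>' q > 0 \<longrightarrow> \<rho> q / 2 + q * \<rho>' q \<le> C0 * \<rho> q) \<and>
      (\<forall>q\<ge>0. \<rho>' q < 0 \<longrightarrow> \<rho> q / 2 + q * \<rho>' q \<ge> inverse C0 * \<rho> q) \<and>
      smooth_on (\<Omega> - {p}) \<eta> \<and> smooth_on (\<Omega> - {p}) \<omega> \<and>
      (\<forall>x\<in>\<Omega> - {p}. homogeneous 1 (\<omega> x)) \<and>
      Q = (\<lambda>x. form_inner (\<omega> x) (\<omega> x)) \<and>
      (\<forall>x\<in>\<Omega> - {p}. \<Gamma> x = ext_d (zero_form \<eta>) x) \<and>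
      (\<forall>x\<in>\<Omega> - {p}. ext_d \<omega> x = \<Gamma> x \<and>\<^sub>\<Lambda> \<omega> x) \<and>
      (\<forall>x\<in>\<Omega> - {p}. codiff 1 (\<lambda>y. \<rho> (Q y) *\<^sub>R \<omega> y) x = \<star> (\<Gamma> x \<and>\<^sub>\<Lambda> \<star> (\<rho> (Q x) *\<^sub>R \<omega> x))) \<and>
      Lp_on (2 * ?N / (?N - 2)) \<Omega> (\<lambda>x. H (Q x)) \<and>
      f = (\<lambda>x. norm_nabla \<Gamma> x + form_inner (\<Gamma> x) (\<Gamma> x)) \<and>
      Lp_on (?N / 2) \<Omega> f \<and> Lp_norm (?N / 2) \<Omega> f < 1 \<and>
      T = (\<lambda>x. (-1) ^ (3 * CARD('n)) *\<^sub>R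
             \<star> (\<omega> x \<and>\<^sub>\<Lambda> \<star> (\<rho>' (Q x) *\<^sub>R (ext_d (zero_form Q) x \<and>\<^sub>\<Lambda> \<omega> x))))"
  define U where "U = \<Omega> - {p}"
  have open_\<Omega>: "open \<Omega>" and p: "p \<in> \<Omega>" and H0: "H 0 = 0"
    and \<rho>: "\<And>q. q \<ge> 0 \<Longrightarrow> \<rho> q > 0" "\<And>q. q \<ge> 0 \<Longrightarrow> (\<rho> has_real_derivative \<rho>' q) (at q within {0..})"
      "continuous_on {0..} \<rho>'"
    and H: "\<And>q. q \<ge> 0 \<Longrightarrow> (H has_real_derivative \<rho> q / 2 + q * \<rho>' q) (at q within {0..})"
    and growth: "\<And>q. q \<ge> 0 \<Longrightarrow> \<rho>' q > 0 \<Longrightarrow> \<rho> q / 2 + q * \<rho>' q \<le> C0 * \<rho> q"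
      "\<And>q. q \<ge> 0 \<Longrightarrow> \<rho>' q < 0 \<Longrightarrow> \<rho> q / 2 + q * \<rho>' q \<ge> inverse C0 * \<rho> q"
    and \<eta>: "smooth_on U \<eta>" and \<omega>: "smooth_on U \<omega>" and \<omega>1: "\<And>x. x \<in> U \<Longrightarrow> homogeneous 1 (\<omega> x)"
    and Q: "Q = (\<lambda>x. form_inner (\<omega> x) (\<omega> x))" and \<Gamma>: "\<And>x. x \<in> U \<Longrightarrow> \<Gamma> x = ext_d (zero_form \<eta>) x"
    and d\<omega>: "\<And>x. x \<in> U \<Longrightarrow> ext_d \<omega> x = \<Gamma> x \<and>\<^sub>\<Lambda> \<omega> x"
    and \<delta>\<omega>: "\<And>x. x \<in> U \<Longrightarrow> codiff 1 (\<lambda>y. \<rho> (Q y) *\<^sub>R \<omega> y) x = \<star> (\<Gamma> x \<and>\<^sub>\<Lambda> \<star> (\<rho> (Q x) *\<^sub>R \<omega> x))"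
    and H_Lp: "Lp_on (2 * ?N / (?N - 2)) \<Omega> (\<lambda>x. H (Q x))"
    and f: "f = (\<lambda>x. norm_nabla \<Gamma> x + form_inner (\<Gamma> x) (\<Gamma> x))" and f_Lp: "Lp_on (?N / 2) \<Omega> f"
    and T: "T = (\<lambda>x. (-1) ^ (3 * CARD('n)) *\<^sub>R
             \<star> (\<omega> x \<and>\<^sub>\<Lambda> \<star> (\<rho>' (Q x) *\<^sub>R (ext_d (zero_form Q) x \<and>\<^sub>\<Lambda> \<omega> x))))"
    using A unfolding U_def by blast+
  have open_U: "open U" using open_\<Omega> by (auto simp: U_def open_delete)
  define w where "w x = (if x \<in> U then sharp (\<omega> x) else 0)" for x
  define M where "M x = (if x \<in> U then \<chi> j i. partial_deriv i \<omega> x $ {j} else 0)" for x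
  define \<gamma> where "\<gamma> x = (if x \<in> U then sharp (\<Gamma> x) else 0)" for x
  define B where "B x = (if x \<in> U then \<chi> j i. partial_deriv i \<Gamma> x $ {j} else 0)" for x
  define F where "F x = (if x \<in> U then f x else 0)" for x
  have \<omega>C1: "Ck_on (Suc 0) U \<omega>" using \<omega> unfolding smooth_on_def by blast
  have w: "C1_grad U (\<lambda>x. w x $ j) (\<lambda>x. M x $ j)" for j
    by (rule C1_grad_cong[OF C1_grad_form_component[OF \<omega>C1, of "{j}"] open_U]) (auto simp: w_def M_def sharp_def)
  have \<gamma>: "C1_grad U (\<lambda>x. \<gamma> x $ j) (\<lambda>x. B x $ j)" for j
    by (rule C1_grad_cong[OF exact_1_form(2)[OF open_U \<eta> \<Gamma>, of j] open_U]) (auto simp: \<gamma>_def B_def sharp_def)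
  have \<Gamma>1: "homogeneous 1 (\<Gamma> x)" if "x \<in> U" for x by (rule exact_1_form(1)[OF open_U \<eta> \<Gamma> that])
  have Qw: "Q x = w x \<bullet> w x" if "x \<in> U" for x
    using that inner_sharp[OF \<omega>1[OF that]] by (simp add: Q form_inner_eq_inner w_def)
  have Qw_C1: "C1_grad U (\<lambda>x. w x \<bullet> w x) (\<lambda>x. 2 *\<^sub>R (w x v* M x))"
    by (rule C1_grad_inner_self[OF w])
  have Q_C1: "C1_grad U Q (\<lambda>x. 2 *\<^sub>R (w x v* M x))"
    by (rule C1_grad_cong[OF Qw_C1 open_U]) (simp_all add: Qw)
  have curl: "M x $ j $ i - M x $ i $ j = \<gamma> x $ i * w x $ j - \<gamma> x $ j * w x $ i" if x: "x \<in> U" for x i j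
  proof (cases "i = j")
    case False
    have "shuffle_sign {i} {j} * (partial_deriv i \<omega> x $ {j} - partial_deriv j \<omega> x $ {i})
        = shuffle_sign {i} {j} * (\<Gamma> x $ {i} * \<omega> x $ {j} - \<Gamma> x $ {j} * \<omega> x $ {i})"
      using d\<omega>[OF x] ext_d_1_form_nth[OF False, of \<omega> x] wedge_1_forms_nth[OF \<Gamma>1[OF x] False] by metis
    moreover have "shuffle_sign {i} {j} \<noteq> 0" by (simp add: shuffle_sign_singletons)
    ultimately show ?thesis using x by (simp add: M_def \<gamma>_def w_def sharp_def)
  qed simp
  have div: "(\<Sum>i\<in>UNIV. \<rho> (w x \<bullet> w x) * M x $ i $ i
         + w x $ i * (\<rho>' (w x \<bullet> w x) * (2 *\<^sub>R (w x v* M x)) $ i)) = - \<rho> (w x \<bullet> w x) * (\<gamma> x \<bullet> w x)" if x: "x \<in> U" for x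
  proof -
    let ?\<alpha> = "\<lambda>y. \<rho> (Q y) *\<^sub>R \<omega> y"
    \<comment> \<open>\<open>C1_grad_compose\<close> asks for this at every point, also off
      \<open>U\<close> where \<omega> need not be a 1-form; the inner product of full forms is
      nonnegative in any case.\<close>
    have Q_nn: "Q y \<in> {0..}" for y by (simp add: Q form_inner_eq_inner)
    have \<rho>Q: "C1_grad U (\<lambda>y. \<rho> (Q y)) (\<lambda>y. \<rho>' (Q y) *\<^sub>R (2 *\<^sub>R (w y v* M y)))"
      by (rule C1_grad_compose[OF Q_C1 Q_nn _ \<rho>(3)]) (use \<rho>(2) in auto)
    have d: "?\<alpha> differentiable (at x)"
      using \<omega>C1 x differentiableI[OF C1_gradD[OF \<rho>Q x]] by (intro differentiable_scaleR) auto
    have "partial_deriv i ?\<alpha> x $ {i} = \<rho> (Q x) * M x $ i $ i + w x $ i * (\<rho>' (Q x) * (2 *\<^sub>R (w x v* M x)) $ i)" for i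
    proof -
      have "C1_grad U (\<lambda>y. \<rho> (Q y) * w y $ i) (\<lambda>y. \<rho> (Q y) *\<^sub>R M y $ i + w y $ i *\<^sub>R (\<rho>' (Q y) *\<^sub>R (2 *\<^sub>R (w y v* M y))))"
        by (rule C1_grad_mult[OF \<rho>Q w])
      then have "C1_grad U (\<lambda>y. ?\<alpha> y $ {i}) (\<lambda>y. \<rho> (Q y) *\<^sub>R M y $ i + w y $ i *\<^sub>R (\<rho>' (Q y) *\<^sub>R (2 *\<^sub>R (w y v* M y))))"
        by (rule C1_grad_cong[OF _ open_U]) (auto simp: w_def sharp_def)
      from partial_deriv_C1_grad[OF this x] partial_deriv_nth(1)[OF d] show ?thesis by simp
    qed
    then have "(\<Sum>i\<in>UNIV. \<rho> (Q x) * M x $ i $ i + w x $ i * (\<rho>' (Q x) * (2 *\<^sub>R (w x v* M x)) $ i)) = - (codiff 1 ?\<alpha> x $ {})"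
      using codiff_1_form[OF d] by simp
    \<comment> \<open>The right-hand side of the second field equation is, at the empty index set,
      \<open>form_inner\<close> by definition.\<close>
    also have "codiff 1 ?\<alpha> x $ {} = form_inner (\<Gamma> x) (\<rho> (Q x) *\<^sub>R \<omega> x)"
      unfolding \<delta>\<omega>[OF x] form_inner_def ..
    also have "\<dots> = \<rho> (Q x) * (\<gamma> x \<bullet> w x)"
      using inner_sharp[OF \<Gamma>1[OF x], of "\<omega> x"] x by (simp add: form_inner_eq_inner \<gamma>_def w_def)
    finally show ?thesis using Qw[OF x] by simp
  qed
  have meas_\<Omega>: "\<Omega> \<in> sets lebesgue" "\<Omega> \<inter> space lebesgue \<in> sets lebesgue" using open_\<Omega> by auto
  have f_nn: "f x \<ge> 0" for x
    by (simp add: f form_inner_eq_inner norm_nabla_def sum_nonneg)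
  have f_meas: "(\<lambda>x. indicator \<Omega> x *\<^sub>R f x) \<in> borel_measurable lebesgue"
    using f_Lp borel_measurable_restrict_space_iff[OF meas_\<Omega>(2), of f] by (simp add: Lp_on_def)
  have F_meas: "F \<in> borel_measurable lebesgue"
    by (rule lebesgue_modify_point(1)[OF f_meas, of p]) (auto simp: F_def U_def)
  have F_int: "integrable lebesgue (\<lambda>x. F x powr (?N / 2))"
  proof -
    have i: "integrable lebesgue (\<lambda>x. indicator \<Omega> x *\<^sub>R (norm (f x) powr (?N / 2)))"
      using f_Lp integrable_restrict_space[OF meas_\<Omega>(2), of "\<lambda>x. norm (f x) powr (?N / 2)"] by (simp add: Lp_on_def)
    show ?thesis
      by (rule lebesgue_modify_point(2)[OF borel_measurable_integrable[OF i] _ i, of p])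
        (use f_nn in \<open>auto simp: F_def U_def\<close>)
  qed
  have F_ge: "norm (B x) + \<gamma> x \<bullet> \<gamma> x \<le> F x" for x
    using norm_Jacobian_le_norm_nabla[of \<Gamma> x] inner_sharp_le[of "\<Gamma> x"]
    by (auto simp: B_def \<gamma>_def F_def f form_inner_eq_inner)
  have H_int: "integrable lebesgue (\<lambda>x. \<bar>H (w x \<bullet> w x)\<bar> powr (2 * ?N / (?N - 2)))"
  proof -
    have i: "integrable lebesgue (\<lambda>x. indicator \<Omega> x *\<^sub>R (norm (H (Q x)) powr (2 * ?N / (?N - 2))))"
      using H_Lp integrable_restrict_space[OF meas_\<Omega>(2), of "\<lambda>x. norm (H (Q x)) powr (2 * ?N / (?N - 2))"]
      by (simp add: Lp_on_def)
    have "\<bar>H (w x \<bullet> w x)\<bar> powr (2 * ?N / (?N - 2)) = indicator \<Omega> x *\<^sub>R (norm (H (Q x)) powr (2 * ?N / (?N - 2)))"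
      if "x \<noteq> p" for x
      using that Qw[of x] H0 by (cases "x \<in> U") (auto simp: U_def w_def)
    then show ?thesis
      by (rule lebesgue_modify_point(2)[OF borel_measurable_integrable[OF i] _ i])
  qed
  have flow: "singular_flow \<Omega> p \<rho> \<rho>' H C0 w \<gamma> M B F"
    by unfold_locales
      (use assms open_\<Omega> p \<rho> H H0 growth w \<gamma> curl div F_meas F_int F_ge H_int
        in \<open>auto simp: U_def w_def M_def \<gamma>_def B_def\<close>)
  show "\<exists>C>0. \<exists>D nablaH. open D \<and> p \<in> D \<and> D \<subseteq> \<Omega> \<and>
         H12_gradient D (\<lambda>x. H (Q x)) nablaH \<and>
         (\<forall>\<zeta>. test_function D \<zeta> \<and> (\<forall>x. \<zeta> x \<ge> 0) \<longrightarrow>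
            integrable (lebesgue_on D)
              (\<lambda>x. (nablaH x + sharp (T x)) \<bullet> grad \<zeta> x - C * f x * H (Q x) * \<zeta> x) \<and>
            (\<integral>x. (nablaH x + sharp (T x)) \<bullet> grad \<zeta> x - C * f x * H (Q x) * \<zeta> x
               \<partial>lebesgue_on D) \<le> 0)"
  proof (rule singular_flow.weak_solution[OF flow])
    fix x assume "x \<in> \<Omega> - {p}"
    then have x: "x \<in> U" by (simp add: U_def)
    show "H (Q x) = H (w x \<bullet> w x)" by (simp add: Qw[OF x])
    show "f x = F x" using x by (simp add: F_def)
    let ?q = "2 *\<^sub>R (w x v* M x)"
    have dQ: "ext_d (zero_form Q) x = (\<Sum>i\<in>UNIV. ?q $ i *\<^sub>R dx i)"
      by (rule ext_d_zero_form[OF Q_C1 x])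
    have "sharp (T x) = (-1) ^ (3 * CARD('n)) *\<^sub>R sharp (\<star> (\<omega> x \<and>\<^sub>\<Lambda> \<star> (\<rho>' (Q x) *\<^sub>R (ext_d (zero_form Q) x \<and>\<^sub>\<Lambda> \<omega> x))))"
      unfolding T by (simp add: sharp_def vec_eq_iff)
    also have "\<dots> = ((-1) ^ (3 * CARD('n)) * ((-1) ^ CARD('n) * \<rho>' (Q x))) *\<^sub>R ((w x \<bullet> ?q) *\<^sub>R w x - (w x \<bullet> w x) *\<^sub>R ?q)"
      unfolding dQ sharp_triple[OF \<omega>1[OF x] sum_dx(1)] sum_dx(2) using x by (simp add: w_def)
    \<comment> \<open>The sign (-1)^(3n) in T compensates the (-1)^n of \<open>sharp_triple\<close>,
      since 4n is even.\<close>
    also have "(-1::real) ^ (3 * CARD('n)) * ((-1) ^ CARD('n) * \<rho>' (Q x)) = \<rho>' (Q x)"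
      by (simp add: power_mult power_mult_distrib[symmetric] flip: mult.assoc)
    finally show "sharp (T x) = \<rho>' (w x \<bullet> w x) *\<^sub>R ((w x \<bullet> ?q) *\<^sub>R w x - (w x \<bullet> w x) *\<^sub>R ?q)"
      by (simp only: Qw[OF x])
  qed
qed simp

end
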